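(* Let $V_+,V_-\in\mathbb{C}$ and let $\mathcal{L}$ be the operator on $L^2(\mathbb{R})$ with $\mathrm{Dom}(\mathcal{L})=H^2(\mathbb{R})$, $\mathcal{L}u=-u''+Vu$, where $V(x)=V_+$ for $x\ge0$ and $V(x)=V_-$ for $x<0$. The spectrum of $\mathcal{L}$ is $$\sigma(\mathcal{L})=[V_+,+\infty)\cup[V_-,+\infty).$$ Furthermore, the spectrum of $\mathcal{L}$ is purely continuous, i.e. $$\sigma_{\mathrm{p}}(\mathcal{L})=\emptyset,\qquad \sigma_{\mathrm{r}}(\mathcal{L})=\emptyset,\qquad \sigma_{\mathrm{c}}(\mathcal{L})=[V_+,+\infty)\cup[V_-,+\infty),$$ and all its essential spectra are identical: $$\sigma_{\mathrm{e}1}(\mathcal{L})=\sigma_{\mathrm{e}2}(\mathcal{L})=\sigma_{\mathrm{e}3}(\mathcal{L})=\sigma_{\mathrm{e}4}(\mathcal{L})=\sigma_{\mathrm{e}5}(\mathcal{L})=[V_+,+\infty)\cup[V_-,+\infty).$$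
   Context: For $C\in\mathbb{C}$, $[C,+\infty):=\{C+t:t\ge0\}$. For a closed densely defined operator $S$ on a Hilbert space $\mathcal{H}$: $\sigma_{\mathrm{p}}(S)$ is the set of $z\in\mathbb{C}$ such that $S-z$ is not injective; $\sigma_{\mathrm{r}}(S)$ is the set of $z$ such that $S-z$ is injective and $\overline{\mathrm{Ran}(S-z)}\subsetneq\mathcal{H}$; $\sigma_{\mathrm{c}}(S)$ is the set of $z$ such that $S-z$ is injective, $\overline{\mathrm{Ran}(S-z)}=\mathcal{H}$ and $\mathrm{Ran}(S-z)\subsetneq\mathcal{H}$. Essential spectra (in the sense of Edmunds–Evans): $\sigma_{\mathrm{e}k}(S)=\mathbb{C}\setminus\Delta_k(S)$, $k=1,\dots,5$, where $\Delta_1(S)$ is the set of $z$ such that $S-z$ is semi-Fredholm, i.e. has closed range and $\dim\mathrm{Ker}(S-z)<\infty$ or $\mathrm{codim}\,\mathrm{Ran}(S-z)<\infty$; $\Delta_2(S)$ is the set of $z$ such that $\mathrm{Ran}(S-z)$ is closed and $\dim\mathrm{Ker}(S-z)<\infty$; $\Delta_3(S)$ is the set of $z$ such that $S-z$ is Fredholm (closed range, finite-dimensional kernel, finite-codimensional range); $\Delta_4(S)$ is the set of $z$ such that $S-z$ is Fredholm of index $0$; $\Delta_5(S)$ is the union of all connected components of $\Delta_1(S)$ that intersect the resolvent set $\rho(S)$. *)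

theory Defs
  imports "HOL-Analysis.Analysis"
begin

section \<open>Complex normed spaces\<close>

class complex_normed_vector = real_normed_vector +
  fixes scaleC :: "complex \<Rightarrow> 'a \<Rightarrow> 'a"  (infixr \<open>*\<^sub>C\<close> 75)
  assumes scaleC_add_right: "a *\<^sub>C (x + y) = a *\<^sub>C x + a *\<^sub>C y"
    and scaleC_add_left: "(a + b) *\<^sub>C x = a *\<^sub>C x + b *\<^sub>C x"
    and scaleC_scaleC: "a *\<^sub>C b *\<^sub>C x = (a * b) *\<^sub>C x"
    and scaleC_of_real: "complex_of_real r *\<^sub>C x = r *\<^sub>R x"
    and norm_scaleC: "norm (a *\<^sub>C x) = cmod a * norm x"

interpretation complex_vector: vector_space "scaleC :: complex \<Rightarrow> 'a \<Rightarrow> 'a::complex_normed_vector"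
proof
  fix x :: 'a
  show "1 *\<^sub>C x = x"
    using scaleC_of_real[of 1 x] by simp
qed (simp_all add: scaleC_add_right scaleC_add_left scaleC_scaleC)

text \<open>Dimension and codimension are over the complex numbers, so
  \<^const>\<open>vector_space.dim\<close> is used for the scalar multiplication \<^const>\<open>scaleC\<close>.  It is only
  meaningful for finite-dimensional subspaces, hence the separate finiteness predicates.
  The codimension of a subspace is the dimension of an algebraic complement, that is, of the
  quotient space.\<close>

definition finite_cdim :: "'a::complex_normed_vector set \<Rightarrow> bool" where
  "finite_cdim W \<longleftrightarrow> (\<exists>B. finite B \<and> complex_vector.span B = W)"

definition algebraic_complement ::
    "'a::complex_normed_vector set \<Rightarrow> 'a set \<Rightarrow> bool" where
  "algebraic_complement W C \<longleftrightarrow>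
     complex_vector.subspace C \<and> W \<inter> C = {0} \<and> (\<forall>x. \<exists>w\<in>W. \<exists>c\<in>C. x = w + c)"

definition finite_ccodim :: "'a::complex_normed_vector set \<Rightarrow> bool" where
  "finite_ccodim W \<longleftrightarrow> (\<exists>C. algebraic_complement W C \<and> finite_cdim C)"

definition ccodim :: "'a::complex_normed_vector set \<Rightarrow> nat" where
  "ccodim W = complex_vector.dim (SOME C. algebraic_complement W C)"


section \<open>Unbounded operators and their spectra\<close>

text \<open>The values of the action outside the domain are irrelevant.\<close>

datatype 'a unbounded_op = Unbounded_Op (Dom: "'a set") (act: "'a \<Rightarrow> 'a")

definition shift_op ::
    "'a::complex_normed_vector unbounded_op \<Rightarrow> complex \<Rightarrow> 'a unbounded_op" where
  "shift_op S z = Unbounded_Op (Dom S) (\<lambda>u. act S u - z *\<^sub>C u)"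

definition op_injective :: "'a unbounded_op \<Rightarrow> bool" where
  "op_injective S \<longleftrightarrow> inj_on (act S) (Dom S)"

definition Ker :: "'a::zero unbounded_op \<Rightarrow> 'a set" where
  "Ker S = {u \<in> Dom S. act S u = 0}"

definition Ran :: "'a unbounded_op \<Rightarrow> 'a set" where
  "Ran S = act S ` Dom S"

text \<open>For a closed operator on a Hilbert space the boundedness of the inverse is automatic.\<close>

definition resolvent_set :: "'a::complex_normed_vector unbounded_op \<Rightarrow> complex set" where
  "resolvent_set S = {z. op_injective (shift_op S z) \<and> Ran (shift_op S z) = UNIV \<and>
     (\<exists>K. \<forall>u\<in>Dom S. norm u \<le> K * norm (act (shift_op S z) u))}"

definition spectrum :: "'a::complex_normed_vector unbounded_op \<Rightarrow> complex set" where
  "spectrum S = - resolvent_set S"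

definition point_spectrum :: "'a::complex_normed_vector unbounded_op \<Rightarrow> complex set" where
  "point_spectrum S = {z. \<not> op_injective (shift_op S z)}"

definition residual_spectrum :: "'a::complex_normed_vector unbounded_op \<Rightarrow> complex set" where
  "residual_spectrum S =
     {z. op_injective (shift_op S z) \<and> closure (Ran (shift_op S z)) \<subset> UNIV}"

definition continuous_spectrum :: "'a::complex_normed_vector unbounded_op \<Rightarrow> complex set" where
  "continuous_spectrum S =
     {z. op_injective (shift_op S z) \<and> closure (Ran (shift_op S z)) = UNIV \<and>
         Ran (shift_op S z) \<subset> UNIV}"

definition semi_Fredholm :: "'a::complex_normed_vector unbounded_op \<Rightarrow> bool" where
  "semi_Fredholm S \<longleftrightarrow> closed (Ran S) \<and> (finite_cdim (Ker S) \<or> finite_ccodim (Ran S))"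

definition Fredholm :: "'a::complex_normed_vector unbounded_op \<Rightarrow> bool" where
  "Fredholm S \<longleftrightarrow> closed (Ran S) \<and> finite_cdim (Ker S) \<and> finite_ccodim (Ran S)"

definition Fredholm_index :: "'a::complex_normed_vector unbounded_op \<Rightarrow> int" where
  "Fredholm_index S = int (complex_vector.dim (Ker S)) - int (ccodim (Ran S))"

definition Delta1 :: "'a::complex_normed_vector unbounded_op \<Rightarrow> complex set" where
  "Delta1 S = {z. semi_Fredholm (shift_op S z)}"

definition Delta2 :: "'a::complex_normed_vector unbounded_op \<Rightarrow> complex set" where
  "Delta2 S = {z. closed (Ran (shift_op S z)) \<and> finite_cdim (Ker (shift_op S z))}"

definition Delta3 :: "'a::complex_normed_vector unbounded_op \<Rightarrow> complex set" where
  "Delta3 S = {z. Fredholm (shift_op S z)}"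

definition Delta4 :: "'a::complex_normed_vector unbounded_op \<Rightarrow> complex set" where
  "Delta4 S = {z. Fredholm (shift_op S z) \<and> Fredholm_index (shift_op S z) = 0}"

definition Delta5 :: "'a::complex_normed_vector unbounded_op \<Rightarrow> complex set" where
  "Delta5 S = \<Union>{C \<in> components (Delta1 S). C \<inter> resolvent_set S \<noteq> {}}"

definition ess_spectrum1 :: "'a::complex_normed_vector unbounded_op \<Rightarrow> complex set" where
  "ess_spectrum1 S = - Delta1 S"

definition ess_spectrum2 :: "'a::complex_normed_vector unbounded_op \<Rightarrow> complex set" where
  "ess_spectrum2 S = - Delta2 S"

definition ess_spectrum3 :: "'a::complex_normed_vector unbounded_op \<Rightarrow> complex set" where
  "ess_spectrum3 S = - Delta3 S"

definition ess_spectrum4 :: "'a::complex_normed_vector unbounded_op \<Rightarrow> complex set" where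
  "ess_spectrum4 S = - Delta4 S"

definition ess_spectrum5 :: "'a::complex_normed_vector unbounded_op \<Rightarrow> complex set" where
  "ess_spectrum5 S = - Delta5 S"


section \<open>The space of square-integrable functions on the real line\<close>

definition square_integrable :: "(real \<Rightarrow> complex) \<Rightarrow> bool" where
  "square_integrable f \<longleftrightarrow>
     f \<in> borel_measurable lborel \<and> integrable lborel (\<lambda>x. (cmod (f x))\<^sup>2)"

lemma square_integrable_measurable [measurable_dest]:
  "square_integrable f \<Longrightarrow> f \<in> borel_measurable lborel"
  by (simp add: square_integrable_def)

lemma square_integrable_zero: "square_integrable (\<lambda>x. 0)"
  by (simp add: square_integrable_def)

lemma square_integrable_bounded_mult:
  assumes "square_integrable f" "m \<in> borel_measurable lborel" "\<And>x. cmod (m x) \<le> K"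
  shows "square_integrable (\<lambda>x. m x * f x)"
proof -
  have [measurable]: "f \<in> borel_measurable borel" "m \<in> borel_measurable borel"
    using assms by (auto simp: square_integrable_def)
  have "integrable lborel (\<lambda>x. K\<^sup>2 * (cmod (f x))\<^sup>2)"
    using assms by (auto simp: square_integrable_def)
  then have "integrable lborel (\<lambda>x. (cmod (m x * f x))\<^sup>2)"
  proof (rule Bochner_Integration.integrable_bound)
    have "(cmod (m x))\<^sup>2 \<le> K\<^sup>2" for x
      using assms(3)[of x] by (intro power_mono) auto
    then show "AE x in lborel. norm ((cmod (m x * f x))\<^sup>2) \<le> norm (K\<^sup>2 * (cmod (f x))\<^sup>2)"
      by (auto simp: norm_mult power_mult_distrib intro!: mult_right_mono)
  qed simp
  then show ?thesis
    by (simp add: square_integrable_def)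
qed

lemma square_integrable_add:
  assumes "square_integrable f" "square_integrable g"
  shows "square_integrable (\<lambda>x. f x + g x)"
proof -
  have [measurable]: "f \<in> borel_measurable borel" "g \<in> borel_measurable borel"
    using assms by (auto simp: square_integrable_def)
  have "integrable lborel (\<lambda>x. 2 * (cmod (f x))\<^sup>2 + 2 * (cmod (g x))\<^sup>2)"
    using assms by (auto simp: square_integrable_def)
  then have "integrable lborel (\<lambda>x. (cmod (f x + g x))\<^sup>2)"
  proof (rule Bochner_Integration.integrable_bound)
    have "(cmod (f x + g x))\<^sup>2 \<le> 2 * (cmod (f x))\<^sup>2 + 2 * (cmod (g x))\<^sup>2" for x
    proof -
      have "(cmod (f x + g x))\<^sup>2 \<le> (cmod (f x) + cmod (g x))\<^sup>2"
        by (intro power_mono norm_triangle_ineq) auto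
      also have "\<dots> \<le> 2 * (cmod (f x))\<^sup>2 + 2 * (cmod (g x))\<^sup>2"
        using zero_le_power2[of "cmod (f x) - cmod (g x)"]
        by (simp add: power2_sum power2_diff)
      finally show ?thesis .
    qed
    then show "AE x in lborel. norm ((cmod (f x + g x))\<^sup>2)
        \<le> norm (2 * (cmod (f x))\<^sup>2 + 2 * (cmod (g x))\<^sup>2)"
      by auto
  qed simp
  then show ?thesis
    by (simp add: square_integrable_def)
qed

lemma square_integrable_cmult: "square_integrable f \<Longrightarrow> square_integrable (\<lambda>x. c * f x)"
  by (rule square_integrable_bounded_mult[where K = "cmod c"]) auto

lemma square_integrable_uminus: "square_integrable f \<Longrightarrow> square_integrable (\<lambda>x. - f x)"
  using square_integrable_cmult[of f "-1"] by simp

lemma square_integrable_diff: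
  "square_integrable f \<Longrightarrow> square_integrable g \<Longrightarrow> square_integrable (\<lambda>x. f x - g x)"
  using square_integrable_add[OF _ square_integrable_uminus, of f g] by simp

lemma square_integrable_scaleR: "square_integrable f \<Longrightarrow> square_integrable (\<lambda>x. r *\<^sub>R f x)"
  using square_integrable_cmult[of f "of_real r"] by (simp add: scaleR_conv_of_real)

lemma integrable_inner_square_integrable:
  assumes "square_integrable f" "square_integrable g"
  shows "integrable lborel (\<lambda>x. f x \<bullet> g x)"
proof -
  have [measurable]: "f \<in> borel_measurable borel" "g \<in> borel_measurable borel"
    using assms by (auto simp: square_integrable_def)
  have "integrable lborel (\<lambda>x. (cmod (f x))\<^sup>2 + (cmod (g x))\<^sup>2)"
    using assms by (auto simp: square_integrable_def)
  then show ?thesis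
  proof (rule Bochner_Integration.integrable_bound)
    have "\<bar>f x \<bullet> g x\<bar> \<le> (cmod (f x))\<^sup>2 + (cmod (g x))\<^sup>2" for x
    proof -
      have "\<bar>f x \<bullet> g x\<bar> \<le> cmod (f x) * cmod (g x)"
        by (rule Cauchy_Schwarz_ineq2)
      also have "\<dots> \<le> (cmod (f x))\<^sup>2 + (cmod (g x))\<^sup>2"
        using zero_le_power2[of "cmod (f x) - cmod (g x)", unfolded power2_diff]
          mult_nonneg_nonneg[OF norm_ge_zero[of "f x"] norm_ge_zero[of "g x"]]
        by linarith
      finally show ?thesis .
    qed
    then show "AE x in lborel. norm (f x \<bullet> g x) \<le> norm ((cmod (f x))\<^sup>2 + (cmod (g x))\<^sup>2)"
      by auto
  qed simp
qed

definition eq_AE :: "(real \<Rightarrow> complex) \<Rightarrow> (real \<Rightarrow> complex) \<Rightarrow> bool" where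
  "eq_AE f g \<longleftrightarrow> square_integrable f \<and> square_integrable g \<and> (AE x in lborel. f x = g x)"

quotient_type L2_line = "real \<Rightarrow> complex" / partial: eq_AE
proof (rule part_equivpI)
  show "\<exists>f. eq_AE f f"
    using square_integrable_zero by (auto simp: eq_AE_def)
  show "symp eq_AE"
    by (auto simp: symp_def eq_AE_def elim: eventually_mono)
  show "transp eq_AE"
    by (auto simp: transp_def eq_AE_def)
qed

text \<open>\<open>inner\<close> is the real part of the usual complex inner product; the norm it induces is the
  L2 norm.\<close>

instantiation L2_line :: real_inner
begin

lift_definition zero_L2_line :: L2_line is "\<lambda>x. 0"
  by (simp add: eq_AE_def square_integrable_zero)

lift_definition plus_L2_line :: "L2_line \<Rightarrow> L2_line \<Rightarrow> L2_line" is "\<lambda>f g x. f x + g x"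
  by (auto simp: eq_AE_def square_integrable_add)

lift_definition uminus_L2_line :: "L2_line \<Rightarrow> L2_line" is "\<lambda>f x. - f x"
  by (auto simp: eq_AE_def square_integrable_uminus)

lift_definition minus_L2_line :: "L2_line \<Rightarrow> L2_line \<Rightarrow> L2_line" is "\<lambda>f g x. f x - g x"
  by (auto simp: eq_AE_def square_integrable_diff)

lift_definition scaleR_L2_line :: "real \<Rightarrow> L2_line \<Rightarrow> L2_line" is "\<lambda>r f x. r *\<^sub>R f x"
  by (auto simp: eq_AE_def square_integrable_scaleR)

lift_definition inner_L2_line :: "L2_line \<Rightarrow> L2_line \<Rightarrow> real" is
  "\<lambda>f g. LINT x|lborel. f x \<bullet> g x"
  by (rule integral_cong_AE) (auto simp: eq_AE_def square_integrable_def)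

lift_definition norm_L2_line :: "L2_line \<Rightarrow> real" is
  "\<lambda>f. sqrt (LINT x|lborel. (cmod (f x))\<^sup>2)"
  by (rule arg_cong[where f = sqrt], rule integral_cong_AE)
    (auto simp: eq_AE_def square_integrable_def)

definition "sgn_L2_line (u :: L2_line) = inverse (norm u) *\<^sub>R u"

definition "dist_L2_line (u :: L2_line) v = norm (u - v)"

definition "(uniformity :: (L2_line \<times> L2_line) filter) =
  (INF e\<in>{0<..}. principal {(u, v). dist u v < e})"

definition "open_L2_line (U :: L2_line set) \<longleftrightarrow>
  (\<forall>u\<in>U. eventually (\<lambda>(u', v). u' = u \<longrightarrow> v \<in> U) uniformity)"

instance
proof
  fix u v w :: L2_line and a b :: real and U :: "L2_line set"
  show "u + v + w = u + (v + w)"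
    by transfer (auto simp: eq_AE_def add.assoc intro!: square_integrable_add)
  show "u + v = v + u"
    by transfer (auto simp: eq_AE_def add.commute intro!: square_integrable_add)
  show "0 + u = u"
    by transfer (auto simp: eq_AE_def)
  show "- u + u = 0"
    by transfer (auto simp: eq_AE_def square_integrable_zero)
  show "u - v = u + - v"
    by transfer (auto simp: eq_AE_def square_integrable_diff)
  show "a *\<^sub>R (u + v) = a *\<^sub>R u + a *\<^sub>R v"
    by transfer (auto simp: eq_AE_def scaleR_add_right
        intro!: square_integrable_add square_integrable_scaleR)
  show "(a + b) *\<^sub>R u = a *\<^sub>R u + b *\<^sub>R u"
    by transfer (auto simp: eq_AE_def scaleR_add_left
        intro!: square_integrable_add square_integrable_scaleR)
  show "a *\<^sub>R b *\<^sub>R u = (a * b) *\<^sub>R u"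
    by transfer (auto simp: eq_AE_def intro!: square_integrable_scaleR)
  show "1 *\<^sub>R u = u"
    by transfer (auto simp: eq_AE_def)
  show "sgn u = inverse (norm u) *\<^sub>R u"
    by (rule sgn_L2_line_def)
  show "dist u v = norm (u - v)"
    by (rule dist_L2_line_def)
  show "(uniformity :: (L2_line \<times> L2_line) filter) =
      (INF e\<in>{0<..}. principal {(u, v). dist u v < e})"
    by (rule uniformity_L2_line_def)
  show "open U \<longleftrightarrow> (\<forall>u\<in>U. eventually (\<lambda>(u', v). u' = u \<longrightarrow> v \<in> U) uniformity)"
    by (rule open_L2_line_def)
  show "u \<bullet> v = v \<bullet> u"
    by transfer (simp add: inner_commute)
  show "(u + v) \<bullet> w = u \<bullet> w + v \<bullet> w"
    by transfer
      (simp add: eq_AE_def inner_add_left integrable_inner_square_integrable)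
  show "(a *\<^sub>R u) \<bullet> v = a * (u \<bullet> v)"
    by transfer simp
  show "0 \<le> u \<bullet> u"
    by transfer (simp add: integral_nonneg_AE)
  show "u \<bullet> u = 0 \<longleftrightarrow> u = 0"
  proof transfer
    fix f assume "eq_AE f f"
    then have f: "square_integrable f"
      by (simp add: eq_AE_def)
    have "(LINT x|lborel. f x \<bullet> f x) = 0 \<longleftrightarrow> (AE x in lborel. f x \<bullet> f x = 0)"
      by (rule integral_nonneg_eq_0_iff_AE[OF integrable_inner_square_integrable[OF f f]]) auto
    then show "(LINT x|lborel. f x \<bullet> f x) = 0 \<longleftrightarrow> eq_AE f (\<lambda>x. 0)"
      using f by (simp add: eq_AE_def square_integrable_zero)
  qed
  show "norm u = sqrt (u \<bullet> u)"
    by transfer (simp add: power2_norm_eq_inner)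
qed

end

instantiation L2_line :: complex_normed_vector
begin

lift_definition scaleC_L2_line :: "complex \<Rightarrow> L2_line \<Rightarrow> L2_line" is "\<lambda>c f x. c * f x"
  by (auto simp: eq_AE_def square_integrable_cmult)

instance
proof
  fix u v :: L2_line and a b :: complex and r :: real
  show "a *\<^sub>C (u + v) = a *\<^sub>C u + a *\<^sub>C v"
    by transfer (auto simp: eq_AE_def distrib_left
        intro!: square_integrable_add square_integrable_cmult)
  show "(a + b) *\<^sub>C u = a *\<^sub>C u + b *\<^sub>C u"
    by transfer (auto simp: eq_AE_def distrib_right
        intro!: square_integrable_add square_integrable_cmult)
  show "a *\<^sub>C b *\<^sub>C u = (a * b) *\<^sub>C u"
    by transfer (auto simp: eq_AE_def mult.assoc intro!: square_integrable_cmult)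
  show "complex_of_real r *\<^sub>C u = r *\<^sub>R u"
    by transfer (auto simp: eq_AE_def scaleR_conv_of_real intro!: square_integrable_cmult)
  show "norm (a *\<^sub>C u) = cmod a * norm u"
    by transfer (simp add: norm_mult power_mult_distrib real_sqrt_mult)
qed

end


section \<open>The Sobolev space of order two and the Schroedinger operator\<close>

definition test_function :: "(real \<Rightarrow> real) \<Rightarrow> bool" where
  "test_function \<phi> \<longleftrightarrow>
     (\<forall>n. (deriv ^^ n) \<phi> differentiable_on UNIV) \<and> compact (closure {x. \<phi> x \<noteq> 0})"

lemma test_function_measurable:
  assumes "test_function \<phi>"
  shows "\<phi> \<in> borel_measurable borel" "deriv \<phi> \<in> borel_measurable borel"
proof -
  have d: "(deriv ^^ n) \<phi> differentiable_on UNIV" for n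
    using assms by (simp add: test_function_def)
  show "\<phi> \<in> borel_measurable borel"
    using differentiable_imp_continuous_on[OF d[of 0]]
    by (simp add: borel_measurable_continuous_onI)
  show "deriv \<phi> \<in> borel_measurable borel"
    using differentiable_imp_continuous_on[OF d[of 1]]
    by (simp add: borel_measurable_continuous_onI)
qed

text \<open>Real-valued test functions determine the same weak derivatives as complex-valued ones, by
  linearity.\<close>

lift_definition has_weak_deriv :: "L2_line \<Rightarrow> L2_line \<Rightarrow> bool" is
  "\<lambda>f g. \<forall>\<phi>. test_function \<phi> \<longrightarrow>
     (LINT x|lborel. f x * of_real (deriv \<phi> x)) = - (LINT x|lborel. g x * of_real (\<phi> x))"
proof -
  fix f f' g g' :: "real \<Rightarrow> complex"
  assume eq: "eq_AE f f'" "eq_AE g g'"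
  have m [measurable]: "f \<in> borel_measurable borel" "f' \<in> borel_measurable borel"
      "g \<in> borel_measurable borel" "g' \<in> borel_measurable borel"
    using eq by (auto simp: eq_AE_def square_integrable_def)
  have "(LINT x|lborel. f x * of_real (deriv \<phi> x)) = (LINT x|lborel. f' x * of_real (deriv \<phi> x))
      \<and> (LINT x|lborel. g x * of_real (\<phi> x)) = (LINT x|lborel. g' x * of_real (\<phi> x))"
    if "test_function \<phi>" for \<phi>
  proof -
    note [measurable] = test_function_measurable[OF that]
    show ?thesis
      using eq by (intro conjI integral_cong_AE) (auto simp: eq_AE_def)
  qed
  then show "(\<forall>\<phi>. test_function \<phi> \<longrightarrow>
      (LINT x|lborel. f x * of_real (deriv \<phi> x)) = - (LINT x|lborel. g x * of_real (\<phi> x))) =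
    (\<forall>\<phi>. test_function \<phi> \<longrightarrow>
      (LINT x|lborel. f' x * of_real (deriv \<phi> x)) = - (LINT x|lborel. g' x * of_real (\<phi> x)))"
    by simp
qed

text \<open>A weak derivative is unique as an element of the quotient.\<close>

definition weak_deriv :: "L2_line \<Rightarrow> L2_line" where
  "weak_deriv u = (THE v. has_weak_deriv u v)"

definition H2_line :: "L2_line set" where
  "H2_line = {u. \<exists>v w. has_weak_deriv u v \<and> has_weak_deriv v w}"

definition step_potential :: "complex \<Rightarrow> complex \<Rightarrow> real \<Rightarrow> complex" where
  "step_potential Vp Vm x = (if x \<ge> 0 then Vp else Vm)"

lift_definition step_mult :: "complex \<Rightarrow> complex \<Rightarrow> L2_line \<Rightarrow> L2_line" is
  "\<lambda>Vp Vm f x. step_potential Vp Vm x * f x"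
proof -
  fix Vp Vm :: complex and f g :: "real \<Rightarrow> complex"
  assume "eq_AE f g"
  moreover have "step_potential Vp Vm \<in> borel_measurable lborel"
    unfolding step_potential_def by simp
  moreover have "cmod (step_potential Vp Vm x) \<le> max (cmod Vp) (cmod Vm)" for x
    by (simp add: step_potential_def)
  ultimately show "eq_AE (\<lambda>x. step_potential Vp Vm x * f x) (\<lambda>x. step_potential Vp Vm x * g x)"
    by (auto simp: eq_AE_def
        intro!: square_integrable_bounded_mult[where K = "max (cmod Vp) (cmod Vm)"])
qed

definition step_schroedinger :: "complex \<Rightarrow> complex \<Rightarrow> L2_line unbounded_op" where
  "step_schroedinger Vp Vm =
     Unbounded_Op H2_line (\<lambda>u. - weak_deriv (weak_deriv u) + step_mult Vp Vm u)"

definition half_line :: "complex \<Rightarrow> complex set" where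
  "half_line C = {C + of_real t | t. t \<ge> 0}"

end

theory Submission
  imports Defs
begin

text \<open>Why the theorem holds.  Fix \<open>z\<close> and write \<open>Vp - z = a\<^sup>2\<close>, \<open>Vm - z = b\<^sup>2\<close> with \<open>Re a \<ge> 0\<close>,
\<open>Re b \<ge> 0\<close> (\<open>a\<close> and \<open>b\<close> are the values of \<^const>\<open>csqrt\<close>).  Then \<open>z\<close> lies on the half-line that starts
at \<open>Vp\<close> iff \<open>Re a = 0\<close>, and on the one that starts at \<open>Vm\<close> iff \<open>Re b = 0\<close>.  The du Bois-Reymond lemma
identifies weak derivatives with indefinite Lebesgue integrals, so \<open>(L - z) u = f\<close> becomes the
ordinary differential equation \<open>U'' = a\<^sup>2 U - f\<close> on \<open>x > 0\<close> and \<open>U'' = b\<^sup>2 U - f\<close> on \<open>x < 0\<close>, with \<open>U\<close> and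
\<open>U'\<close> continuous at \<open>0\<close> (\<open>schroedinger_eq_iff_line_sol\<close>).  Each side is treated as a problem on
\<open>[0, \<infinity>)\<close>, the left one after the reflection \<open>x \<mapsto> - x\<close>, and each splits into first-order equations by
\<open>\<partial>\<^sup>2 - a\<^sup>2 = (\<partial> - a) (\<partial> + a)\<close>.

Injectivity holds for every \<open>z\<close> (\<open>line_sol_unique\<close>): a square-integrable solution of the
homogeneous equation satisfies \<open>U'(0) = - a U(0) = b U(0)\<close>, and \<open>U(0) = 0\<close> if \<open>Re a = 0\<close> or \<open>Re b = 0\<close>.
If both real parts are positive, \<open>a + b \<noteq> 0\<close> forces \<open>U(0) = 0\<close> as well.

Off both half-lines the equation is solved on each side by solutions that are square-integrable
and depend on the free value \<open>U(0)\<close>.  Matching \<open>U'(0)\<close> determines this value, because \<open>a + b \<noteq> 0\<close>, and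
energy estimates, that is, the equation for \<open>(|U|\<^sup>2)'\<close>, bound the norm of \<open>U\<close> by that of \<open>f\<close>
(\<open>line_resolvent\<close>).

On a half-line, say for \<open>Re a = 0\<close>, the range is not everything: \<open>f(x) = e\<^sup>a\<^sup>x / (1 + x)\<close> on \<open>x \<ge> 0\<close> is in
resonance with the equation, and \<open>U' + a U\<close> would grow like the logarithm
(\<open>resonant_no_half_L2_solution\<close>).  The range is nevertheless dense (\<open>line_range_dense\<close>): for \<open>f\<close> of
compact support there is a solution \<open>U\<close> that vanishes far on the left and grows at most linearly on
the right; multiplying it by a slowly decaying factor puts it in the domain and changes the
right-hand side arbitrarily little.

The rest is formal (\<open>purely_continuous_spectrum\<close>).  A range that is dense and not everything is not
closed, so no such \<open>z\<close> is in any of the sets \<open>\<Delta>\<^sub>k\<close>; points of the resolvent set are in \<open>\<Delta>\<^sub>1\<close> to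
\<open>\<Delta>\<^sub>4\<close>; and \<open>\<Delta>\<^sub>1\<close> being the resolvent set, every component of it meets the resolvent set.\<close>

section \<open>Absolutely continuous functions on a half-line\<close>

text \<open>\<open>F\<close> is absolutely continuous on \<open>[0, \<infinity>)\<close> with derivative \<open>f\<close>.  The base point is
\<open>0\<close> because the potential is constant on either side of it; the left side is reflected.\<close>

definition half_prim :: "(real \<Rightarrow> complex) \<Rightarrow> (real \<Rightarrow> complex) \<Rightarrow> bool" where
  "half_prim F f \<longleftrightarrow> (\<forall>x\<ge>0. set_integrable lborel {0..x} f \<and>
     F x - F 0 = (LINT y:{0..x}|lborel. f y))"

lemma half_primD:
  assumes "half_prim F f" "0 \<le> x"
  shows "set_integrable lborel {0..x} f" "F x - F 0 = (LINT y:{0..x}|lborel. f y)"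
  using assms unfolding half_prim_def by blast+

lemma half_prim_continuous:
  assumes "half_prim F f"
  shows "continuous_on {0..x} F"
proof (cases "0 \<le> x")
  case True
  note D = half_primD[OF assms]
  have eq: "F 0 + integral {0..y} f = F y" if "y \<in> {0..x}" for y
    using D(2)[of y] set_borel_integral_eq_integral(2)[OF D(1)[of y]] that
    by (simp add: diff_eq_eq add.commute)
  have "f integrable_on {0..x}"
    using set_borel_integral_eq_integral(1)[OF D(1)[OF True]] .
  then have "continuous_on {0..x} (\<lambda>y. F 0 + integral {0..y} f)"
    by (intro continuous_intros indefinite_integral_continuous_1)
  then show ?thesis
    by (rule continuous_on_eq) (simp add: eq)
qed simp

lemma set_integrable_continuous_mult:
  fixes F f :: "real \<Rightarrow> complex"
  assumes F: "continuous_on {a..b} F" and f: "set_integrable lborel {a..b} f"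
  shows "set_integrable lborel {a..b} (\<lambda>x. F x * f x)"
proof -
  have "bounded (F ` {a..b})"
    by (intro compact_imp_bounded compact_continuous_image F compact_Icc)
  then obtain B where "\<forall>y\<in>F ` {a..b}. norm y \<le> B"
    unfolding bounded_iff by blast
  then have B: "norm (F x) \<le> B" if "x \<in> {a..b}" for x
    using that by blast
  have mF: "(\<lambda>x. indicator {a..b} x *\<^sub>R F x) \<in> borel_measurable lborel"
    using borel_integrable_atLeastAtMost'[OF F] by (simp add: set_integrable_def)
  have mf: "(\<lambda>x. indicator {a..b} x *\<^sub>R f x) \<in> borel_measurable lborel"
    using f by (simp add: set_integrable_def)
  have "(\<lambda>x. (indicator {a..b} x *\<^sub>R F x) * (indicator {a..b} x *\<^sub>R f x)) \<in> borel_measurable lborel"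
    using mF mf by (rule borel_measurable_times)
  also have "(\<lambda>x. (indicator {a..b} x *\<^sub>R F x) * (indicator {a..b} x *\<^sub>R f x))
      = (\<lambda>x. indicator {a..b} x *\<^sub>R (F x * f x))"
    by (auto simp: indicator_def)
  finally have m: "set_borel_measurable lborel {a..b} (\<lambda>x. F x * f x)"
    by (simp add: set_borel_measurable_def)
  have "set_integrable lborel {a..b} (\<lambda>x. of_real B * f x)"
    using f by simp
  then show ?thesis
  proof (rule set_integrable_bound[OF _ m])
    have "norm (F x * f x) \<le> norm (of_real B * f x)" if "x \<in> {a..b}" for x
      using B[OF that] abs_ge_self[of B] norm_ge_zero[of "f x"]
      by (auto simp: norm_mult intro!: mult_right_mono)
    then show "AE x in lborel. x \<in> {a..b} \<longrightarrow> norm (F x * f x) \<le> norm (of_real B * f x)"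
      by auto
  qed
qed

lemma half_prim_const: "half_prim (\<lambda>x. c) (\<lambda>x. 0)"
  by (simp add: half_prim_def set_integrable_def)

lemma half_prim_add:
  assumes "half_prim F f" "half_prim G g"
  shows "half_prim (\<lambda>x. F x + G x) (\<lambda>x. f x + g x)"
  unfolding half_prim_def
proof (intro allI impI conjI)
  fix x :: real assume x: "0 \<le> x"
  note D = half_primD[OF assms(1) x] half_primD[OF assms(2) x]
  show "set_integrable lborel {0..x} (\<lambda>x. f x + g x)"
    using D by (intro set_integral_add)
  show "F x + G x - (F 0 + G 0) = (LINT y:{0..x}|lborel. f y + g y)"
    unfolding set_integral_add(2)[OF D(1,3)] D(2,4)[symmetric] by simp
qed

lemma half_prim_cmult:
  assumes "half_prim F f"
  shows "half_prim (\<lambda>x. c * F x) (\<lambda>x. c * f x)"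
  using assms by (simp add: half_prim_def right_diff_distrib[symmetric])

lemma half_prim_uminus: "half_prim F f \<Longrightarrow> half_prim (\<lambda>x. - F x) (\<lambda>x. - f x)"
  using half_prim_cmult[of F f "-1"] by simp

lemma half_prim_diff:
  "half_prim F f \<Longrightarrow> half_prim G g \<Longrightarrow> half_prim (\<lambda>x. F x - G x) (\<lambda>x. f x - g x)"
  using half_prim_add[OF _ half_prim_uminus, of F f G g] by simp

text \<open>The derivative may be changed at the point \<open>0\<close>, where the potential jumps.\<close>

lemma half_prim_cong:
  assumes "half_prim F f" "\<And>x. 0 \<le> x \<Longrightarrow> F x = G x" "\<And>x. 0 < x \<Longrightarrow> f x = g x"
  shows "half_prim G g"
  unfolding half_prim_def
proof (intro allI impI)
  fix x :: real assume x: "0 \<le> x"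
  have eq: "indicator {0..x} y *\<^sub>R f y = indicator {0..x} y *\<^sub>R g y" if "y \<notin> {0}" for y
    using assms(3)[of y] that by (auto simp: indicator_def)
  have "set_integrable lborel {0..x} f = set_integrable lborel {0..x} g"
    unfolding set_integrable_def
    by (rule integrable_discrete_difference[where X = "{0}"]) (use eq in auto)
  moreover have "(LINT y:{0..x}|lborel. f y) = (LINT y:{0..x}|lborel. g y)"
    unfolding set_lebesgue_integral_def
    by (rule integral_discrete_difference[where X = "{0}"]) (use eq in auto)
  ultimately show "set_integrable lborel {0..x} g \<and> G x - G 0 = (LINT y:{0..x}|lborel. g y)"
    using half_primD[OF assms(1) x] assms(2)[OF x] assms(2)[of 0] by simp
qed

lemma half_prim_cong_AE:
  assumes F: "half_prim F f" and m: "f \<in> borel_measurable lborel" "g \<in> borel_measurable lborel"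
    and eq: "AE x in lborel. 0 \<le> x \<longrightarrow> f x = g x"
  shows "half_prim F g"
  unfolding half_prim_def
proof (intro allI impI)
  fix x :: real assume x: "0 \<le> x"
  have "set_integrable lborel {0..x} f = set_integrable lborel {0..x} g"
    by (rule set_integrable_cong_AE[OF m]) (use eq in \<open>auto elim: eventually_mono\<close>)
  moreover have "(LINT y:{0..x}|lborel. f y) = (LINT y:{0..x}|lborel. g y)"
    by (rule set_lebesgue_integral_cong_AE[OF _ m]) (use eq in \<open>auto elim: eventually_mono\<close>)
  ultimately show "set_integrable lborel {0..x} g \<and> F x - F 0 = (LINT y:{0..x}|lborel. g y)"
    using half_primD[OF F x] by simp
qed

text \<open>The classical primitives, needed for exponentials, test functions and damping factors.\<close>

lemma half_prim_C1:
  assumes d: "\<And>x. 0 \<le> x \<Longrightarrow> (F has_vector_derivative f x) (at x within {0..})"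
    and c: "\<And>x. continuous_on {0..x} f"
  shows "half_prim F f"
  unfolding half_prim_def
proof (intro allI impI conjI)
  fix x :: real assume x: "0 \<le> x"
  show "set_integrable lborel {0..x} f"
    by (rule borel_integrable_atLeastAtMost'[OF c])
  have "integral\<^sup>L lborel (\<lambda>y. indicator {0..x} y *\<^sub>R f y) = F x - F 0"
    by (rule integral_FTC_atLeastAtMost[OF x _ c])
      (auto intro: has_vector_derivative_within_subset[OF d])
  then show "F x - F 0 = (LINT y:{0..x}|lborel. f y)"
    by (simp add: set_lebesgue_integral_def)
qed

lemma half_prim_cnj:
  assumes "half_prim F f"
  shows "half_prim (\<lambda>x. cnj (F x)) (\<lambda>x. cnj (f x))"
  unfolding half_prim_def
proof (intro allI impI)
  fix x :: real assume x: "0 \<le> x"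
  have "(\<lambda>y. indicator {0..x} y *\<^sub>R cnj (f y)) = (\<lambda>y. cnj (indicator {0..x} y *\<^sub>R f y))"
    by (auto simp: indicator_def)
  then show "set_integrable lborel {0..x} (\<lambda>x. cnj (f x)) \<and>
      cnj (F x) - cnj (F 0) = (LINT y:{0..x}|lborel. cnj (f y))"
    using half_primD[OF assms x]
    by (simp add: set_integrable_def set_lebesgue_integral_def
        complex_cnj_diff[symmetric] del: complex_cnj_scaleR complex_cnj_diff)
qed

text \<open>Both sides are the integral of \<open>a s * b r\<close> over the triangle \<open>r \<le> s\<close>.\<close>

lemma integral_triangle_swap:
  fixes a b :: "real \<Rightarrow> complex"
  assumes a: "integrable lborel a" and b: "integrable lborel b"
  shows "(LINT s|lborel. a s * (LINT r:{..s}|lborel. b r)) =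
         (LINT r|lborel. (LINT s:{r..}|lborel. a s) * b r)"
proof -
  have [measurable]: "a \<in> borel_measurable borel" "b \<in> borel_measurable borel"
    using a b by auto
  define k where "k = (\<lambda>(s, r). (if r \<le> s then a s * b r else 0))"
  have mk [measurable]: "k \<in> borel_measurable (lborel \<Otimes>\<^sub>M lborel)"
    unfolding k_def by measurable
  have ab: "integrable (lborel \<Otimes>\<^sub>M lborel) (\<lambda>(s, r). a s * b r)"
  proof (rule lborel_pair.Fubini_integrable)
    show "(\<lambda>(s, r). a s * b r) \<in> borel_measurable (lborel \<Otimes>\<^sub>M lborel)"
      by measurable
    have "integrable lborel (\<lambda>s. norm (a s) * (LINT r|lborel. norm (b r)))"
      using a by simp
    then show "integrable lborel (\<lambda>x. LINT y|lborel. norm (case (x, y) of (s, r) \<Rightarrow> a s * b r))"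
      by (simp add: norm_mult)
    show "AE x in lborel. integrable lborel (\<lambda>y. case (x, y) of (s, r) \<Rightarrow> a s * b r)"
      using b by simp
  qed
  have ik: "integrable (lborel \<Otimes>\<^sub>M lborel) k"
    by (rule Bochner_Integration.integrable_bound[OF ab mk]) (auto simp: k_def)
  have "(LINT s|lborel. (LINT r|lborel. k (s, r))) = (LINT r|lborel. (LINT s|lborel. k (s, r)))"
    using lborel_pair.Fubini_integral[of "\<lambda>s r. k (s, r)"] ik by simp
  also have "(\<lambda>s. LINT r|lborel. k (s, r)) = (\<lambda>s. a s * (LINT r:{..s}|lborel. b r))"
  proof
    fix s
    have "(\<lambda>r. k (s, r)) = (\<lambda>r. a s * (indicator {..s} r *\<^sub>R b r))"
      by (auto simp: k_def indicator_def)
    then show "(LINT r|lborel. k (s, r)) = a s * (LINT r:{..s}|lborel. b r)"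
      by (simp add: set_lebesgue_integral_def del: mult_scaleR_right)
  qed
  also have "(\<lambda>r. LINT s|lborel. k (s, r)) = (\<lambda>r. (LINT s:{r..}|lborel. a s) * b r)"
  proof
    fix r
    have "(\<lambda>s. k (s, r)) = (\<lambda>s. (indicator {r..} s *\<^sub>R a s) * b r)"
      by (auto simp: k_def indicator_def)
    then show "(LINT s|lborel. k (s, r)) = (LINT s:{r..}|lborel. a s) * b r"
      by (simp add: set_lebesgue_integral_def del: mult_scaleR_left)
  qed
  finally show ?thesis .
qed

text \<open>The product rule.  The derivatives exist only almost everywhere, so it is proved by Fubini: with
\<open>F\<close> and \<open>G\<close> written as integrals, both terms are integrals of \<open>f s * g r\<close>, one over each of the two
triangles into which the diagonal cuts a square.\<close>

lemma half_prim_mult: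
  assumes F: "half_prim F f" and G: "half_prim G g"
  shows "half_prim (\<lambda>x. F x * G x) (\<lambda>x. f x * G x + F x * g x)"
  unfolding half_prim_def
proof (intro allI impI)
  fix X :: real assume X: "0 \<le> X"
  note DF = half_primD[OF F] and DG = half_primD[OF G]
  let ?I = "{0..X}"
  define a where "a = (\<lambda>s. indicator ?I s *\<^sub>R f s)"
  define b where "b = (\<lambda>s. indicator ?I s *\<^sub>R g s)"
  have a: "integrable lborel a" and b: "integrable lborel b"
    using DF(1)[OF X] DG(1)[OF X] by (auto simp: a_def b_def set_integrable_def)
  have i1: "set_integrable lborel ?I (\<lambda>x. f x * G x)"
    using set_integrable_continuous_mult[OF half_prim_continuous[OF G] DF(1)[OF X]]
    by (simp add: mult.commute)
  have i2: "set_integrable lborel ?I (\<lambda>x. F x * g x)"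
    using set_integrable_continuous_mult[OF half_prim_continuous[OF F] DG(1)[OF X]] .
  \<comment> \<open>The inner integrals of the triangle formula are increments of \<open>G\<close> and \<open>F\<close>.\<close>
  have b_low: "(LINT r:{..s}|lborel. b r) = G s - G 0" if "s \<in> ?I" for s
  proof -
    have "(\<lambda>r. indicator {..s} r *\<^sub>R b r) = (\<lambda>r. indicator {0..s} r *\<^sub>R g r)"
      using that by (auto simp: b_def indicator_def)
    then show ?thesis
      using DG(2)[of s] that by (simp add: set_lebesgue_integral_def)
  qed
  have a_high: "(LINT s:{r..}|lborel. a s) = F X - F r" if "r \<in> ?I" for r
  proof -
    have 1: "(\<lambda>s. indicator {r..} s *\<^sub>R a s) = (\<lambda>s. indicator {r..X} s *\<^sub>R f s)"
      using that by (auto simp: a_def indicator_def)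
    have "(LINT s:{0..r} \<union> {r..X}|lborel. f s)
        = (LINT s:{0..r}|lborel. f s) + (LINT s:{r..X}|lborel. f s)"
    proof (rule set_integral_Un_AE)
      have "AE x in lborel. x \<noteq> r" by (rule AE_lborel_singleton)
      then show "AE x in lborel. \<not> (x \<in> {0..r} \<and> x \<in> {r..X})"
        by eventually_elim auto
      show "set_integrable lborel {0..r} f" "set_integrable lborel {r..X} f"
        using DF(1)[OF X] that by (auto intro: set_integrable_subset)
    qed auto
    moreover have "{0..r} \<union> {r..X} = ?I" using that by auto
    ultimately show ?thesis
      using 1 DF(2)[of r] DF(2)[OF X] that by (simp add: set_lebesgue_integral_def diff_eq_eq)
  qed
  have "(LINT s|lborel. a s * (LINT r:{..s}|lborel. b r)) = (LINT s:?I|lborel. f s * (G s - G 0))"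
    unfolding set_lebesgue_integral_def[of lborel ?I]
    by (rule Bochner_Integration.integral_cong) (auto simp: a_def b_low indicator_def)
  moreover have "(LINT r|lborel. (LINT s:{r..}|lborel. a s) * b r) = (LINT r:?I|lborel. (F X - F r) * g r)"
    unfolding set_lebesgue_integral_def[of lborel ?I]
    by (rule Bochner_Integration.integral_cong) (auto simp: b_def a_high indicator_def)
  ultimately have "(LINT s:?I|lborel. f s * G s - f s * G 0) = (LINT r:?I|lborel. F X * g r - F r * g r)"
    using integral_triangle_swap[OF a b] by (simp add: algebra_simps)
  then have "(LINT s:?I|lborel. f s * G s) - (LINT s:?I|lborel. f s) * G 0
      = F X * (LINT r:?I|lborel. g r) - (LINT r:?I|lborel. F r * g r)"
    using i1 i2 DF(1)[OF X] DG(1)[OF X] by (simp add: set_integral_diff)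
  then show "set_integrable lborel ?I (\<lambda>x. f x * G x + F x * g x) \<and>
      F X * G X - F 0 * G 0 = (LINT y:?I|lborel. f y * G y + F y * g y)"
    using i1 i2 unfolding DF(2)[OF X, symmetric] DG(2)[OF X, symmetric]
    by (simp add: set_integral_add(2) algebra_simps)
qed

section \<open>Smooth step functions\<close>

text \<open>Differentiability to order \<open>n\<close> with an existentially quantified derivative, instead of iterates of
\<^const>\<open>deriv\<close>: the closure properties then follow by induction on \<open>n\<close> without computing any derivative.\<close>

primrec times_diff :: "nat \<Rightarrow> (real \<Rightarrow> real) \<Rightarrow> bool" where
  "times_diff 0 f = True"
| "times_diff (Suc n) f = (\<exists>f'. (\<forall>x. (f has_real_derivative f' x) (at x)) \<and> times_diff n f')"

lemma times_diff_SucD: "times_diff (Suc n) f \<Longrightarrow> times_diff n f"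
  by (induction n arbitrary: f) auto

lemma times_diff_deriv:
  assumes "times_diff (Suc n) f" shows "(deriv ^^ n) f differentiable_on UNIV"
  using assms
proof (induction n arbitrary: f)
  case 0
  then show ?case
    by (auto simp: differentiable_on_def real_differentiable_def)
next
  case (Suc n)
  then obtain f' where f': "\<And>x. (f has_real_derivative f' x) (at x)" "times_diff (Suc n) f'"
    by auto
  have "deriv f = f'"
    using f'(1) by (auto intro: DERIV_imp_deriv)
  then show ?case
    using Suc.IH[OF f'(2)] by (simp add: funpow_swap1)
qed

lemma times_diff_add: "times_diff n f \<Longrightarrow> times_diff n g \<Longrightarrow> times_diff n (\<lambda>x. f x + g x)"
proof (induction n arbitrary: f g)
  case (Suc n)
  then obtain f' g' where "\<And>x. (f has_real_derivative f' x) (at x)" "times_diff n f'"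
    "\<And>x. (g has_real_derivative g' x) (at x)" "times_diff n g'"
    by auto
  then show ?case
    by (auto intro!: exI[of _ "\<lambda>x. f' x + g' x"] Suc.IH derivative_eq_intros)
qed simp

lemma times_diff_mult: "times_diff n f \<Longrightarrow> times_diff n g \<Longrightarrow> times_diff n (\<lambda>x. f x * g x)"
proof (induction n arbitrary: f g)
  case (Suc n)
  then obtain f' g' where *: "\<And>x. (f has_real_derivative f' x) (at x)" "times_diff n f'"
    "\<And>x. (g has_real_derivative g' x) (at x)" "times_diff n g'"
    by auto
  have "times_diff n f" "times_diff n g"
    using Suc.prems times_diff_SucD by blast+
  then have "times_diff n (\<lambda>x. f' x * g x + g' x * f x)"
    using * by (intro times_diff_add Suc.IH)
  moreover have "((\<lambda>x. f x * g x) has_real_derivative f' x * g x + g' x * f x) (at x)" for x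
    by (rule DERIV_mult) (use * in auto)
  ultimately show ?case
    unfolding times_diff.simps by (intro exI conjI allI)
qed simp

lemma times_diff_const: "times_diff n (\<lambda>x. c)"
  by (induction n arbitrary: c) (auto intro!: exI[of _ "\<lambda>x. 0"])

lemma times_diff_affine: "times_diff n f \<Longrightarrow> times_diff n (\<lambda>x. f (c * x + d))"
proof (induction n arbitrary: f)
  case (Suc n)
  then obtain f' where f': "\<And>x. (f has_real_derivative f' x) (at x)" "times_diff n f'"
    by auto
  have "times_diff n (\<lambda>x. c * f' (c * x + d))"
    by (intro times_diff_mult times_diff_const Suc.IH f')
  moreover have "((\<lambda>x. f (c * x + d)) has_real_derivative c * f' (c * x + d)) (at x)" for x
  proof -
    have "((\<lambda>x. c * x + d) has_real_derivative c) (at x)"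
      by (auto intro!: derivative_eq_intros)
    from DERIV_chain2[OF f'(1) this] show ?thesis
      by (simp add: mult.commute)
  qed
  ultimately show ?case
    unfolding times_diff.simps by (intro exI conjI allI)
qed simp

text \<open>The functions \<open>p (1 / x) exp (- 1 / x)\<close>, extended by \<open>0\<close> to \<open>x \<le> 0\<close>.  For a polynomial \<open>p\<close> they form a class that
is closed under differentiation, at \<open>0\<close> because \<open>exp\<close> beats every power; hence all of them are smooth.\<close>

definition flat_fun :: "real poly \<Rightarrow> real \<Rightarrow> real" where
  "flat_fun p x = (if x \<le> 0 then 0 else poly p (inverse x) * exp (- inverse x))"

lemma poly_exp_minus_at_top: "((\<lambda>y. poly p y * exp (- y)) \<longlongrightarrow> (0::real)) at_top"
proof -
  have "((\<lambda>y. coeff p i * (y ^ i / exp y)) \<longlongrightarrow> coeff p i * 0) at_top" for i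
    by (intro tendsto_mult tendsto_const tendsto_power_div_exp_0)
  then have "((\<lambda>y. \<Sum>i\<le>degree p. coeff p i * (y ^ i / exp y)) \<longlongrightarrow> (\<Sum>i\<le>degree p. coeff p i * 0)) at_top"
    by (rule tendsto_sum)
  then show ?thesis
    by (simp add: poly_altdef exp_minus sum_distrib_right divide_inverse mult.assoc)
qed

lemma flat_fun_deriv:
  "(flat_fun p has_real_derivative flat_fun (monom 1 2 * (p - pderiv p)) x) (at x)"
proof (cases "x = 0")
  case [simp]: True
  have "((\<lambda>h. flat_fun p h / h) \<longlongrightarrow> 0) (at 0)"
  proof (rule filterlim_split_at)
    have "\<forall>\<^sub>F h in at_left (0::real). flat_fun p h / h = 0"
      unfolding eventually_at_filter by (auto simp: flat_fun_def)
    then show "((\<lambda>h. flat_fun p h / h) \<longlongrightarrow> 0) (at_left 0)"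
      by (rule tendsto_eventually)
    have "((\<lambda>h. poly (pCons 0 p) (inverse h) * exp (- inverse h)) \<longlongrightarrow> 0) (at_right (0::real))"
      by (rule filterlim_compose[OF poly_exp_minus_at_top filterlim_inverse_at_top_right])
    moreover have "\<forall>\<^sub>F h in at_right (0::real).
        poly (pCons 0 p) (inverse h) * exp (- inverse h) = flat_fun p h / h"
      unfolding eventually_at_filter by (auto simp: flat_fun_def divide_inverse)
    ultimately show "((\<lambda>h. flat_fun p h / h) \<longlongrightarrow> 0) (at_right 0)"
      by (rule Lim_transform_eventually)
  qed
  then show ?thesis
    by (simp add: has_field_derivative_iff flat_fun_def)
next
  case False
  consider "x < 0" | "0 < x" using False by linarith
  then show ?thesis
  proof cases
    case 1
    have "((\<lambda>x. 0) has_real_derivative flat_fun (monom 1 2 * (p - pderiv p)) x) (at x)"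
      using 1 by (simp add: flat_fun_def)
    then show ?thesis
      by (rule has_field_derivative_transform_within_open[where S = "{..<0}"])
        (use 1 in \<open>auto simp: flat_fun_def\<close>)
  next
    case 2
    have "((\<lambda>x. poly p (inverse x) * exp (- inverse x)) has_real_derivative
        flat_fun (monom 1 2 * (p - pderiv p)) x) (at x)"
      using 2 by (auto intro!: derivative_eq_intros DERIV_chain2[OF poly_DERIV]
          simp: flat_fun_def poly_monom field_simps power2_eq_square)
    then show ?thesis
      by (rule has_field_derivative_transform_within_open[where S = "{0<..}"])
        (use 2 in \<open>auto simp: flat_fun_def\<close>)
  qed
qed

lemma times_diff_flat_fun: "times_diff n (flat_fun p)"
  by (induction n arbitrary: p) (auto intro: flat_fun_deriv)

lemma times_diff_primitive:
  assumes "\<And>x. (F has_real_derivative f x) (at x)" "times_diff n f"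
  shows "times_diff (Suc n) F"
  using assms by auto

text \<open>The normalised primitive of the bump \<open>\<beta> x = exp (- 1 / x) exp (- 1 / (1 - x))\<close> on \<open>(0, 1)\<close>.\<close>

lemma smooth_step_exists:
  "\<exists>\<eta> :: real \<Rightarrow> real. (\<forall>n. times_diff n \<eta>) \<and> (\<forall>x. 0 \<le> \<eta> x \<and> \<eta> x \<le> 1) \<and>
     (\<forall>x\<le>0. \<eta> x = 0) \<and> (\<forall>x\<ge>1. \<eta> x = 1)"
proof -
  define \<beta> where "\<beta> = (\<lambda>x. flat_fun 1 x * flat_fun 1 (-1 * x + 1))"
  have \<beta>: "times_diff n \<beta>" for n
    unfolding \<beta>_def by (intro times_diff_mult times_diff_affine times_diff_flat_fun)
  have nonneg: "0 \<le> \<beta> x" for x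
    by (simp add: \<beta>_def flat_fun_def)
  have zero: "\<beta> x = 0" if "x \<le> 0 \<or> 1 \<le> x" for x
    using that by (auto simp: \<beta>_def flat_fun_def)
  obtain \<beta>' where "\<And>x. (\<beta> has_real_derivative \<beta>' x) (at x)"
    using \<beta>[of 1] by auto
  then have cont: "continuous_on S \<beta>" for S
    by (meson DERIV_isCont continuous_at_imp_continuous_on)
  define B where "B = (\<lambda>x. integral {0..x} \<beta>)"
  have int: "\<beta> integrable_on {a..b}" for a b
    by (rule integrable_continuous_real[OF cont])
  have B0: "B x = 0" if "x \<le> 0" for x
  proof (cases "x = 0")
    case False then show ?thesis using that by (simp add: B_def)
  qed (simp add: B_def)
  have Bmono: "B x \<le> B y" if "x \<le> y" for x y
    unfolding B_def by (rule integral_subset_le) (use that int nonneg in auto)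
  have B1: "B x = B 1" if "1 \<le> x" for x
  proof -
    have "integral {0..1} \<beta> + integral {1..x} \<beta> = integral {0..x} \<beta>"
      by (rule Henstock_Kurzweil_Integration.integral_combine) (use that int in auto)
    moreover have "integral {1..x} \<beta> = integral {1..x} (\<lambda>x. 0)"
      by (rule integral_cong) (simp add: zero)
    ultimately show ?thesis by (simp add: B_def)
  qed
  have dB: "(B has_real_derivative \<beta> x) (at x)" for x
  proof (cases "0 < x")
    case True
    have "((\<lambda>u. integral {0..u} \<beta>) has_real_derivative \<beta> x) (at x within {0..x+1})"
      by (rule integral_has_real_derivative[OF cont]) (use True in auto)
    then have "(B has_real_derivative \<beta> x) (at x within {0<..<x+1})"
      unfolding B_def by (rule DERIV_subset) auto
    then show ?thesis
      using True by (simp add: at_within_open[of x "{0<..<x+1}"])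
  next
    case False
    \<comment> \<open>The interval \<open>{0..u}\<close> is empty for \<open>u < 0\<close>, so near \<open>x \<le> 0\<close> the integral is started at \<open>x - 1\<close>,
      which changes nothing because \<open>\<beta>\<close> vanishes on the negative half-line.\<close>
    have "((\<lambda>u. integral {x-1..u} \<beta>) has_real_derivative \<beta> x) (at x within {x-1..x+1})"
      by (rule integral_has_real_derivative[OF cont]) auto
    then have 1: "((\<lambda>u. integral {x-1..u} \<beta>) has_real_derivative \<beta> x) (at x within {x-1<..<x+1})"
      by (rule DERIV_subset) auto
    have eq: "integral {x-1..u} \<beta> = B u" if "x - 1 < u" for u
    proof (cases "u \<le> 0")
      case True
      have "integral {x-1..u} \<beta> = integral {x-1..u} (\<lambda>x. 0)"
        by (rule integral_cong) (use True in \<open>auto simp: zero\<close>)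
      then show ?thesis using B0[OF True] by simp
    next
      case F: False
      have "integral {x-1..0} \<beta> + integral {0..u} \<beta> = integral {x-1..u} \<beta>"
        by (rule Henstock_Kurzweil_Integration.integral_combine) (use False F int in auto)
      moreover have "integral {x-1..0} \<beta> = integral {x-1..0} (\<lambda>x. 0)"
        by (rule integral_cong) (simp add: zero)
      ultimately show ?thesis by (simp add: B_def)
    qed
    have "((\<lambda>u. integral {x-1..u} \<beta>) has_real_derivative \<beta> x) (at x)"
      using 1 by (simp add: at_within_open[of x "{x-1<..<x+1}"])
    then show ?thesis
      by (rule has_field_derivative_transform_within_open[where S = "{x-1<..<x+1}"])
        (use eq in auto)
  qed
  have pos: "0 < B 1"
  proof -
    have "B (1/2) < B 1"
    proof (rule DERIV_pos_imp_increasing_open[where f = B])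
      fix x :: real assume "1/2 < x" "x < 1"
      then have "0 < \<beta> x" by (simp add: \<beta>_def flat_fun_def)
      then show "\<exists>y. (B has_real_derivative y) (at x) \<and> 0 < y" using dB by blast
    qed (auto intro!: continuous_at_imp_continuous_on DERIV_isCont[OF dB])
    with Bmono[of 0 "1/2"] B0[of 0] show ?thesis by simp
  qed
  define \<eta> where "\<eta> = (\<lambda>x. inverse (B 1) * B x)"
  have B: "times_diff n B" for n
    by (rule times_diff_SucD[OF times_diff_primitive[OF dB \<beta>]])
  have "times_diff n \<eta>" for n
    unfolding \<eta>_def by (intro times_diff_mult times_diff_const B)
  moreover have "0 \<le> \<eta> x" for x
    using Bmono[of 0 x] Bmono[of x 0] B0[of x] B0[of 0] pos
    by (cases "x \<le> 0") (auto simp: \<eta>_def)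
  moreover have "\<eta> x \<le> 1" for x
    using Bmono[of x 1] B1[of x] pos
    by (cases "x \<le> 1") (auto simp: \<eta>_def field_simps)
  moreover have "\<eta> x = 0" if "x \<le> 0" for x
    using B0[OF that] by (simp add: \<eta>_def)
  moreover have "\<eta> x = 1" if "1 \<le> x" for x
    unfolding \<eta>_def B1[OF that] using pos by simp
  ultimately show ?thesis
    by blast
qed

section \<open>The du Bois-Reymond lemma\<close>

lemma test_functionI:
  assumes "\<And>n. times_diff n \<phi>" "\<And>x. R < \<bar>x\<bar> \<Longrightarrow> \<phi> x = 0"
  shows "test_function \<phi>"
proof -
  have "{x. \<phi> x \<noteq> 0} \<subseteq> {-R..R}"
    using assms(2) by (force simp: abs_le_iff not_less)
  then have "bounded {x. \<phi> x \<noteq> 0}"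
    by (rule bounded_subset[rotated]) simp
  then show ?thesis
    using times_diff_deriv[OF assms(1)] by (simp add: test_function_def)
qed

lemma test_function_support:
  assumes "test_function \<phi>"
  obtains R where "0 \<le> R" "\<And>x. R < \<bar>x\<bar> \<Longrightarrow> \<phi> x = 0"
proof -
  have "bounded {x. \<phi> x \<noteq> 0}"
    using assms compact_imp_bounded closure_subset bounded_subset
    unfolding test_function_def by metis
  then obtain R where "\<And>x. \<phi> x \<noteq> 0 \<Longrightarrow> \<bar>x\<bar> \<le> R"
    unfolding bounded_iff by auto
  then show ?thesis
    by (intro that[of "max R 0"]) force+
qed

lemma test_function_DERIV:
  assumes "test_function \<phi>"
  shows "(\<phi> has_real_derivative deriv \<phi> x) (at x)" "continuous_on S (deriv \<phi>)"
proof -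
  have d: "(deriv ^^ n) \<phi> differentiable_on UNIV" for n
    using assms by (simp add: test_function_def)
  show "(\<phi> has_real_derivative deriv \<phi> x) (at x)"
    using d[of 0] by (simp add: DERIV_deriv_iff_real_differentiable differentiable_on_def)
  show "continuous_on S (deriv \<phi>)"
    using differentiable_imp_continuous_on[OF d[of 1]] continuous_on_subset by auto
qed

text \<open>The half-open intervals are stable under intersection and generate the Borel sets, so the
integral over every Borel set vanishes.\<close>

lemma AE_zero_if_Ioc_integrals_zero_integrable:
  fixes g :: "real \<Rightarrow> complex"
  assumes g: "integrable lborel g" and z: "(LINT x|lborel. g x) = 0"
    and Ioc: "\<And>s t. (LINT x:{s<..t}|lborel. g x) = 0"
  shows "AE x in lborel. g x = 0"
proof (rule sigma_finite_measure.density_zero[OF sigma_finite_lborel g])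
  fix A :: "real set" assume A: "A \<in> sets lborel"
  define E :: "real set set" where "E = range (\<lambda>(a, b). {a<..b})"
  have si: "set_integrable lborel B g" if "B \<in> sets lborel" for B
    unfolding set_integrable_def by (rule integrable_mult_indicator[OF that g])
  have bs: "sets lborel = sigma_sets UNIV E"
    by (simp add: borel_sigma_sets_Ioc E_def)
  have "Int_stable E"
  proof (rule Int_stableI)
    fix A B assume "A \<in> E" "B \<in> E"
    then obtain a b c d where "A = {a<..b}" "B = {c<..d}" by (auto simp: E_def)
    then have "A \<inter> B = {max a c<..min b d}" by auto
    then show "A \<inter> B \<in> E" by (auto simp: E_def)
  qed
  moreover have "E \<subseteq> Pow UNIV" by simp
  moreover have "A \<in> sigma_sets UNIV E" using A bs by simp
  ultimately show "(LINT x:A|lborel. g x) = 0"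
  proof (induction A rule: sigma_sets_induct_disjoint)
    case (basic A)
    then show ?case using Ioc by (auto simp: E_def)
  next
    case empty
    then show ?case by (simp add: set_lebesgue_integral_def)
  next
    case (compl A)
    then have A: "A \<in> sets lborel" using bs by simp
    have "(LINT x:A \<union> (UNIV - A)|lborel. g x) = (LINT x:A|lborel. g x) + (LINT x:UNIV - A|lborel. g x)"
      by (rule set_integral_Un) (use A in \<open>auto intro!: si\<close>)
    then show ?case
      using compl.IH z by (simp add: set_lebesgue_integral_def)
  next
    case (union F)
    then have F: "F i \<in> sets lborel" for i using bs by auto
    have "(LINT x:(\<Union>i. F i)|lborel. g x) = (\<Sum>i. (LINT x:F i|lborel. g x))"
    proof (rule lebesgue_integral_countable_add[OF F])
      show "set_integrable lborel (\<Union> (range F)) g"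
        by (rule si) (use F in auto)
    qed (use union.hyps in \<open>auto simp: disjoint_family_on_def\<close>)
    then show ?case using union.IH by simp
  qed
qed

lemma AE_zero_if_Ioc_integrals_zero:
  fixes g :: "real \<Rightarrow> complex"
  assumes g: "\<And>s t. set_integrable lborel {s<..t} g"
    and Ioc: "\<And>s t. s \<le> t \<Longrightarrow> (LINT x:{s<..t}|lborel. g x) = 0"
  shows "AE x in lborel. g x = 0"
proof -
  have "AE x in lborel. indicator {- real N<..real N} x *\<^sub>R g x = 0" for N
  proof (rule AE_zero_if_Ioc_integrals_zero_integrable)
    show "integrable lborel (\<lambda>x. indicator {- real N<..real N} x *\<^sub>R g x)"
      using g by (simp add: set_integrable_def)
    show "(LINT x|lborel. indicator {- real N<..real N} x *\<^sub>R g x) = 0"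
      using Ioc[of "- real N" "real N"] by (simp add: set_lebesgue_integral_def)
    fix s t :: real
    define a b where "a = max s (- real N)" and "b = min t (real N)"
    have "(\<lambda>x. indicator {s<..t} x *\<^sub>R indicator {- real N<..real N} x *\<^sub>R g x)
        = (\<lambda>x. indicator {a<..max a b} x *\<^sub>R g x)"
      by (rule ext) (auto simp: a_def b_def indicator_def split: if_splits)
    then show "(LINT x:{s<..t}|lborel. indicator {- real N<..real N} x *\<^sub>R g x) = 0"
      using Ioc[of a "max a b"] by (simp add: set_lebesgue_integral_def)
  qed
  then have "AE x in lborel. \<forall>N. indicator {- real N<..real N} x *\<^sub>R g x = 0"
    unfolding AE_all_countable by blast
  then show ?thesis
  proof eventually_elim
    case (elim x)
    obtain N where "\<bar>x\<bar> < real N" using reals_Archimedean2 by blast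
    then have "indicator {- real N<..real N} x = (1::real)" by (auto simp: indicator_def)
    with elim show ?case by (metis scaleR_one)
  qed
qed

text \<open>The ramps from which compactly supported test functions with prescribed derivative are built: they
are affine with slope \<open>1\<close> from \<open>1\<close> on, so suitable linear combinations of translates vanish there.\<close>

lemma primitive_of_smooth_step:
  fixes \<eta> :: "real \<Rightarrow> real"
  assumes \<eta>: "\<And>n. times_diff n \<eta>" and z: "\<And>x. x \<le> 0 \<Longrightarrow> \<eta> x = 0" and o: "\<And>x. 1 \<le> x \<Longrightarrow> \<eta> x = 1"
  obtains K :: "real \<Rightarrow> real" and C where "\<And>n. times_diff n K" "\<And>x. (K has_real_derivative \<eta> x) (at x)"
    "\<And>x. x \<le> 0 \<Longrightarrow> K x = 0" "\<And>x. 1 \<le> x \<Longrightarrow> K x = C + x"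
proof -
  obtain \<eta>' where "\<And>x. (\<eta> has_real_derivative \<eta>' x) (at x)"
    using \<eta>[of 1] by auto
  then have isc: "isCont \<eta> x" for x by (meson DERIV_isCont)
  obtain K0 where K0: "\<And>x. (K0 has_real_derivative \<eta> x) (at x)"
  proof -
    have "\<exists>g. \<forall>x. (-\<infinity>::ereal) < ereal x \<longrightarrow> ereal x < \<infinity> \<longrightarrow> (g has_real_derivative \<eta> x) (at x)"
      using einterval_antiderivative[of "-\<infinity>" "\<infinity>" \<eta>] isc
      by (simp add: has_real_derivative_iff_has_vector_derivative)
    then show ?thesis using that by auto
  qed
  define K where "K = (\<lambda>x. K0 x - K0 0)"
  have K: "(K has_real_derivative \<eta> x) (at x)" for x
    unfolding K_def by (auto intro!: derivative_eq_intros K0)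
  have "K x = 0" if "x \<le> 0" for x
  proof (cases "x = 0")
    case False
    with that have "x < 0" by simp
    then obtain y where "x < y" "y < 0" "K 0 - K x = (0 - x) * \<eta> y"
      using MVT2[of x 0 K \<eta>] K by blast
    then show ?thesis using z[of y] by (simp add: K_def)
  qed (simp add: K_def)
  moreover have "K x = (K 1 - 1) + x" if "1 \<le> x" for x
  proof (cases "x = 1")
    case False
    with that have "1 < x" by simp
    then obtain y where "1 < y" "y < x" "K x - K 1 = (x - 1) * \<eta> y"
      using MVT2[of 1 x K \<eta>] K by blast
    then show ?thesis using o[of y] by simp
  qed simp
  moreover have "times_diff n K" for n
    by (rule times_diff_SucD[OF times_diff_primitive[OF K \<eta>]])
  ultimately show ?thesis using that K by blast
qed

text \<open>The derivative of a test function can approximate \<open>1\<^bsub>(s,t]\<^esub> - (t - s) 1\<^bsub>(0,1]\<^esub>\<close>, a function with integral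
\<open>0\<close>.  In the limit, the integral of \<open>h\<close> over \<open>(s, t]\<close> is \<open>t - s\<close> times its integral over \<open>(0, 1]\<close>, so \<open>h\<close>
minus that constant integrates to \<open>0\<close> over every interval.\<close>

lemma du_Bois_Reymond:
  fixes h :: "real \<Rightarrow> complex"
  assumes h: "\<And>R. set_integrable lborel {-R..R} h"
    and orth: "\<And>\<phi>. test_function \<phi> \<Longrightarrow> (LINT x|lborel. h x * of_real (deriv \<phi> x)) = 0"
  shows "\<exists>c. AE x in lborel. h x = c"
proof -
  obtain \<eta> :: "real \<Rightarrow> real" where \<eta>: "\<And>n. times_diff n \<eta>" "\<And>x. 0 \<le> \<eta> x" "\<And>x. \<eta> x \<le> 1"
    "\<And>x. x \<le> 0 \<Longrightarrow> \<eta> x = 0" "\<And>x. 1 \<le> x \<Longrightarrow> \<eta> x = 1"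
    using smooth_step_exists by blast
  obtain K :: "real \<Rightarrow> real" and C where K: "\<And>n. times_diff n K" "\<And>x. (K has_real_derivative \<eta> x) (at x)"
    "\<And>x. x \<le> 0 \<Longrightarrow> K x = 0" "\<And>x. 1 \<le> x \<Longrightarrow> K x = C + x"
    using primitive_of_smooth_step[OF \<eta>(1,4,5)] by metis
  have hIoc: "set_integrable lborel {s<..t} h" for s t
    by (rule set_integrable_subset[OF h[of "max \<bar>s\<bar> \<bar>t\<bar>"]]) auto
  define c where "c = (LINT x:{0<..1}|lborel. h x)"
  have "(LINT x:{s<..t}|lborel. h x) = (t - s) * c" if st: "s \<le> t" for s t
  proof -
    \<comment> \<open>Four ramps with corners near \<open>s\<close>, \<open>t\<close>, \<open>0\<close> and \<open>1\<close>, smoothed on the scale \<open>1 / n\<close>.  The factor \<open>t - s\<close>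
      makes the sum vanish on the far right.  Its derivative is \<open>\<psi> n\<close>, with pointwise limit \<open>\<sigma>\<close>.\<close>
    define \<kappa> where "\<kappa> = t - s"
    define R where "R = \<bar>s\<bar> + \<bar>t\<bar> + 2"
    define \<phi> where "\<phi> n x = (1 / real n) * (K (real n * x + - (real n * s)) + (-1) * K (real n * x +
        - (real n * t))
        + (- \<kappa>) * (K (real n * x + 0) + (-1) * K (real n * x + - real n)))" for n x
    define \<psi> where "\<psi> n x = \<eta> (real n * (x - s)) - \<eta> (real n * (x - t))
        - \<kappa> * (\<eta> (real n * x) - \<eta> (real n * (x - 1)))" for n x
    define \<sigma> :: "real \<Rightarrow> real" where "\<sigma> x = indicator {s<..t} x - \<kappa> * indicator {0<..1} x" for x
    have td: "times_diff m (\<phi> n)" for m n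
      unfolding \<phi>_def by (intro times_diff_mult times_diff_add times_diff_const times_diff_affine K)
    have dK: "((\<lambda>x. K (real n * x + d)) has_real_derivative real n * \<eta> (real n * x + d)) (at x)" for n x d
    proof -
      have "((\<lambda>x. real n * x + d) has_real_derivative real n) (at x)"
        by (auto intro!: derivative_eq_intros)
      from DERIV_chain2[OF K(2) this] show ?thesis by (simp add: mult.commute)
    qed
    have d\<phi>: "(\<phi> n has_real_derivative \<psi> n x) (at x)" if "0 < n" for n x
      unfolding \<phi>_def \<psi>_def
      by (rule derivative_eq_intros dK refl)+ (use that in \<open>simp add: field_simps\<close>)
    \<comment> \<open>On the far left all four ramps are \<open>0\<close>, on the far right all are affine.\<close>
    have out: "\<phi> n x = 0 \<and> \<psi> n x = 0" if n: "0 < n" and x: "R < \<bar>x\<bar>" for n x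
    proof (cases "x < 0")
      case True
      have le: "real n * x \<le> real n * s" "real n * x \<le> real n * t" "real n * x \<le> 0" "real n * x
          \<le> real n * 1"
        using True x by (auto intro!: mult_left_mono simp: R_def mult_nonneg_nonpos simp del: mult_1_right)
      then show ?thesis
        by (simp add: \<phi>_def \<psi>_def K(3) \<eta>(4) right_diff_distrib)
    next
      case False
      have ge: "real n * 1 \<le> real n * (x - s)" "real n * 1 \<le> real n * (x - t)" "real n * 1
          \<le> real n * x" "real n * 1 \<le> real n * (x - 1)"
        using False x n by (auto intro!: mult_left_mono simp: R_def simp del: mult_1_right)
      moreover have "1 \<le> real n" using n by simp
      ultimately have ge1: "1 \<le> real n * x - real n * s" "1 \<le> real n * x - real n * t" "1
          \<le> real n * x" "1 \<le> real n * x - real n"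
        unfolding right_diff_distrib mult_1_right by linarith+
      then show ?thesis
        by (simp add: \<phi>_def \<psi>_def K(4) \<eta>(5) right_diff_distrib \<kappa>_def field_simps)
    qed
    have "(LINT x|lborel. h x * of_real (\<psi> (Suc n) x)) = 0" for n
    proof -
      have "test_function (\<phi> (Suc n))"
        by (rule test_functionI[OF td, of R]) (use out in auto)
      moreover have "deriv (\<phi> (Suc n)) = \<psi> (Suc n)"
        by (rule ext, rule DERIV_imp_deriv, rule d\<phi>) simp
      ultimately show ?thesis using orth by metis
    qed
    moreover have "(\<lambda>n. LINT x|lborel. h x * of_real (\<psi> (Suc n) x)) \<longlonglongrightarrow> (LINT x|lborel. h x * of_real (\<sigma> x))"
    proof (rule integral_dominated_convergence)
      define w where "w x = norm (indicator {-R..R} x *\<^sub>R h x) * (1 + \<bar>\<kappa>\<bar>)" for x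
      have hm: "(\<lambda>x. indicator {-R..R} x *\<^sub>R h x) \<in> borel_measurable lborel"
        using h[of R] by (auto simp: set_integrable_def)
      show "integrable lborel w"
        unfolding w_def
        by (intro integrable_mult_left integrable_norm h[of R, unfolded set_integrable_def])
      have \<psi>m: "\<psi> (Suc n) \<in> borel_measurable lborel" for n
      proof -
        obtain \<eta>' where "\<And>x. (\<eta> has_real_derivative \<eta>' x) (at x)"
          using \<eta>(1)[of 1] by auto
        then have "continuous_on UNIV \<eta>"
          by (meson DERIV_isCont continuous_at_imp_continuous_on)
        then have [measurable]: "\<eta> \<in> borel_measurable borel"
          by (rule borel_measurable_continuous_onI)
        show ?thesis unfolding \<psi>_def by measurable
      qed
      have eq: "h x * of_real (\<psi> (Suc n) x) = (indicator {-R..R} x *\<^sub>R h x) * of_real (\<psi> (Suc n) x)" for n x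
        using out[of "Suc n" x] by (cases "R < \<bar>x\<bar>") (auto simp: indicator_def)
      show "(\<lambda>x. h x * of_real (\<psi> (Suc n) x)) \<in> borel_measurable lborel" for n
        unfolding eq using hm \<psi>m[of n] by measurable
      have \<sigma>out: "\<sigma> x = 0" if "R < \<bar>x\<bar>" for x
        using that by (auto simp: \<sigma>_def R_def indicator_def)
      have eq2: "h x * of_real (\<sigma> x) = (indicator {-R..R} x *\<^sub>R h x) * of_real (\<sigma> x)" for x
        using \<sigma>out[of x] by (cases "R < \<bar>x\<bar>") (auto simp: indicator_def)
      have "\<sigma> \<in> borel_measurable lborel"
        unfolding \<sigma>_def by measurable
      then show "(\<lambda>x. h x * of_real (\<sigma> x)) \<in> borel_measurable lborel"
        unfolding eq2 using hm by measurable
      have "\<bar>\<psi> n x\<bar> \<le> 1 + \<bar>\<kappa>\<bar>" for n x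
      proof -
        have "\<bar>\<eta> a - \<eta> b\<bar> \<le> 1" for a b
          using \<eta>(2,3)[of a] \<eta>(2,3)[of b] by auto
        then have "\<bar>\<eta> (real n * (x - s)) - \<eta> (real n * (x - t))\<bar> \<le> 1"
          "\<bar>\<kappa> * (\<eta> (real n * x) - \<eta> (real n * (x - 1)))\<bar> \<le> \<bar>\<kappa>\<bar>"
          by (auto simp: abs_mult mult_left_le)
        then show ?thesis unfolding \<psi>_def by linarith
      qed
      then show "AE x in lborel. norm (h x * of_real (\<psi> (Suc n) x)) \<le> w x" for n
        unfolding eq w_def norm_mult norm_of_real by (intro AE_I2 mult_left_mono) auto
      have lim\<eta>: "(\<lambda>n. \<eta> (real (Suc n) * y)) \<longlonglongrightarrow> indicator {0<..} y" for y
      proof (cases "y \<le> 0")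
        case True
        then have "real (Suc n) * y \<le> 0" for n by (simp add: mult_nonneg_nonpos)
        then show ?thesis using True \<eta>(4) by simp
      next
        case False
        obtain N where N: "1 / y \<le> real N" using real_arch_simple by blast
        have "\<eta> (real (Suc n) * y) = 1" if "N \<le> n" for n
        proof -
          have "1 / y \<le> real (Suc n)" using N that by (simp add: order_trans)
          then show ?thesis using False by (intro \<eta>(5)) (simp add: field_simps)
        qed
        then have "\<forall>\<^sub>F n in sequentially. \<eta> (real (Suc n) * y) = 1"
          by (auto simp: eventually_sequentially)
        then show ?thesis using False by (simp add: tendsto_eventually)
      qed
      have "(\<lambda>n. \<psi> (Suc n) x) \<longlonglongrightarrow> \<sigma> x" for x
      proof -
        have "(\<lambda>n. \<psi> (Suc n) x) \<longlonglongrightarrow> indicator {0<..} (x - s) - indicator {0<..} (x - t)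
            - \<kappa> * (indicator {0<..} x - indicator {0<..} (x - 1))"
          unfolding \<psi>_def by (intro tendsto_intros lim\<eta>)
        moreover have "indicator {0<..} (x - s) - indicator {0<..} (x - t)
            - \<kappa> * (indicator {0<..} x - indicator {0<..} (x - 1)) = \<sigma> x"
          using st by (auto simp: \<sigma>_def indicator_def)
        ultimately show ?thesis by simp
      qed
      then show "AE x in lborel. (\<lambda>n. h x * of_real (\<psi> (Suc n) x)) \<longlonglongrightarrow> h x * of_real (\<sigma> x)"
        by (intro AE_I2 tendsto_mult tendsto_const tendsto_of_real)
    qed
    ultimately have "(LINT x|lborel. h x * of_real (\<sigma> x)) = 0"
      using LIMSEQ_unique by (metis (no_types, lifting) tendsto_const ext)
    moreover have "(LINT x|lborel. h x * of_real (\<sigma> x)) = (LINT x:{s<..t}|lborel. h x) - \<kappa> * c"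
    proof -
      have "h x * of_real (\<sigma> x) = indicator {s<..t} x *\<^sub>R h x - \<kappa> * (indicator {0<..1} x *\<^sub>R h x)" for x
        by (auto simp: \<sigma>_def indicator_def algebra_simps)
      then show ?thesis
        using hIoc[of s t] hIoc[of 0 1]
        by (simp add: set_lebesgue_integral_def c_def set_integrable_def del: mult_scaleR_right)
    qed
    ultimately show ?thesis by (simp add: \<kappa>_def)
  qed
  then have *: "(LINT x:{s<..t}|lborel. h x) = (t - s) * c" if "s \<le> t" for s t
    using that by simp
  have ci: "set_integrable lborel {s<..t} (\<lambda>x. c)" for s t :: real
    by (rule set_integrable_subset[OF borel_integrable_atLeastAtMost'[of s t]]) auto
  have "AE x in lborel. h x - c = 0"
  proof (rule AE_zero_if_Ioc_integrals_zero)
    show "set_integrable lborel {s<..t} (\<lambda>x. h x - c)" for s t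
      by (intro set_integral_diff(1) hIoc ci)
    show "(LINT x:{s<..t}|lborel. h x - c) = 0" if "s \<le> t" for s t
      using *[OF that] hIoc[of s t] ci[of s t] that
      by (simp add: set_integral_diff set_integral_const scaleR_conv_of_real)
  qed
  then show ?thesis
    by (intro exI[of _ c]) (auto elim: eventually_mono)
qed

section \<open>Weak derivatives as primitives on the line\<close>

text \<open>\<open>F\<close> is absolutely continuous on the real line with derivative \<open>f\<close>, as the conjunction of the
statements for the two half-lines.  The function \<open>F (- x)\<close> has derivative \<open>- f (- x)\<close>.\<close>

definition line_prim :: "(real \<Rightarrow> complex) \<Rightarrow> (real \<Rightarrow> complex) \<Rightarrow> bool" where
  "line_prim F f \<longleftrightarrow> half_prim F f \<and> half_prim (\<lambda>x. F (- x)) (\<lambda>x. - f (- x))"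

lemma half_prim_set_integrable: "half_prim F f \<Longrightarrow> set_integrable lborel {0..x} f"
  by (cases "0 \<le> x") (auto simp: half_prim_def set_integrable_def)

lemma lborel_integrable_reflect:
  fixes k :: "real \<Rightarrow> complex"
  shows "integrable lborel (\<lambda>x. k (- x)) \<longleftrightarrow> integrable lborel k"
  using lborel_integrable_real_affine_iff[of "-1" k 0] by simp

lemma lborel_integral_reflect:
  fixes k :: "real \<Rightarrow> complex"
  shows "(LINT x|lborel. k (- x)) = (LINT x|lborel. k x)"
  using lborel_integral_real_affine[of "-1" k 0] by simp

lemma set_integrable_reflect:
  fixes k :: "real \<Rightarrow> complex"
  shows "set_integrable lborel {a..b} (\<lambda>x. k (- x)) \<longleftrightarrow> set_integrable lborel {-b..-a} k"
proof -
  have "(\<lambda>x. indicator {a..b} x *\<^sub>R k (- x)) = (\<lambda>x. indicator {-b..-a} (- x) *\<^sub>R k (- x))"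
    by (auto simp: indicator_def)
  then show ?thesis
    using lborel_integrable_reflect[of "\<lambda>x. indicator {-b..-a} x *\<^sub>R k x"]
    by (simp only: set_integrable_def)
qed

lemma set_integrable_from_halves:
  fixes k :: "real \<Rightarrow> complex"
  assumes "set_integrable lborel {0..R} k" "set_integrable lborel {0..R} (\<lambda>x. k (- x))"
  shows "set_integrable lborel {-R..R} k"
proof -
  have "set_integrable lborel ({-R..0} \<union> {0..R}) k"
    using assms by (intro set_integrable_Un) (auto simp: set_integrable_reflect)
  then show ?thesis
    by (rule set_integrable_subset) auto
qed

lemma line_prim_set_integrable:
  assumes "line_prim F f" shows "set_integrable lborel {-R..R} f"
proof (rule set_integrable_from_halves)
  show "set_integrable lborel {0..R} f"
    using assms by (auto simp: line_prim_def intro: half_prim_set_integrable)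
  have "set_integrable lborel {0..R} (\<lambda>x. (-1) * (- f (- x)))"
    using assms by (intro set_integrable_mult_right) (auto simp: line_prim_def intro:
        half_prim_set_integrable)
  then show "set_integrable lborel {0..R} (\<lambda>x. f (- x))"
    by simp
qed

lemma line_prim_continuous:
  assumes "line_prim F f" shows "continuous_on S F"
proof -
  have c1: "continuous_on {0..R} F" and c2: "continuous_on {0..R} (\<lambda>x. F (- x))" for R
    using assms half_prim_continuous by (auto simp: line_prim_def)
  have "continuous_on {-R..0} (\<lambda>x. F (- (- x)))" for R
    by (rule continuous_on_compose2[OF c2[of R]]) (auto intro!: continuous_intros)
  then have c3: "continuous_on ({-R..0} \<union> {0..R}) F" for R
    using c1 by (intro continuous_on_closed_Un) auto
  have c: "continuous_on {-R<..<R} F" for R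
    by (rule continuous_on_subset[OF c3[of R]]) auto
  have "isCont F x" for x
  proof -
    have "x \<in> {-(\<bar>x\<bar> + 1)<..<\<bar>x\<bar> + 1}" by auto
    then show ?thesis
      using c[of "\<bar>x\<bar> + 1"] by (simp only: continuous_on_eq_continuous_at open_greaterThanLessThan)
  qed
  then show ?thesis
    by (simp add: continuous_at_imp_continuous_on)
qed

lemma line_prim_measurable:
  assumes "line_prim F f" shows "F \<in> borel_measurable lborel"
  using borel_measurable_continuous_onI[OF line_prim_continuous[OF assms]] by simp

lemma set_integral_point: "(LINT y:{a::real}|lborel. f y) = (0::complex)"
  unfolding set_lebesgue_integral_def
  by (rule integral_eq_zero_AE) (use AE_lborel_singleton[of a] in \<open>auto elim: eventually_mono\<close>)

lemma half_prim_exists: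
  assumes "\<And>x. 0 \<le> x \<Longrightarrow> set_integrable lborel {0..x} f"
  shows "half_prim (\<lambda>x. c + (LINT y:{0..x}|lborel. f y)) f"
proof -
  have "(LINT y:{0..0}|lborel. f y) = 0"
    by (simp add: set_integral_point)
  then show ?thesis
    using assms by (simp add: half_prim_def)
qed

lemma line_prim_exists:
  assumes f: "\<And>R. set_integrable lborel {-R..R} f"
  obtains F where "line_prim F f"
proof -
  define P where "P = (\<lambda>x. LINT y:{0..x}|lborel. f y)"
  define N where "N = (\<lambda>x. LINT y:{0..x}|lborel. - f (- y))"
  have P: "half_prim P f"
    using half_prim_exists[of f 0] set_integrable_subset[OF f, of "{0..x}" x for x]
    unfolding P_def by simp
  have "set_integrable lborel {0..x} (\<lambda>y. - f (- y))" for x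
    using set_integrable_reflect[of 0 x "\<lambda>y. (-1) * f y"] set_integrable_subset[OF f[of x], of "{-x..0}"]
    by (cases "0 \<le> x") (auto simp: set_integrable_def)
  then have N: "half_prim N (\<lambda>y. - f (- y))"
    using half_prim_exists[of "\<lambda>y. - f (- y)" 0] by (auto simp: N_def)
  have 0: "P 0 = 0" "N 0 = 0"
    by (simp_all add: P_def N_def set_integral_point)
  define F where "F x = (if 0 \<le> x then P x else N (- x))" for x
  have "half_prim F f"
    by (rule half_prim_cong[OF P]) (auto simp: F_def)
  moreover have "half_prim (\<lambda>x. F (- x)) (\<lambda>x. - f (- x))"
    by (rule half_prim_cong[OF N]) (auto simp: F_def 0)
  ultimately show ?thesis using that by (auto simp: line_prim_def)
qed

lemma line_prim_add_const: "line_prim F f \<Longrightarrow> line_prim (\<lambda>x. F x + c) f"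
  using half_prim_add[OF _ half_prim_const] by (fastforce simp: line_prim_def)

lemma line_prim_cong_AE:
  assumes "line_prim F f" "f \<in> borel_measurable lborel" "g \<in> borel_measurable lborel"
    "AE x in lborel. f x = g x"
  shows "line_prim F g"
proof -
  have [measurable]: "f \<in> borel_measurable borel" "g \<in> borel_measurable borel"
    using assms by auto
  have AE': "AE x in lborel. f (- x) = g (- x)"
    using AE_borel_affine[of "-1" "\<lambda>x. f x = g x" 0] assms(4) by simp
  show ?thesis
    using assms AE' unfolding line_prim_def
    by (auto intro!: half_prim_cong_AE[of F f] half_prim_cong_AE[of "\<lambda>x. F (- x)" "\<lambda>x. - f (- x)"])
qed

lemma square_integrable_imp_set_integrable:
  assumes "square_integrable f" shows "set_integrable lborel {a..b} f"
proof -
  have [measurable]: "f \<in> borel_measurable borel"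
    using assms by (simp add: square_integrable_def)
  have "integrable lborel (\<lambda>x. indicator {a..b} x + (cmod (f x))\<^sup>2 :: real)"
    using assms by (intro Bochner_Integration.integrable_add integrable_real_indicator)
      (auto simp: square_integrable_def emeasure_lborel_Icc_eq)
  then show ?thesis
    unfolding set_integrable_def
  proof (rule Bochner_Integration.integrable_bound)
    have le: "norm (indicator {a..b} x *\<^sub>R f x) \<le> indicator {a..b} x + (cmod (f x))\<^sup>2" for x
    proof -
      have "2 * (1 * cmod (f x)) \<le> 1 + (cmod (f x))\<^sup>2"
        using sum_squares_bound[of 1 "cmod (f x)"] by (simp add: power2_eq_square)
      then have "cmod (f x) \<le> 1 + (cmod (f x))\<^sup>2"
        using norm_ge_zero[of "f x"] by linarith
      then show ?thesis by (auto simp: indicator_def)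
    qed
    show "AE x in lborel. norm (indicator {a..b} x *\<^sub>R f x) \<le> norm (indicator {a..b} x + (cmod (f x))\<^sup>2)"
      unfolding real_norm_def by (intro AE_I2 order_trans[OF le abs_ge_self])
  qed measurable
qed

lemma integrable_times_compactly_supported:
  fixes f w :: "real \<Rightarrow> complex"
  assumes "set_integrable lborel {-R..R} f" "continuous_on {-R..R} w" "\<And>x. R < \<bar>x\<bar> \<Longrightarrow> w x = 0"
  shows "integrable lborel (\<lambda>x. f x * w x)"
proof -
  have "set_integrable lborel {-R..R} (\<lambda>x. w x * f x)"
    by (rule set_integrable_continuous_mult[OF assms(2,1)])
  moreover have "indicator {-R..R} x *\<^sub>R (w x * f x) = f x * w x" for x
    using assms(3)[of x] by (cases "R < \<bar>x\<bar>") (auto simp: indicator_def)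
  ultimately show ?thesis by (simp add: set_integrable_def)
qed

text \<open>Integration by parts against a function that vanishes far out leaves the boundary term at \<open>0\<close>.  The
contributions from the two half-lines will cancel.\<close>

lemma half_prim_by_parts_compact:
  assumes F: "half_prim F f" and W: "half_prim W w" and R: "0 \<le> R"
    and out: "\<And>x. R < x \<Longrightarrow> W x = 0 \<and> w x = 0" and WR: "W R = 0"
  shows "(LINT x:{0..}|lborel. f x * W x + F x * w x) = - F 0 * W 0"
proof -
  have "(LINT x:{0..R}|lborel. f x * W x + F x * w x) = F R * W R - F 0 * W 0"
    using half_primD(2)[OF half_prim_mult[OF F W] R] by simp
  moreover have "(LINT x:{0..}|lborel. f x * W x + F x * w x) = (LINT x:{0..R}|lborel. f x * W x
      + F x * w x)"
    unfolding set_lebesgue_integral_def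
    by (rule Bochner_Integration.integral_cong) (use out in \<open>auto simp: indicator_def\<close>)
  ultimately show ?thesis using WR by simp
qed

lemma integral_split_halves:
  fixes k :: "real \<Rightarrow> complex"
  assumes k: "integrable lborel k"
  shows "(LINT x|lborel. k x) = (LINT x:{0..}|lborel. k x) + (LINT x:{0..}|lborel. k (- x))"
proof -
  have si: "set_integrable lborel B k" if "B \<in> sets lborel" for B
    unfolding set_integrable_def by (rule integrable_mult_indicator[OF that k])
  have "(LINT x:{0..} \<union> {..0}|lborel. k x) = (LINT x:{0..}|lborel. k x) + (LINT x:{..0}|lborel. k x)"
  proof (rule set_integral_Un_AE)
    have "AE x in lborel. x \<noteq> (0::real)" by (rule AE_lborel_singleton)
    then show "AE x in lborel. \<not> (x \<in> {0..} \<and> x \<in> {..0::real})"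
      by eventually_elim auto
  qed (auto intro!: si)
  moreover have "{0..} \<union> {..0} = (UNIV :: real set)" by auto
  moreover have "(LINT x:{..0}|lborel. k x) = (LINT x:{0..}|lborel. k (- x))"
  proof -
    have "(\<lambda>x. indicator {0..} x *\<^sub>R k (- x)) = (\<lambda>x. indicator {..0} (- x) *\<^sub>R k (- x))"
      by (auto simp: indicator_def)
    then show ?thesis
      using lborel_integral_reflect[of "\<lambda>x. indicator {..0} x *\<^sub>R k x"]
      by (simp only: set_lebesgue_integral_def)
  qed
  ultimately show ?thesis by (simp add: set_lebesgue_integral_def)
qed

lemma test_function_deriv_zero:
  assumes \<phi>: "test_function \<phi>" and R: "\<And>x. R < \<bar>x\<bar> \<Longrightarrow> \<phi> x = 0" and x: "R < \<bar>x\<bar>"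
  shows "deriv \<phi> x = 0"
proof -
  have op: "open {x. R < \<bar>x\<bar>}" by (intro open_Collect_less continuous_intros)
  have "((\<lambda>x. 0) has_real_derivative deriv \<phi> x) (at x)"
    by (rule has_field_derivative_transform_within_open[OF test_function_DERIV(1)[OF \<phi>] op])
      (use x R in auto)
  then show ?thesis using DERIV_unique DERIV_const by blast
qed

lemma line_prim_weak_deriv:
  assumes F: "line_prim F f" and \<phi>: "test_function \<phi>"
  shows "(LINT x|lborel. F x * of_real (deriv \<phi> x)) = - (LINT x|lborel. f x * of_real (\<phi> x))"
    and "integrable lborel (\<lambda>x. F x * of_real (deriv \<phi> x))"
    and "integrable lborel (\<lambda>x. f x * of_real (\<phi> x))"
proof -
  obtain R0 where R0: "0 \<le> R0" "\<And>x. R0 < \<bar>x\<bar> \<Longrightarrow> \<phi> x = 0"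
    using test_function_support[OF \<phi>] by blast
  define R where "R = R0 + 1"
  have d: "(\<phi> has_real_derivative deriv \<phi> x) (at x)" for x
    by (rule test_function_DERIV[OF \<phi>])
  have out: "\<phi> x = 0" "deriv \<phi> x = 0" if "R0 < \<bar>x\<bar>" for x
    using that R0 test_function_deriv_zero[OF \<phi> R0(2)] by auto
  define W w where "W = (\<lambda>x. complex_of_real (\<phi> x))" and "w = (\<lambda>x. complex_of_real (deriv \<phi> x))"
  have cw: "continuous_on S w" "continuous_on S W" for S
    unfolding w_def W_def
    by (auto intro!: continuous_intros test_function_DERIV[OF \<phi>] continuous_at_imp_continuous_on
        DERIV_isCont[OF d])
  have dW: "(W has_vector_derivative w x) (at x)" for x
    unfolding W_def w_def
    using has_vector_derivative_of_real d has_real_derivative_iff_has_vector_derivative by blast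
  have W: "half_prim W w"
    by (rule half_prim_C1) (auto intro: has_vector_derivative_at_within dW cw)
  have W': "half_prim (\<lambda>x. W (- x)) (\<lambda>x. - w (- x))"
  proof (rule half_prim_C1)
    fix x :: real
    have "((\<lambda>x. - x) has_real_derivative -1) (at x)" by (auto intro!: derivative_eq_intros)
    then have "((W \<circ> (\<lambda>x. - x)) has_vector_derivative (-1) *\<^sub>R w (- x)) (at x)"
      using vector_diff_chain_at[of "\<lambda>x. - x" "-1" x W "w (- x)"] dW
      by (simp add: has_real_derivative_iff_has_vector_derivative)
    then show "((\<lambda>x. W (- x)) has_vector_derivative - w (- x)) (at x within {0..})"
      by (auto simp: o_def intro: has_vector_derivative_at_within)
    show "continuous_on {0..x} (\<lambda>x. - w (- x))"
      by (intro continuous_intros continuous_on_compose2[OF cw(1)[of UNIV]]) auto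
  qed
  have Rpos: "0 \<le> R" using R0 by (simp add: R_def)
  have i1: "integrable lborel (\<lambda>x. f x * W x)"
    by (rule integrable_times_compactly_supported[OF line_prim_set_integrable[OF F] cw(2), of R])
      (use out in \<open>auto simp: W_def R_def\<close>)
  have i2: "integrable lborel (\<lambda>x. F x * w x)"
    by (rule integrable_times_compactly_supported[OF
          borel_integrable_atLeastAtMost'[OF line_prim_continuous[OF F]] cw(1), of R])
      (use out in \<open>auto simp: w_def R_def\<close>)
  from i1 i2 show "integrable lborel (\<lambda>x. F x * of_real (deriv \<phi> x))"
    "integrable lborel (\<lambda>x. f x * of_real (\<phi> x))"
    by (auto simp: W_def w_def)
  have p1: "(LINT x:{0..}|lborel. f x * W x + F x * w x) = - F 0 * W 0"
    by (rule half_prim_by_parts_compact[OF _ W Rpos]) (use F out R0 in \<open>auto simp: line_prim_def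
        W_def w_def R_def\<close>)
  have p2: "(LINT x:{0..}|lborel. - f (- x) * W (- x) + F (- x) * (- w (- x))) = - F (- 0) * W (- 0)"
    by (rule half_prim_by_parts_compact[OF _ W' Rpos]) (use F out R0 in \<open>auto simp: line_prim_def
        W_def w_def R_def\<close>)
  have "(LINT x|lborel. f x * W x + F x * w x) =
      (LINT x:{0..}|lborel. f x * W x + F x * w x) + (LINT x:{0..}|lborel. f (- x) * W (- x)
          + F (- x) * w (- x))"
    using integral_split_halves[of "\<lambda>x. f x * W x + F x * w x"] i1 i2 by simp
  also have "(LINT x:{0..}|lborel. f (- x) * W (- x) + F (- x) * w (- x)) =
      - (LINT x:{0..}|lborel. - f (- x) * W (- x) + F (- x) * (- w (- x)))"
    unfolding set_lebesgue_integral_def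
    by (subst Bochner_Integration.integral_minus[symmetric], rule Bochner_Integration.integral_cong)
        (auto simp: algebra_simps)
  finally have "(LINT x|lborel. f x * W x + F x * w x) = 0"
    using p1 p2 by simp
  then have "(LINT x|lborel. f x * W x) + (LINT x|lborel. F x * w x) = 0"
    using i1 i2 by simp
  then show "(LINT x|lborel. F x * of_real (deriv \<phi> x)) = - (LINT x|lborel. f x * of_real (\<phi> x))"
    by (simp add: W_def w_def eq_neg_iff_add_eq_0 add.commute)
qed

text \<open>By partial integration, the difference of \<open>f\<close> and any primitive of \<open>g\<close> is orthogonal to the derivatives
of test functions, hence constant.\<close>

lemma weak_deriv_imp_line_prim:
  assumes f: "square_integrable f" and g: "square_integrable g"
    and w: "\<And>\<phi>. test_function \<phi> \<Longrightarrow>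
      (LINT x|lborel. f x * of_real (deriv \<phi> x)) = - (LINT x|lborel. g x * of_real (\<phi> x))"
  obtains F where "line_prim F g" "AE x in lborel. f x = F x"
proof -
  obtain G where G: "line_prim G g"
    using line_prim_exists square_integrable_imp_set_integrable[OF g] by metis
  have "\<exists>c. AE x in lborel. f x - G x = c"
  proof (rule du_Bois_Reymond)
    show "set_integrable lborel {-R..R} (\<lambda>x. f x - G x)" for R
      by (intro set_integral_diff(1) square_integrable_imp_set_integrable f
          borel_integrable_atLeastAtMost' line_prim_continuous[OF G])
    fix \<phi> assume \<phi>: "test_function \<phi>"
    obtain R where R: "0 \<le> R" "\<And>x. R < \<bar>x\<bar> \<Longrightarrow> \<phi> x = 0"
      using test_function_support[OF \<phi>] by blast
    have "integrable lborel (\<lambda>x. f x * of_real (deriv \<phi> x))"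
    proof -
      have "deriv \<phi> x = 0" if "R < \<bar>x\<bar>" for x
        using test_function_deriv_zero[OF \<phi> R(2) that] .
      then show ?thesis
        by (intro integrable_times_compactly_supported[of R])
          (auto intro!: square_integrable_imp_set_integrable f continuous_intros test_function_DERIV[OF \<phi>])
    qed
    then show "(LINT x|lborel. (f x - G x) * of_real (deriv \<phi> x)) = 0"
      using line_prim_weak_deriv[OF G \<phi>] w[OF \<phi>] by (simp add: left_diff_distrib)
  qed
  then obtain c where c: "AE x in lborel. f x - G x = c" by blast
  have "line_prim (\<lambda>x. G x + c) g"
    by (rule line_prim_add_const[OF G])
  moreover have "AE x in lborel. f x = G x + c"
    using c by eventually_elim (simp add: algebra_simps)
  ultimately show ?thesis by (rule that)
qed

lemma test_function_deriv:
  assumes \<phi>: "test_function \<phi>" shows "test_function (deriv \<phi>)"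
proof -
  obtain R where R: "\<And>x. R < \<bar>x\<bar> \<Longrightarrow> \<phi> x = 0"
    using test_function_support[OF \<phi>] by metis
  have "{x. deriv \<phi> x \<noteq> 0} \<subseteq> {-R..R}"
    using test_function_deriv_zero[OF \<phi> R] by (force simp: abs_le_iff not_less)
  then have "bounded {x. deriv \<phi> x \<noteq> 0}"
    by (rule bounded_subset[rotated]) simp
  moreover have "(deriv ^^ n) (deriv \<phi>) differentiable_on UNIV" for n
    using \<phi>[unfolded test_function_def, THEN conjunct1, THEN spec, of "Suc n"] by (simp add: funpow_swap1)
  ultimately show ?thesis
    by (simp add: test_function_def)
qed

text \<open>A function that annihilates all test functions annihilates their derivatives, so it is constant; and
\<open>0\<close> is the only square-integrable constant.\<close>

lemma square_integrable_test_zero: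
  assumes g: "square_integrable g"
    and orth: "\<And>\<phi>. test_function \<phi> \<Longrightarrow> (LINT x|lborel. g x * of_real (\<phi> x)) = 0"
  shows "AE x in lborel. g x = 0"
proof -
  obtain c where c: "AE x in lborel. g x = c"
    using du_Bois_Reymond[OF square_integrable_imp_set_integrable[OF g] orth[OF test_function_deriv]]
    by blast
  have [measurable]: "g \<in> borel_measurable borel"
    using g by (simp add: square_integrable_def)
  have "integrable lborel (\<lambda>x::real. (cmod c)\<^sup>2)"
    using g c unfolding square_integrable_def
    by (subst integrable_cong_AE[of _ _ "\<lambda>x. (cmod (g x))\<^sup>2"]) (auto elim: eventually_mono)
  then have "c = 0"
    by (simp add: integrable_iff_bounded ennreal_mult_less_top split: if_splits)
  with c show ?thesis by simp
qed

section \<open>Weak derivatives of square-integrable equivalence classes\<close>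

lemma eq_AE_refl: "eq_AE f f \<longleftrightarrow> square_integrable f"
  by (auto simp: eq_AE_def)

lemma abs_L2_line_eq_iff:
  assumes "square_integrable f" "square_integrable g"
  shows "abs_L2_line f = abs_L2_line g \<longleftrightarrow> (AE x in lborel. f x = g x)"
  using Quotient_rel[OF Quotient_L2_line, of f g] assms by (simp add: eq_AE_def)

lemma abs_L2_line_cases:
  obtains f where "square_integrable f" "u = abs_L2_line f"
  using Quotient_abs_rep[OF Quotient_L2_line, of u] Quotient_rep_reflp[OF Quotient_L2_line, of u]
  by (metis eq_AE_refl)

lemma has_weak_deriv_abs:
  assumes "square_integrable f" "square_integrable g"
  shows "has_weak_deriv (abs_L2_line f) (abs_L2_line g) \<longleftrightarrow> (\<forall>\<phi>. test_function \<phi> \<longrightarrow>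
     (LINT x|lborel. f x * of_real (deriv \<phi> x)) = - (LINT x|lborel. g x * of_real (\<phi> x)))"
  using assms by (simp add: has_weak_deriv.abs_eq eq_AE_refl)

lemma integrable_times_test_function:
  assumes f: "square_integrable f" and \<phi>: "test_function \<phi>"
  shows "integrable lborel (\<lambda>x. f x * of_real (\<phi> x))"
proof -
  obtain F where "line_prim F f"
    using line_prim_exists square_integrable_imp_set_integrable[OF f] by metis
  then show ?thesis by (rule line_prim_weak_deriv(3)[OF _ \<phi>])
qed

text \<open>Uniqueness of the weak derivative, which evaluates the description operator in
\<^const>\<open>weak_deriv\<close>.\<close>

lemma weak_deriv_eqI:
  assumes "has_weak_deriv u v" shows "weak_deriv u = v"
  unfolding weak_deriv_def
proof (rule the_equality)
  show "has_weak_deriv u v" by (rule assms)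
next
  fix v' assume v': "has_weak_deriv u v'"
  obtain f g g' where *: "square_integrable f" "square_integrable g" "square_integrable g'"
    and eq: "u = abs_L2_line f" "v = abs_L2_line g" "v' = abs_L2_line g'"
    by (metis abs_L2_line_cases)
  have "AE x in lborel. g' x - g x = 0"
  proof (rule square_integrable_test_zero)
    show "square_integrable (\<lambda>x. g' x - g x)"
      using * by (intro square_integrable_diff)
    fix \<phi> assume \<phi>: "test_function \<phi>"
    show "(LINT x|lborel. (g' x - g x) * of_real (\<phi> x)) = 0"
      using assms v' \<phi> integrable_times_test_function[OF *(2) \<phi>] integrable_times_test_function[OF *(3) \<phi>]
      unfolding eq by (simp add: has_weak_deriv_abs * left_diff_distrib)
  qed
  then show "v' = v"
    unfolding eq using * by (subst abs_L2_line_eq_iff) (auto elim: eventually_mono)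
qed

lemma line_prim_has_weak_deriv:
  assumes "line_prim F f" "square_integrable F" "square_integrable f"
  shows "has_weak_deriv (abs_L2_line F) (abs_L2_line f)"
  using assms line_prim_weak_deriv(1)[OF assms(1)] by (simp add: has_weak_deriv_abs)

lemma has_weak_deriv_line_prim:
  assumes "has_weak_deriv u (abs_L2_line g)" "square_integrable g"
  obtains F where "line_prim F g" "square_integrable F" "u = abs_L2_line F"
proof -
  obtain f where f: "square_integrable f" "u = abs_L2_line f"
    by (rule abs_L2_line_cases)
  obtain F where F: "line_prim F g" "AE x in lborel. f x = F x"
    by (rule weak_deriv_imp_line_prim[OF f(1) assms(2)]) (use assms f in \<open>auto simp: has_weak_deriv_abs\<close>)
  have [measurable]: "f \<in> borel_measurable borel" "F \<in> borel_measurable borel"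
    using f line_prim_measurable[OF F(1)] by (auto simp: square_integrable_def)
  have "integrable lborel (\<lambda>x. (cmod (F x))\<^sup>2)"
    using f F(2) unfolding square_integrable_def
    by (subst integrable_cong_AE[of _ _ "\<lambda>x. (cmod (f x))\<^sup>2"]) (auto elim: eventually_mono)
  then have "square_integrable F"
    by (simp add: square_integrable_def)
  then show ?thesis
    using that F f abs_L2_line_eq_iff by metis
qed

section \<open>The eigenvalue equation as a differential equation\<close>

text \<open>The equation \<open>- U'' + q U = f\<close> on \<open>[0, \<infinity>)\<close> as a first-order system for \<open>U\<close> and \<open>U1 = U'\<close>.\<close>

definition half_sol ::
    "complex \<Rightarrow> (real \<Rightarrow> complex) \<Rightarrow> (real \<Rightarrow> complex) \<Rightarrow> (real \<Rightarrow> complex) \<Rightarrow> bool" where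
  "half_sol q f U U1 \<longleftrightarrow> half_prim U U1 \<and> half_prim U1 (\<lambda>x. q * U x - f x)"

text \<open>The equation with coefficient \<open>qp\<close> on the right and \<open>qm\<close> on the left.  The left half is reflected,
which turns \<open>U'\<close> into \<open>- U'(- x)\<close>.  That both halves speak about the same functions \<open>U\<close> and \<open>U1\<close> encodes
the continuity of \<open>U\<close> and \<open>U'\<close> at \<open>0\<close>.\<close>

definition line_sol :: "complex \<Rightarrow> complex \<Rightarrow>
    (real \<Rightarrow> complex) \<Rightarrow> (real \<Rightarrow> complex) \<Rightarrow> (real \<Rightarrow> complex) \<Rightarrow> bool" where
  "line_sol qp qm f U U1 \<longleftrightarrow> half_sol qp f U U1 \<and>
     half_sol qm (\<lambda>x. f (- x)) (\<lambda>x. U (- x)) (\<lambda>x. - U1 (- x))"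

lemma step_potential_measurable [measurable]: "step_potential Vp Vm \<in> borel_measurable borel"
  unfolding step_potential_def by simp

lemma square_integrable_step_mult:
  "square_integrable f \<Longrightarrow> square_integrable (\<lambda>x. step_potential Vp Vm x * f x)"
  by (rule square_integrable_bounded_mult[where K = "max (cmod Vp) (cmod Vm)"])
    (auto simp: step_potential_def)

lemma line_sol_iff_line_prim:
  "line_sol (Vp - z) (Vm - z) f U U1 \<longleftrightarrow>
    line_prim U U1 \<and> line_prim U1 (\<lambda>x. step_potential Vp Vm x * U x - z * U x - f x)"
proof -
  let ?g = "\<lambda>x. step_potential Vp Vm x * U x - z * U x - f x"
  have "half_prim U1 ?g \<longleftrightarrow> half_prim U1 (\<lambda>x. (Vp - z) * U x - f x)"
    by (auto elim!: half_prim_cong simp: step_potential_def left_diff_distrib)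
  moreover have "half_prim (\<lambda>x. - U1 (- x)) (\<lambda>x. ?g (- x)) \<longleftrightarrow>
      half_prim (\<lambda>x. - U1 (- x)) (\<lambda>x. (Vm - z) * U (- x) - f (- x))"
    by (auto elim!: half_prim_cong simp: step_potential_def left_diff_distrib)
  moreover have "half_prim (\<lambda>x. - U1 (- x)) (\<lambda>x. ?g (- x)) \<longleftrightarrow>
      half_prim (\<lambda>x. U1 (- x)) (\<lambda>x. - ?g (- x))"
    using half_prim_uminus[of "\<lambda>x. - U1 (- x)" "\<lambda>x. ?g (- x)"]
      half_prim_uminus[of "\<lambda>x. U1 (- x)" "\<lambda>x. - ?g (- x)"] by auto
  ultimately show ?thesis
    unfolding line_sol_def half_sol_def line_prim_def by auto
qed

lemma act_abs:
  assumes "has_weak_deriv u v" "has_weak_deriv v (abs_L2_line w)" "u = abs_L2_line U"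
    "square_integrable U" "square_integrable w"
  shows "act (shift_op (step_schroedinger Vp Vm) z) u =
    abs_L2_line (\<lambda>x. - w x + step_potential Vp Vm x * U x - z * U x)"
  using assms weak_deriv_eqI[OF assms(1)] weak_deriv_eqI[OF assms(2)]
  by (simp add: shift_op_def step_schroedinger_def uminus_L2_line.abs_eq plus_L2_line.abs_eq
      minus_L2_line.abs_eq scaleC_L2_line.abs_eq step_mult.abs_eq eq_AE_refl square_integrable_uminus
      square_integrable_cmult square_integrable_step_mult square_integrable_add
      square_integrable_diff)

lemma Dom_shift: "Dom (shift_op (step_schroedinger Vp Vm) z) = H2_line"
  by (simp add: shift_op_def step_schroedinger_def)

text \<open>The bridge from the operator on equivalence classes to the differential equation for functions.
An element of \<^const>\<open>H2_line\<close> has a representative that is a primitive of a primitive.\<close>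

lemma schroedinger_eq_iff_line_sol:
  assumes f: "square_integrable f"
  shows "u \<in> H2_line \<and> act (shift_op (step_schroedinger Vp Vm) z) u = abs_L2_line f \<longleftrightarrow>
    (\<exists>U U1. square_integrable U \<and> square_integrable U1 \<and> u = abs_L2_line U \<and>
       line_sol (Vp - z) (Vm - z) f U U1)" (is "?L \<longleftrightarrow> ?R")
proof
  assume L: ?L
  then obtain v w' where vw: "has_weak_deriv u v" "has_weak_deriv v w'"
    by (auto simp: H2_line_def)
  obtain w where w: "square_integrable w" "w' = abs_L2_line w" by (rule abs_L2_line_cases)
  obtain U1 where U1: "line_prim U1 w" "square_integrable U1" "v = abs_L2_line U1"
    using has_weak_deriv_line_prim vw(2) w by metis
  obtain U where U: "line_prim U U1" "square_integrable U" "u = abs_L2_line U"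
    using has_weak_deriv_line_prim vw(1) U1 by metis
  have "abs_L2_line (\<lambda>x. - w x + step_potential Vp Vm x * U x - z * U x) = abs_L2_line f"
    using L act_abs[OF vw(1) _ U(3,2) w(1)] vw(2) w(2) by simp
  moreover have "square_integrable (\<lambda>x. - w x + step_potential Vp Vm x * U x - z * U x)"
    using U w by (intro square_integrable_diff square_integrable_add square_integrable_uminus
        square_integrable_cmult square_integrable_step_mult)
  ultimately have "AE x in lborel. - w x + step_potential Vp Vm x * U x - z * U x = f x"
    using abs_L2_line_eq_iff f by blast
  then have ae: "AE x in lborel. w x = step_potential Vp Vm x * U x - z * U x - f x"
    by eventually_elim (auto simp: algebra_simps)
  have [measurable]: "U \<in> borel_measurable borel" "f \<in> borel_measurable borel" "w \<in> borel_measurable borel"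
    using U f w by (auto simp: square_integrable_def)
  have "line_prim U1 (\<lambda>x. step_potential Vp Vm x * U x - z * U x - f x)"
  proof (rule line_prim_cong_AE[OF U1(1) _ _ ae])
    show "w \<in> borel_measurable lborel" by simp
    show "(\<lambda>x. step_potential Vp Vm x * U x - z * U x - f x) \<in> borel_measurable lborel"
      by measurable
  qed
  then show ?R
    using U U1 line_sol_iff_line_prim[of Vp z Vm f U U1] by auto
next
  assume ?R
  then obtain U U1 where U: "square_integrable U" "square_integrable U1" "u = abs_L2_line U"
    and sol: "line_sol (Vp - z) (Vm - z) f U U1" by blast
  let ?w = "\<lambda>x. step_potential Vp Vm x * U x - z * U x - f x"
  have w: "square_integrable ?w"
    using U f by (intro square_integrable_diff square_integrable_cmult square_integrable_step_mult)
  have "line_prim U U1" "line_prim U1 ?w"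
    using line_sol_iff_line_prim[of Vp z Vm f U U1] sol by auto
  then have wd: "has_weak_deriv u (abs_L2_line U1)" "has_weak_deriv (abs_L2_line U1) (abs_L2_line ?w)"
    using line_prim_has_weak_deriv U w by auto
  then have "u \<in> H2_line" by (auto simp: H2_line_def)
  moreover have "act (shift_op (step_schroedinger Vp Vm) z) u = abs_L2_line f"
    using act_abs[OF wd U(3,1) w] by simp
  ultimately show ?L by simp
qed

section \<open>Square-integrable functions on a half-line\<close>

text \<open>Square integrability on \<open>[0, \<infinity>)\<close>, expressed through the extension by zero so that the closure
properties on the line carry over.\<close>

definition half_L2 :: "(real \<Rightarrow> complex) \<Rightarrow> bool" where
  "half_L2 f \<longleftrightarrow> square_integrable (\<lambda>x. indicator {0..} x *\<^sub>R f x)"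

definition half_sqnorm :: "(real \<Rightarrow> complex) \<Rightarrow> real" where
  "half_sqnorm f = (LINT x|lborel. indicator {0..} x * (cmod (f x))\<^sup>2)"

lemma indicator_cmod_sq: "(cmod (indicator A x *\<^sub>R f x))\<^sup>2 = indicator A x * (cmod (f x))\<^sup>2"
  by (simp add: power_mult_distrib indicator_def)

lemma half_L2_integrable: "half_L2 f \<Longrightarrow> integrable lborel (\<lambda>x. indicator {0..} x * (cmod (f x))\<^sup>2)"
  by (simp add: half_L2_def square_integrable_def indicator_cmod_sq[symmetric] del: norm_scaleR)

lemma half_sqnorm_nonneg: "0 \<le> half_sqnorm f"
  by (simp add: half_sqnorm_def)

lemma half_L2_add: "half_L2 f \<Longrightarrow> half_L2 g \<Longrightarrow> half_L2 (\<lambda>x. f x + g x)"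
  unfolding half_L2_def using square_integrable_add by (simp add: scaleR_add_right)

lemma half_L2_cmult: "half_L2 f \<Longrightarrow> half_L2 (\<lambda>x. c * f x)"
  unfolding half_L2_def by (drule square_integrable_cmult[of _ c]) (simp add: mult_scaleR_right)

lemma half_L2_uminus: "half_L2 f \<Longrightarrow> half_L2 (\<lambda>x. - f x)"
  using half_L2_cmult[of f "-1"] by simp

lemma half_L2_diff: "half_L2 f \<Longrightarrow> half_L2 g \<Longrightarrow> half_L2 (\<lambda>x. f x - g x)"
  using half_L2_add[OF _ half_L2_uminus, of f g] by simp

lemma square_integrable_half_L2: "square_integrable f \<Longrightarrow> half_L2 f"
  unfolding half_L2_def scaleR_conv_of_real
  by (rule square_integrable_bounded_mult[where K = 1]) (auto simp: indicator_def)

lemma square_integrable_reflect: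
  assumes "square_integrable f" shows "square_integrable (\<lambda>x. f (- x))"
proof -
  have "integrable lborel (\<lambda>x. (cmod (f (- x)))\<^sup>2)"
    using assms lborel_integrable_real_affine_iff[of "-1" "\<lambda>x. (cmod (f x))\<^sup>2" 0]
    by (simp add: square_integrable_def)
  moreover have [measurable]: "f \<in> borel_measurable borel"
    using assms by (simp add: square_integrable_def)
  ultimately show ?thesis by (simp add: square_integrable_def)
qed

lemma half_L2_set_integrable:
  assumes "half_L2 f" "0 \<le> a" shows "set_integrable lborel {a..b} f"
proof -
  have "set_integrable lborel {a..b} (\<lambda>x. indicator {0..} x *\<^sub>R f x)"
    using assms by (intro square_integrable_imp_set_integrable) (simp add: half_L2_def)
  then show ?thesis
    by (rule set_integrable_cong[THEN iffD1, rotated -1]) (use assms in auto)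
qed

lemma integral_split_halves_real:
  fixes k :: "real \<Rightarrow> real"
  assumes k: "integrable lborel k"
  shows "(LINT x|lborel. k x) = (LINT x|lborel. indicator {0..} x * k x)
      + (LINT x|lborel. indicator {0..} x * k (- x))"
proof -
  have "(LINT x|lborel. complex_of_real (k x)) = (LINT x:{0..}|lborel. complex_of_real (k x))
      + (LINT x:{0..}|lborel. complex_of_real (k (- x)))"
    using integral_split_halves[of "\<lambda>x. complex_of_real (k x)"] k by simp
  then have "complex_of_real (LINT x|lborel. k x) = complex_of_real ((LINT x|lborel. indicator {0..}
      x * k x) + (LINT x|lborel. indicator {0..} x * k (- x)))"
    by (simp add: set_lebesgue_integral_def scaleR_conv_of_real flip: of_real_mult)
  then show ?thesis by (simp only: of_real_eq_iff)
qed

text \<open>Measurability on the line is part of the conclusion: \<open>U\<close> is put together from two measurable halves.\<close>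

lemma square_integrable_from_halves:
  assumes U': "half_L2 U" "half_L2 (\<lambda>x. U (- x))"
  shows "square_integrable U"
    and "(LINT x|lborel. (cmod (U x))\<^sup>2) = half_sqnorm U + half_sqnorm (\<lambda>x. U (- x))"
proof -
  have "U \<in> borel_measurable lborel"
  proof -
    have m1: "(\<lambda>x. indicator {0..} x *\<^sub>R U x) \<in> borel_measurable lborel"
      using U'(1) by (simp add: half_L2_def square_integrable_def)
    have m2: "(\<lambda>x. indicator {0..} (- x) *\<^sub>R U x) \<in> borel_measurable lborel"
      using square_integrable_reflect[OF U'(2)[unfolded half_L2_def]] by (simp add: square_integrable_def)
    have "U = (\<lambda>x. if 0 \<le> x then indicator {0..} x *\<^sub>R U x else indicator {0..} (- x) *\<^sub>R U x)"
      by auto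
    also have "\<dots> \<in> borel_measurable lborel"
      using m1 m2 by measurable
    finally show ?thesis .
  qed
  note U = this U'
  have "square_integrable (\<lambda>x. indicator {0..} (- x) *\<^sub>R U (- (- x)))"
    using square_integrable_reflect[OF U(3)[unfolded half_L2_def]] .
  then have "square_integrable (\<lambda>x. indicator {0..} x *\<^sub>R U x + indicator {0..} (- x) *\<^sub>R U x)"
    using U(2) by (auto simp: half_L2_def intro: square_integrable_add)
  then have "integrable lborel (\<lambda>x. (cmod (indicator {0..} x *\<^sub>R U x + indicator {0..} (- x) *\<^sub>R U x))\<^sup>2)"
    by (simp add: square_integrable_def)
  then have "integrable lborel (\<lambda>x. (cmod (U x))\<^sup>2)"
  proof (rule Bochner_Integration.integrable_bound)
    show "(\<lambda>x. (cmod (U x))\<^sup>2) \<in> borel_measurable lborel" using U by measurable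
    have "cmod (U x) \<le> cmod (indicator {0..} x *\<^sub>R U x + indicator {0..} (- x) *\<^sub>R U x)" for x
      by (auto simp: indicator_def scaleR_conv_of_real norm_mult simp flip: mult_2)
    then show "AE x in lborel. norm ((cmod (U x))\<^sup>2) \<le>
        norm ((cmod (indicator {0..} x *\<^sub>R U x + indicator {0..} (- x) *\<^sub>R U x))\<^sup>2)"
      by (intro AE_I2) (simp add: power_mono)
  qed
  with U show "square_integrable U" "(LINT x|lborel. (cmod (U x))\<^sup>2) = half_sqnorm U
      + half_sqnorm (\<lambda>x. U (- x))"
    using integral_split_halves_real[of "\<lambda>x. (cmod (U x))\<^sup>2"]
    by (auto simp: square_integrable_def half_sqnorm_def)
qed

text \<open>Monotone convergence.  All a priori estimates below bound integrals over \<open>[0, X]\<close>, uniformly in \<open>X\<close>.\<close>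

lemma half_L2_of_bounded_integrals:
  assumes c: "\<And>X. continuous_on {0..X} F"
    and b: "\<And>X. 0 \<le> X \<Longrightarrow> (LINT x:{0..X}|lborel. (cmod (F x))\<^sup>2) \<le> M"
  shows "half_L2 F" "half_sqnorm F \<le> M"
proof -
  define G where "G n x = indicator {0..real n} x * (cmod (F x))\<^sup>2" for n x
  have iG: "integrable lborel (G n)" for n
  proof -
    have "continuous_on {0..real n} (\<lambda>x. (cmod (F x))\<^sup>2)"
      by (intro continuous_intros c)
    from borel_integrable_atLeastAtMost'[OF this] show ?thesis
      by (simp add: G_def[abs_def] set_integrable_def)
  qed
  have GM: "integral\<^sup>L lborel (G n) \<le> M" for n
    using b[of "real n"] unfolding G_def set_lebesgue_integral_def by simp
  have mono: "G m x \<le> G n x" if "m \<le> n" for m n x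
    using that by (auto simp: G_def indicator_def)
  have "incseq (\<lambda>n. integral\<^sup>L lborel (G n))"
    unfolding incseq_def using mono iG by (auto intro!: integral_mono)
  then obtain L where L: "(\<lambda>n. integral\<^sup>L lborel (G n)) \<longlonglongrightarrow> L"
    using incseq_convergent GM by metis
  have lim: "\<forall>\<^sub>F n in sequentially. indicator {0..real n} x = (indicator {0..} x :: real)" for x
  proof -
    obtain N where "\<bar>x\<bar> \<le> real N" using real_arch_simple by blast
    then show ?thesis
      unfolding eventually_sequentially by (intro exI[of _ N]) (auto simp: indicator_def)
  qed
  have mF: "(\<lambda>x. indicator {0..real n} x *\<^sub>R F x) \<in> borel_measurable lborel" for n
    using borel_integrable_atLeastAtMost'[OF c[of "real n"]] by (simp add: set_integrable_def)
  have m: "(\<lambda>x. indicator {0..} x *\<^sub>R F x) \<in> borel_measurable lborel"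
  proof (rule borel_measurable_LIMSEQ_metric[OF mF])
    fix x
    show "(\<lambda>n. indicator {0..real n} x *\<^sub>R F x) \<longlonglongrightarrow> indicator {0..} x *\<^sub>R F x"
      by (rule tendsto_eventually) (use lim[of x] in \<open>auto elim: eventually_mono\<close>)
  qed
  have m2: "(\<lambda>x. indicator {0..} x * (cmod (F x))\<^sup>2) \<in> borel_measurable lborel"
    unfolding indicator_cmod_sq[symmetric] using m by measurable
  have gl: "(\<lambda>n. G n x) \<longlonglongrightarrow> indicator {0..} x * (cmod (F x))\<^sup>2" for x
    unfolding G_def by (rule tendsto_eventually) (use lim[of x] in \<open>auto elim: eventually_mono\<close>)
  have 1: "integrable lborel (\<lambda>x. indicator {0..} x * (cmod (F x))\<^sup>2)"
    and 2: "integral\<^sup>L lborel (\<lambda>x. indicator {0..} x * (cmod (F x))\<^sup>2) = L"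
    by (rule integral_monotone_convergence_nonneg[OF iG _ _ _ L m2];
        auto intro!: AE_I2 gl mono simp: mono_def; simp add: G_def)+
  show "half_L2 F"
    using 1 m unfolding half_L2_def square_integrable_def indicator_cmod_sq by simp
  show "half_sqnorm F \<le> M"
    unfolding half_sqnorm_def 2 using LIMSEQ_le_const2[OF L] GM by blast
qed

lemma half_L2_integral_le:
  assumes "half_L2 f"
  shows "(LINT x:{0..X}|lborel. (cmod (f x))\<^sup>2) \<le> half_sqnorm f"
    and "set_integrable lborel {0..X} (\<lambda>x. (cmod (f x))\<^sup>2)"
proof -
  have i: "integrable lborel (\<lambda>x. indicator {0..X} x *\<^sub>R (indicator {0..} x * (cmod (f x))\<^sup>2))"
    by (rule integrable_mult_indicator[OF _ half_L2_integrable[OF assms]]) simp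
  moreover have "(\<lambda>x. indicator {0..X} x *\<^sub>R (indicator {0..} x * (cmod (f x))\<^sup>2))
      = (\<lambda>x. indicator {0..X} x *\<^sub>R (cmod (f x))\<^sup>2)"
    by (auto simp: indicator_def)
  ultimately show i': "set_integrable lborel {0..X} (\<lambda>x. (cmod (f x))\<^sup>2)"
    by (simp only: set_integrable_def)
  show "(LINT x:{0..X}|lborel. (cmod (f x))\<^sup>2) \<le> half_sqnorm f"
    unfolding half_sqnorm_def set_lebesgue_integral_def
    by (rule integral_mono[OF i'[unfolded set_integrable_def] half_L2_integrable[OF assms]])
      (auto simp: indicator_def)
qed

section \<open>First-order equations and energy estimates\<close>

lemma half_prim_exp: "half_prim (\<lambda>x. exp (c * of_real x)) (\<lambda>x. c * exp (c * of_real x))"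
proof (rule half_prim_C1)
  fix x :: real
  have "((\<lambda>w. exp (c * w)) has_field_derivative c * exp (c * of_real x)) (at (of_real x))"
    by (auto intro!: derivative_eq_intros)
  then show "((\<lambda>x. exp (c * of_real x)) has_vector_derivative c * exp (c * of_real x)) (at x within {0..})"
    using has_vector_derivative_real_field has_vector_derivative_at_within by blast
qed (intro continuous_intros)

text \<open>The function \<open>e\<^sup>-\<^sup>c\<^sup>x W x\<close> has derivative \<open>- e\<^sup>-\<^sup>c\<^sup>x f x\<close>.\<close>

lemma variation_of_constants:
  assumes W: "half_prim W (\<lambda>x. c * W x - f x)" and x: "0 \<le> x"
  shows "W x = exp (c * of_real x) * (W 0 - (LINT y:{0..x}|lborel. exp (- c * of_real y) * f y))"
proof -
  have "half_prim (\<lambda>x. exp (- c * of_real x) * W x) (\<lambda>x. - (exp (- c * of_real x) * f x))"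
    using half_prim_mult[OF half_prim_exp[of "- c"] W]
    by (rule half_prim_cong) (auto simp: algebra_simps)
  from half_primD(2)[OF half_prim_uminus[OF this] x]
  have "exp (- c * of_real x) * W x = W 0 - (LINT y:{0..x}|lborel. exp (- c * of_real y) * f y)"
    by (simp add: algebra_simps)
  then have "exp (c * of_real x) * (exp (- c * of_real x) * W x) =
      exp (c * of_real x) * (W 0 - (LINT y:{0..x}|lborel. exp (- c * of_real y) * f y))"
    by simp
  then show ?thesis
    by (simp add: mult.assoc[symmetric] exp_add[symmetric])
qed

lemma exp_mult_set_integrable:
  fixes f :: "real \<Rightarrow> complex"
  assumes "set_integrable lborel {a..b} f"
  shows "set_integrable lborel {a..b} (\<lambda>y. exp (c * of_real y) * f y)"
  by (rule set_integrable_continuous_mult[OF _ assms]) (intro continuous_intros)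

lemma first_order_exists:
  assumes f: "\<And>x. 0 \<le> x \<Longrightarrow> set_integrable lborel {0..x} f"
  obtains W where "half_prim W (\<lambda>x. c * W x - f x)" "W 0 = p"
    "\<And>x. W x = exp (c * of_real x) * (p - (LINT y:{0..x}|lborel. exp (- c * of_real y) * f y))"
proof -
  define P where "P x = (LINT y:{0..x}|lborel. exp (- c * of_real y) * f y)" for x
  have P: "half_prim P (\<lambda>y. exp (- c * of_real y) * f y)"
  proof -
    have "half_prim (\<lambda>x. 0 + (LINT y:{0..x}|lborel. exp (- c * of_real y) * f y)) (\<lambda>y. exp (- c *
        of_real y) * f y)"
      by (rule half_prim_exists) (rule exp_mult_set_integrable[OF f])
    then show ?thesis by (simp add: P_def[abs_def])
  qed
  define W where "W x = exp (c * of_real x) * (p - P x)" for x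
  have "half_prim W (\<lambda>x. c * W x - f x)"
  proof (rule half_prim_cong[OF half_prim_mult[OF half_prim_exp half_prim_diff[OF half_prim_const P]]])
    fix x :: real
    have ee: "exp (c * of_real x) * exp (- c * of_real x) = 1"
      by (simp add: exp_minus_inverse)
    have "c * exp (c * of_real x) * (p - P x) + exp (c * of_real x) * (0 - exp (- c * of_real x) * f x) =
        c * (exp (c * of_real x) * (p - P x)) - (exp (c * of_real x) * exp (- c * of_real x)) * f x"
      by (simp only: algebra_simps) simp
    then show "c * exp (c * of_real x) * (p - P x) + exp (c * of_real x) * (0
        - exp (- c * of_real x) * f x) =
        c * W x - f x"
      unfolding ee W_def by simp
  qed (simp add: W_def)
  moreover have "W 0 = p" by (simp add: W_def P_def set_integral_point)
  ultimately show ?thesis using that by (simp add: W_def P_def)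
qed

text \<open>Since \<open>(|W|\<^sup>2)' = 2 Re (W' cnj W)\<close>, integration of the product rule for \<open>W\<close> and its conjugate gives the
change of \<open>|W|\<^sup>2\<close>.\<close>

lemma energy_identity:
  assumes W: "half_prim W (\<lambda>x. c * W x - f x)" and X: "0 \<le> X"
  shows "set_integrable lborel {0..X} (\<lambda>x. 2 * Re c * (cmod (W x))\<^sup>2 - 2 * Re (f x * cnj (W x)))"
    and "(cmod (W X))\<^sup>2 - (cmod (W 0))\<^sup>2 =
      (LINT x:{0..X}|lborel. 2 * Re c * (cmod (W x))\<^sup>2 - 2 * Re (f x * cnj (W x)))"
proof -
  let ?k = "\<lambda>x. (c * W x - f x) * cnj (W x) + W x * cnj (c * W x - f x)"
  have eq: "?k x = complex_of_real (2 * Re c * (cmod (W x))\<^sup>2 - 2 * Re (f x * cnj (W x)))" for x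
    unfolding cmod_power2 by (simp add: complex_eq_iff power2_eq_square algebra_simps)
  have W2: "W x * cnj (W x) = complex_of_real ((cmod (W x))\<^sup>2)" for x
    by (rule complex_norm_square[symmetric])
  note D = half_primD[OF half_prim_mult[OF W half_prim_cnj[OF W]] X, unfolded eq W2]
  have "set_integrable lborel {0..X} (\<lambda>x. Re (complex_of_real (2 * Re c * (cmod (W x))\<^sup>2
      - 2 * Re (f x * cnj (W x)))))"
    using integrable_Re[OF D(1)[unfolded set_integrable_def]] by (simp add: set_integrable_def)
  then show "set_integrable lborel {0..X} (\<lambda>x. 2 * Re c * (cmod (W x))\<^sup>2 - 2 * Re (f x * cnj (W x)))"
    by simp
  have "complex_of_real ((cmod (W X))\<^sup>2 - (cmod (W 0))\<^sup>2) = complex_of_real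
      (LINT x:{0..X}|lborel. 2 * Re c * (cmod (W x))\<^sup>2 - 2 * Re (f x * cnj (W x)))"
    using D(2)[unfolded set_integral_complex_of_real] by (simp only: of_real_diff)
  then show "(cmod (W X))\<^sup>2 - (cmod (W 0))\<^sup>2 =
      (LINT x:{0..X}|lborel. 2 * Re c * (cmod (W x))\<^sup>2 - 2 * Re (f x * cnj (W x)))"
    by (simp only: of_real_eq_iff)
qed

lemma cross_term_bound:
  assumes "0 < r"
  shows "2 * \<bar>Re (v * cnj w)\<bar> \<le> r * (cmod w)\<^sup>2 + (cmod v)\<^sup>2 / r"
proof -
  have "\<bar>Re (v * cnj w)\<bar> \<le> cmod v * cmod w"
    using abs_Re_le_cmod[of "v * cnj w"] by (simp add: norm_mult)
  moreover have "2 * (cmod v * cmod w) \<le> r * (cmod w)\<^sup>2 + (cmod v)\<^sup>2 / r"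
  proof -
    have "0 \<le> (r * cmod w - cmod v)\<^sup>2 / r" using assms by simp
    also have "\<dots> = r * (cmod w)\<^sup>2 + (cmod v)\<^sup>2 / r - 2 * (cmod v * cmod w)"
      using assms by (simp add: power2_diff field_simps power2_eq_square)
    finally show ?thesis by simp
  qed
  ultimately show ?thesis by linarith
qed

text \<open>The inhomogeneous term is absorbed by half of \<open>2 Re c |W|\<^sup>2\<close>.  If \<open>Re c > 0\<close>, the norm of \<open>W\<close> on
\<open>[0, X]\<close> is controlled by \<open>f\<close> and the value at the right end, and if \<open>Re c < 0\<close> by \<open>f\<close> and the initial value.\<close>

lemma energy_estimate:
  assumes W: "half_prim W (\<lambda>x. c * W x - f x)" and X: "0 \<le> X" and f: "half_L2 f" and r: "0 < r"
  shows "Re c = r \<Longrightarrow> r * (LINT x:{0..X}|lborel. (cmod (W x))\<^sup>2) \<le> (cmod (W X))\<^sup>2 - (cmod (W 0))\<^sup>2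
      + half_sqnorm f / r"
    and "Re c = - r \<Longrightarrow> r * (LINT x:{0..X}|lborel. (cmod (W x))\<^sup>2) \<le> (cmod (W 0))\<^sup>2 - (cmod (W X))\<^sup>2
        + half_sqnorm f / r"
proof -
  have iW: "set_integrable lborel {0..X} (\<lambda>x. (cmod (W x))\<^sup>2)"
    by (rule borel_integrable_atLeastAtMost') (intro continuous_intros half_prim_continuous[OF W])
  note if2 = half_L2_integral_le[OF f, of X]
  let ?A = "LINT x:{0..X}|lborel. (cmod (W x))\<^sup>2" and ?B = "LINT x:{0..X}|lborel. (cmod (f x))\<^sup>2"
  have B: "?B / r \<le> half_sqnorm f / r" using if2(1) r by (simp add: divide_right_mono)
  note E = energy_identity[OF W X]
  have iC: "set_integrable lborel {0..X} (\<lambda>x. r * (cmod (W x))\<^sup>2 - (cmod (f x))\<^sup>2 / r)"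
    using iW if2(2) by (intro set_integral_diff(1)) auto
  have C: "(LINT x:{0..X}|lborel. r * (cmod (W x))\<^sup>2 - (cmod (f x))\<^sup>2 / r) = r * ?A - ?B / r"
    using iW if2(2) by (subst set_integral_diff(2)) auto
  have iD: "set_integrable lborel {0..X} (\<lambda>x. (cmod (f x))\<^sup>2 / r - r * (cmod (W x))\<^sup>2)"
    using iW if2(2) by (intro set_integral_diff(1)) auto
  have D: "(LINT x:{0..X}|lborel. (cmod (f x))\<^sup>2 / r - r * (cmod (W x))\<^sup>2) = ?B / r - r * ?A"
    using iW if2(2) by (subst set_integral_diff(2)) auto
  {
    assume c: "Re c = r"
    have "r * (cmod (W x))\<^sup>2 - (cmod (f x))\<^sup>2 / r \<le> 2 * Re c * (cmod (W x))\<^sup>2 - 2 * Re (f x * cnj (W x))" for x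
      using cross_term_bound[OF r, of "f x" "W x"] unfolding c by linarith
    from set_integral_mono[OF iC E(1) this]
    show "r * ?A \<le> (cmod (W X))\<^sup>2 - (cmod (W 0))\<^sup>2 + half_sqnorm f / r"
      using B unfolding C E(2)[symmetric] by linarith
  }
  {
    assume c: "Re c = - r"
    have "2 * Re c * (cmod (W x))\<^sup>2 - 2 * Re (f x * cnj (W x)) \<le> (cmod (f x))\<^sup>2 / r - r * (cmod (W x))\<^sup>2" for x
      using cross_term_bound[OF r, of "f x" "W x"] unfolding c by linarith
    from set_integral_mono[OF E(1) iD this]
    show "r * ?A \<le> (cmod (W 0))\<^sup>2 - (cmod (W X))\<^sup>2 + half_sqnorm f / r"
      using B unfolding D E(2)[symmetric] by linarith
  }
qed

section \<open>Square-integrable solutions on a half-line\<close>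

text \<open>The Cauchy-Schwarz inequality for complex functions, from the one in \<^typ>\<open>L2_line\<close> applied to the
absolute values.\<close>

lemma integral_norm_mult_le:
  assumes f: "square_integrable f" and g: "square_integrable g"
  shows "integrable lborel (\<lambda>x. f x * g x)"
    and "cmod (LINT x|lborel. f x * g x) \<le>
      sqrt (LINT x|lborel. (cmod (f x))\<^sup>2) * sqrt (LINT x|lborel. (cmod (g x))\<^sup>2)"
proof -
  have [measurable]: "f \<in> borel_measurable borel" "g \<in> borel_measurable borel"
    using f g by (auto simp: square_integrable_def)
  let ?F = "\<lambda>x. complex_of_real (cmod (f x))" and ?G = "\<lambda>x. complex_of_real (cmod (g x))"
  have F: "square_integrable ?F" and G: "square_integrable ?G"
    using f g by (auto simp: square_integrable_def)
  have eq: "?F x \<bullet> ?G x = cmod (f x * g x)" for x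
    by (simp add: inner_complex_def norm_mult)
  have i: "integrable lborel (\<lambda>x. cmod (f x * g x))"
    using integrable_inner_square_integrable[OF F G] unfolding eq .
  show i': "integrable lborel (\<lambda>x. f x * g x)"
    by (rule integrable_norm_cancel[OF i]) measurable
  have "abs_L2_line ?F \<bullet> abs_L2_line ?G = (LINT x|lborel. cmod (f x * g x))"
    using F G by (simp add: inner_L2_line.abs_eq eq_AE_refl eq del: inner_complex_def)
  then have "(LINT x|lborel. cmod (f x * g x)) \<le> norm (abs_L2_line ?F) * norm (abs_L2_line ?G)"
    by (metis norm_cauchy_schwarz)
  then have "(LINT x|lborel. cmod (f x * g x)) \<le>
      sqrt (LINT x|lborel. (cmod (f x))\<^sup>2) * sqrt (LINT x|lborel. (cmod (g x))\<^sup>2)"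
    using F G by (simp add: norm_L2_line.abs_eq eq_AE_refl del: norm_mult)
  then show "cmod (LINT x|lborel. f x * g x) \<le>
      sqrt (LINT x|lborel. (cmod (f x))\<^sup>2) * sqrt (LINT x|lborel. (cmod (g x))\<^sup>2)"
    by (rule order_trans[OF integral_norm_bound])
qed

lemma has_integral_exp_decay:
  fixes k x :: real
  assumes k: "0 < k"
  shows "has_bochner_integral lborel (\<lambda>y. indicator {x..} y * exp (- (k * y))) (exp (- (k * x)) / k)"
proof (rule has_bochner_integral_nn_integral)
  have "(\<integral>\<^sup>+y. ennreal (exp (- (k * y))) * indicator {x..} y \<partial>lborel) = ennreal (0
      - (- exp (- (k * x)) / k))"
  proof (rule nn_integral_FTC_atLeast)
    show "((\<lambda>y. - exp (- (k * y)) / k) has_real_derivative exp (- (k * y))) (at y)" for y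
      using k by (auto intro!: derivative_eq_intros)
    have "filterlim (\<lambda>y. k * y) at_top at_top"
      using k by (rule filterlim_tendsto_pos_mult_at_top[OF tendsto_const _ filterlim_ident])
    then have "((\<lambda>y. exp (- (k * y))) \<longlongrightarrow> 0) at_top"
      by (intro filterlim_compose[OF exp_at_bot] filterlim_compose[OF filterlim_uminus_at_bot_at_top])
    from tendsto_divide[OF tendsto_minus[OF this] tendsto_const[of k]]
    show "((\<lambda>y. - exp (- (k * y)) / k) \<longlongrightarrow> 0) at_top"
      using k by simp
  qed (use k in auto)
  moreover have "(\<integral>\<^sup>+y. ennreal (exp (- (k * y))) * indicator {x..} y \<partial>lborel)
      = (\<integral>\<^sup>+y. ennreal (indicator {x..} y * exp (- (k * y))) \<partial>lborel)"
    by (rule nn_integral_cong) (auto simp: indicator_def)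
  ultimately show "(\<integral>\<^sup>+y. ennreal (indicator {x..} y * exp (- (k * y))) \<partial>lborel)
      = ennreal (exp (- (k * x)) / k)"
    by simp
qed (use k in auto)

lemma square_integrable_exp_tail:
  assumes r: "0 < Re a"
  shows "square_integrable (\<lambda>y. indicator {x..} y *\<^sub>R exp (- a * of_real y))"
    and "(LINT y|lborel. (cmod (indicator {x..} y *\<^sub>R exp (- a * of_real y)))\<^sup>2)
        = exp (- (2 * Re a * x)) / (2 * Re a)"
proof -
  have eq: "(cmod (indicator {x..} y *\<^sub>R exp (- a * of_real y)))\<^sup>2
      = indicator {x..} y * exp (- (2 * Re a * y))" for y
    by (cases "y \<in> {x..}") (simp_all add: exp_double[symmetric] mult.assoc)
  have h: "has_bochner_integral lborel (\<lambda>y. indicator {x..} y * exp (- (2 * Re a * y))) (exp (- (2 *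
      Re a * x)) / (2 * Re a))"
    using has_integral_exp_decay[of "2 * Re a" x] r by simp
  show "square_integrable (\<lambda>y. indicator {x..} y *\<^sub>R exp (- a * of_real y))"
    unfolding square_integrable_def eq using h by (auto simp: has_bochner_integral_iff)
  show "(LINT y|lborel. (cmod (indicator {x..} y *\<^sub>R exp (- a * of_real y)))\<^sup>2)
      = exp (- (2 * Re a * x)) / (2 * Re a)"
    unfolding eq using h by (simp add: has_bochner_integral_iff)
qed

text \<open>For \<open>Re a > 0\<close> the solutions of \<open>Y' = a Y - f\<close> grow, with one exception,
\<open>Y x = \<integral>\<^sub>x\<^sup>\<infinity> e\<^sup>a\<^sup>(\<^sup>x\<^sup>-\<^sup>y\<^sup>) f y dy\<close>.  By Cauchy-Schwarz it is bounded by the norm of \<open>f\<close>, and the energy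
estimate turns this pointwise bound into a bound for the norm.\<close>

lemma decaying_first_order:
  assumes r: "0 < Re a" and f: "half_L2 f"
  obtains Y where "half_prim Y (\<lambda>x. a * Y x - f x)" "half_L2 Y"
    "half_sqnorm Y \<le> 3 / (2 * (Re a)\<^sup>2) * half_sqnorm f" "(cmod (Y 0))\<^sup>2 \<le> half_sqnorm f / (2 * Re a)"
proof -
  let ?h = "\<lambda>y. exp (- a * of_real y) * f y"
  let ?fi = "\<lambda>y. indicator {0..} y *\<^sub>R f y"
  let ?N = "half_sqnorm f"
  have fi: "square_integrable ?fi" using f by (simp add: half_L2_def)
  have N: "(LINT x|lborel. (cmod (?fi x))\<^sup>2) = ?N"
    unfolding half_sqnorm_def indicator_cmod_sq ..
  have prod: "(\<lambda>y. (indicator {x..} y *\<^sub>R exp (- a * of_real y)) * ?fi y) = (\<lambda>y. indicator {x..} y *\<^sub>R ?h y)"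
    if "0 \<le> x" for x
    using that by (auto simp: indicator_def)
  have ih: "set_integrable lborel {x..} ?h" if "0 \<le> x" for x
    using integral_norm_mult_le(1)[OF square_integrable_exp_tail(1)[OF r] fi]
    unfolding set_integrable_def prod[OF that, symmetric] .
  have tail: "(cmod (exp (a * of_real x) * (LINT y:{x..}|lborel. ?h y)))\<^sup>2 \<le> ?N / (2 * Re a)" if x:
      "0 \<le> x" for x
  proof -
    have "cmod (LINT y:{x..}|lborel. ?h y) \<le> sqrt (exp (- (2 * Re a * x)) / (2 * Re a)) * sqrt ?N"
      using integral_norm_mult_le(2)[OF square_integrable_exp_tail(1)[OF r, of x] fi]
      unfolding prod[OF x] square_integrable_exp_tail(2)[OF r] N by (simp add: set_lebesgue_integral_def)
    then have "(cmod (LINT y:{x..}|lborel. ?h y))\<^sup>2 \<le> (sqrt (exp (- (2 * Re a * x)) / (2 * Re a)) *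
        sqrt ?N)\<^sup>2"
      by (rule power_mono) simp
    also have "\<dots> = exp (- (2 * Re a * x)) / (2 * Re a) * ?N"
      using r half_sqnorm_nonneg[of f] by (simp add: power_mult_distrib)
    finally have "(cmod (LINT y:{x..}|lborel. ?h y))\<^sup>2 \<le> exp (- (2 * Re a * x)) / (2 * Re a) * ?N" .
    then have "(exp (Re a * x))\<^sup>2 * (cmod (LINT y:{x..}|lborel. ?h y))\<^sup>2
        \<le> (exp (Re a * x))\<^sup>2 * (exp (- (2 * Re a * x)) / (2 * Re a) * ?N)"
      by (rule mult_left_mono) simp
    also have "\<dots> = ?N / (2 * Re a)"
      by (simp add: exp_double[symmetric] exp_minus field_simps)
    finally show ?thesis by (simp add: norm_mult power_mult_distrib)
  qed
  \<comment> \<open>The initial value of the decaying solution.\<close>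
  obtain Y where Y: "half_prim Y (\<lambda>x. a * Y x - f x)" "Y 0 = (LINT y:{0..}|lborel. ?h y)"
    "\<And>x. Y x = exp (a * of_real x) * ((LINT y:{0..}|lborel. ?h y) - (LINT y:{0..x}|lborel. ?h y))"
    using half_L2_set_integrable[OF f order_refl]
    by (rule first_order_exists[of f a "LINT y:{0..}|lborel. ?h y"]) (rule that)
  have Yx: "Y x = exp (a * of_real x) * (LINT y:{x..}|lborel. ?h y)" if x: "0 \<le> x" for x
  proof -
    have "(LINT y:{0..x} \<union> {x..}|lborel. ?h y) = (LINT y:{0..x}|lborel. ?h y) + (LINT y:{x..}|lborel. ?h y)"
    proof (rule set_integral_Un_AE)
      have "AE y in lborel. y \<noteq> x" by (rule AE_lborel_singleton)
      then show "AE y in lborel. \<not> (y \<in> {0..x} \<and> y \<in> {x..})" by eventually_elim auto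
      show "set_integrable lborel {0..x} ?h"
        by (rule set_integrable_subset[OF ih[OF order_refl]]) auto
    qed (use ih[OF x] in auto)
    moreover have "{0..x} \<union> {x..} = {0..}" using x by auto
    ultimately show ?thesis using Y(3)[of x] by simp
  qed
  have Yb: "(cmod (Y x))\<^sup>2 \<le> ?N / (2 * Re a)" if "0 \<le> x" for x
    using tail[OF that] unfolding Yx[OF that] .
  have bd: "(LINT x:{0..X}|lborel. (cmod (Y x))\<^sup>2) \<le> 3 / (2 * (Re a)\<^sup>2) * ?N" if X: "0 \<le> X" for X
  proof -
    have "Re a * (LINT x:{0..X}|lborel. (cmod (Y x))\<^sup>2) \<le> ?N / (2 * Re a) + ?N / Re a"
      using energy_estimate(1)[OF Y(1) X f r refl] Yb[OF X] zero_le_power2[of "cmod (Y 0)"] by linarith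
    then show ?thesis using r by (simp add: field_simps power2_eq_square)
  qed
  show ?thesis
    using that[OF Y(1)] half_L2_of_bounded_integrals[OF half_prim_continuous[OF Y(1)] bd] Yb[of 0] by auto
qed

text \<open>The factorization \<open>\<partial>\<^sup>2 - a\<^sup>2 = (\<partial> - a) (\<partial> + a)\<close>, with \<open>Y = U' + a U\<close>.  Unlike
the fundamental system \<open>e\<^sup>a\<^sup>x\<close>, \<open>e\<^sup>-\<^sup>a\<^sup>x\<close> it does not degenerate for \<open>a = 0\<close>.\<close>

lemma half_sol_factorized:
  assumes Y: "half_prim Y (\<lambda>x. a * Y x - f x)" and U: "half_prim U (\<lambda>x. - a * U x - (- Y x))"
  shows "half_sol (a\<^sup>2) f U (\<lambda>x. Y x - a * U x)"
  unfolding half_sol_def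
proof
  show "half_prim U (\<lambda>x. Y x - a * U x)"
    by (rule half_prim_cong[OF U]) auto
  show "half_prim (\<lambda>x. Y x - a * U x) (\<lambda>x. a\<^sup>2 * U x - f x)"
    by (rule half_prim_cong[OF half_prim_diff[OF Y half_prim_cmult[OF U]]])
      (auto simp: algebra_simps power2_eq_square)
qed

lemma half_prim_loc_integrable: "half_prim F f \<Longrightarrow> set_integrable lborel {0..x} (\<lambda>x. - F x)"
  using borel_integrable_atLeastAtMost'[OF half_prim_continuous, of "\<lambda>x. - F x" "\<lambda>x.
      - f x"] half_prim_uminus by blast

text \<open>The square-integrable solutions form a one-parameter family, with the value \<open>p\<close> at \<open>0\<close> as the parameter:
\<open>Y = U' + a U\<close> must be the decaying solution of its equation, whereas every solution \<open>U\<close> of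
\<open>U' = - a U + Y\<close> is square-integrable.  The number \<open>y0\<close> is \<open>Y 0\<close>.\<close>

lemma half_resolvent:
  assumes r: "0 < Re a"
  obtains K where "0 \<le> K" "\<And>f. half_L2 f \<Longrightarrow> \<exists>y0. (cmod y0)\<^sup>2 \<le> K * half_sqnorm f \<and>
    (\<forall>p. \<exists>U U1. half_sol (a\<^sup>2) f U U1 \<and> U 0 = p \<and> U1 0 = y0 - a * p \<and> half_L2 U \<and> half_L2 U1 \<and>
       half_sqnorm U \<le> K * ((cmod p)\<^sup>2 + half_sqnorm f))"
proof -
  \<comment> \<open>The constant \<open>k1\<close> bounds \<open>Y 0\<close>, whereas \<open>k2\<close> and \<open>k3\<close> come from the energy estimate for \<open>U\<close>.\<close>
  define k1 k2 k3 where "k1 = 1 / (2 * Re a)" and "k2 = 1 / Re a" and "k3 = 3 / (2 * (Re a)\<^sup>2) / (Re a)\<^sup>2"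
  have k: "0 \<le> k1" "0 \<le> k2" "0 \<le> k3" using r by (auto simp: k1_def k2_def k3_def)
  show ?thesis
  proof (rule that[of "k1 + k2 + k3"])
    fix f assume f: "half_L2 f"
    let ?N = "half_sqnorm f"
    have N: "0 \<le> ?N" by (rule half_sqnorm_nonneg)
    obtain Y where Y: "half_prim Y (\<lambda>x. a * Y x - f x)" "half_L2 Y"
      "half_sqnorm Y \<le> 3 / (2 * (Re a)\<^sup>2) * ?N" "(cmod (Y 0))\<^sup>2 \<le> ?N / (2 * Re a)"
      by (rule decaying_first_order[OF r f])
    have mY: "half_L2 (\<lambda>x. - Y x)" "half_sqnorm (\<lambda>x. - Y x) = half_sqnorm Y"
      using half_L2_uminus[OF Y(2)] by (auto simp: half_sqnorm_def)
    have "(cmod (Y 0))\<^sup>2 \<le> k1 * ?N" using Y(4) by (simp add: k1_def)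
    also have "\<dots> \<le> (k1 + k2 + k3) * ?N" using k N by (intro mult_right_mono) auto
    finally have y0: "(cmod (Y 0))\<^sup>2 \<le> (k1 + k2 + k3) * ?N" .
    have "\<exists>U U1. half_sol (a\<^sup>2) f U U1 \<and> U 0 = p \<and> U1 0 = Y 0 - a * p \<and> half_L2 U \<and> half_L2 U1 \<and>
       half_sqnorm U \<le> (k1 + k2 + k3) * ((cmod p)\<^sup>2 + ?N)" for p
    proof -
      obtain U where U: "half_prim U (\<lambda>x. - a * U x - (- Y x))" "U 0 = p"
        using first_order_exists[of "\<lambda>x. - Y x" "- a" p] half_prim_loc_integrable[OF Y(1)] by blast
      have bd: "(LINT x:{0..X}|lborel. (cmod (U x))\<^sup>2) \<le> (k1 + k2 + k3) * ((cmod p)\<^sup>2 + ?N)" if X: "0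
          \<le> X" for X
      proof -
        have "Re a * (LINT x:{0..X}|lborel. (cmod (U x))\<^sup>2) \<le> (cmod p)\<^sup>2 + half_sqnorm Y / Re a"
          using energy_estimate(2)[OF U(1) X mY(1) r, unfolded mY(2) U(2), simplified]
            zero_le_power2[of "cmod (U X)"] by linarith
        also have "\<dots> \<le> (cmod p)\<^sup>2 + 3 / (2 * (Re a)\<^sup>2) * ?N / Re a"
          using divide_right_mono[OF Y(3), of "Re a"] r by simp
        finally have "(LINT x:{0..X}|lborel. (cmod (U x))\<^sup>2) \<le> ((cmod p)\<^sup>2
            + 3 / (2 * (Re a)\<^sup>2) * ?N / Re a) / Re a"
          using r by (simp add: field_simps)
        also have "\<dots> = k2 * (cmod p)\<^sup>2 + k3 * ?N"
          using r by (simp add: k2_def k3_def field_simps power2_eq_square)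
        also have "\<dots> \<le> (k1 + k2 + k3) * (cmod p)\<^sup>2 + (k1 + k2 + k3) * ?N"
          using k N by (intro add_mono mult_right_mono) auto
        finally show ?thesis by (simp add: distrib_left)
      qed
      note L = half_L2_of_bounded_integrals[OF half_prim_continuous[OF U(1)] bd]
      show ?thesis
        using half_sol_factorized[OF Y(1) U(1)] U(2) L half_L2_diff[OF Y(2) half_L2_cmult[OF L(1)]] by blast
    qed
    with y0 show "\<exists>y0. (cmod y0)\<^sup>2 \<le> (k1 + k2 + k3) * ?N \<and>
      (\<forall>p. \<exists>U U1. half_sol (a\<^sup>2) f U U1 \<and> U 0 = p \<and> U1 0 = y0 - a * p \<and> half_L2 U \<and> half_L2 U1 \<and>
       half_sqnorm U \<le> (k1 + k2 + k3) * ((cmod p)\<^sup>2 + ?N))" by blast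
  qed (use k in simp)
qed

section \<open>Homogeneous solutions and resonance\<close>

lemma half_L2_not_bounded_below:
  assumes W: "half_L2 W" and d: "0 < d" and b: "\<And>x. x0 \<le> x \<Longrightarrow> d \<le> cmod (W x)"
  shows False
proof -
  define y where "y = max x0 0"
  \<comment> \<open>So long an interval that the lower bound exceeds the total mass.\<close>
  define X where "X = y + (half_sqnorm W + 1) / d\<^sup>2"
  have yX: "y \<le> X" using d half_sqnorm_nonneg[of W] by (simp add: X_def)
  have "(LINT x|lborel. indicator {y..X} x *\<^sub>R d\<^sup>2) \<le> (LINT x|lborel. indicator {0..X} x *\<^sub>R (cmod (W x))\<^sup>2)"
  proof (rule integral_mono)
    show "integrable lborel (\<lambda>x. indicator {0..X} x *\<^sub>R (cmod (W x))\<^sup>2)"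
      using half_L2_integral_le(2)[OF W] by (simp add: set_integrable_def)
    show "integrable lborel (\<lambda>x. indicator {y..X} x *\<^sub>R d\<^sup>2)"
      using borel_integrable_atLeastAtMost'[of y X "\<lambda>x. d\<^sup>2"] by (simp add: set_integrable_def)
    have "d\<^sup>2 \<le> (cmod (W x))\<^sup>2" if "y \<le> x" for x
      using b[of x] that d by (intro power_mono) (auto simp: y_def)
    then show "indicator {y..X} x *\<^sub>R d\<^sup>2 \<le> indicator {0..X} x *\<^sub>R (cmod (W x))\<^sup>2" for x
      by (auto simp: indicator_def y_def)
  qed
  also have "\<dots> \<le> half_sqnorm W"
    using half_L2_integral_le(1)[OF W, of X] by (simp add: set_lebesgue_integral_def)
  also have "(LINT x|lborel. indicator {y..X} x *\<^sub>R d\<^sup>2) = (X - y) * d\<^sup>2"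
    using yX by simp
  also have "\<dots> = half_sqnorm W + 1" using d by (simp add: X_def)
  finally show False by simp
qed

text \<open>The two commuting factors \<open>\<partial> - a\<close> and \<open>\<partial> + a\<close> give one first-order equation each.\<close>

lemma half_sol_first_order:
  assumes "half_sol (a\<^sup>2) f U U1"
  shows "half_prim (\<lambda>x. U1 x + a * U x) (\<lambda>x. a * (U1 x + a * U x) - f x)"
    and "half_prim (\<lambda>x. U1 x - a * U x) (\<lambda>x. (- a) * (U1 x - a * U x) - f x)"
proof -
  have U: "half_prim U U1" "half_prim U1 (\<lambda>x. a\<^sup>2 * U x - f x)"
    using assms by (auto simp: half_sol_def)
  show "half_prim (\<lambda>x. U1 x + a * U x) (\<lambda>x. a * (U1 x + a * U x) - f x)"
    by (rule half_prim_cong[OF half_prim_add[OF U(2) half_prim_cmult[OF U(1)]]])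
      (auto simp: algebra_simps power2_eq_square)
  show "half_prim (\<lambda>x. U1 x - a * U x) (\<lambda>x. (- a) * (U1 x - a * U x) - f x)"
    by (rule half_prim_cong[OF half_prim_diff[OF U(2) half_prim_cmult[OF U(1)]]])
      (auto simp: algebra_simps power2_eq_square)
qed

lemma homogeneous_first_order:
  assumes "half_prim W (\<lambda>x. c * W x - 0)" "0 \<le> x"
  shows "W x = exp (c * of_real x) * W 0"
  using variation_of_constants[OF assms] by simp

text \<open>Otherwise \<open>|W x| = e\<^bsup>Re c x\<^esup> |W 0|\<close> would be bounded below by \<open>|W 0| > 0\<close>.\<close>

lemma homogeneous_first_order_zero:
  assumes W: "half_prim W (\<lambda>x. c * W x - 0)" "half_L2 W" and c: "0 \<le> Re c"
  shows "W 0 = 0"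
proof (rule ccontr)
  assume "W 0 \<noteq> 0"
  then have "0 < cmod (W 0)" by simp
  moreover have "cmod (W 0) \<le> cmod (W x)" if "0 \<le> x" for x
  proof -
    have "1 * cmod (W 0) \<le> exp (Re c * x) * cmod (W 0)"
      using c that by (intro mult_right_mono) auto
    then show ?thesis
      using homogeneous_first_order[OF W(1) that] by (simp add: norm_mult)
  qed
  ultimately show False by (rule half_L2_not_bounded_below[OF W(2)])
qed

text \<open>The function \<open>U' + a U\<close> is a multiple of \<open>e\<^sup>a\<^sup>x\<close>, hence zero, so \<open>U\<close> is a multiple of \<open>e\<^sup>-\<^sup>a\<^sup>x\<close>.  For
\<open>Re a = 0\<close> such a multiple is square-integrable only if it is zero.\<close>

lemma homogeneous_half_L2:
  assumes sol: "half_sol (a\<^sup>2) (\<lambda>x. 0) U U1" and L: "half_L2 U" "half_L2 U1" and a: "0 \<le> Re a"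
  shows "\<And>x. 0 \<le> x \<Longrightarrow> U x = exp (- a * of_real x) * U 0" "U1 0 = - a * U 0" "Re a = 0 \<Longrightarrow> U 0 = 0"
proof -
  note W = half_sol_first_order[OF sol]
  have W0: "U1 0 + a * U 0 = 0"
    by (rule homogeneous_first_order_zero[OF W(1) half_L2_add[OF L(2) half_L2_cmult[OF L(1)]] a])
  then show "U1 0 = - a * U 0" by (simp add: eq_neg_iff_add_eq_0)
  have Wx: "U1 x + a * U x = 0" if "0 \<le> x" for x
    using homogeneous_first_order[OF W(1) that] W0 by simp
  have "half_prim U (\<lambda>x. - a * U x - 0)"
    using sol Wx by (auto simp: half_sol_def elim!: half_prim_cong simp: eq_neg_iff_add_eq_0)
  then show Ux: "U x = exp (- a * of_real x) * U 0" if "0 \<le> x" for x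
    using homogeneous_first_order that by blast
  show "U 0 = 0" if "Re a = 0"
  proof (rule ccontr)
    assume "U 0 \<noteq> 0"
    then have "0 < cmod (U 0)" by simp
    moreover have "cmod (U 0) \<le> cmod (U x)" if "0 \<le> x" for x
      using Ux[OF that] \<open>Re a = 0\<close> by (simp add: norm_mult)
    ultimately show False by (rule half_L2_not_bounded_below[OF L(1)])
  qed
qed

lemma integral_inverse_one_plus:
  assumes "0 \<le> x"
  shows "(LINT y:{0..x}|lborel. complex_of_real (1 / (1 + y))) = complex_of_real (ln (1 + x))"
proof -
  have "integral\<^sup>L lborel (\<lambda>y. indicator {0..x} y *\<^sub>R (1 / (1 + y))) = ln (1 + x) - ln (1 + 0)"
  proof (rule integral_FTC_atLeastAtMost[OF assms])
    fix y :: real assume "0 \<le> y" "y \<le> x"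
    then have "((\<lambda>y. ln (1 + y)) has_real_derivative 1 / (1 + y)) (at y within {0..x})"
      by (auto intro!: derivative_eq_intros)
    then show "((\<lambda>y. ln (1 + y)) has_vector_derivative 1 / (1 + y)) (at y within {0..x})"
      by (simp add: has_real_derivative_iff_has_vector_derivative)
  qed (auto intro!: continuous_intros)
  then show ?thesis
    unfolding set_integral_complex_of_real by (simp add: set_lebesgue_integral_def)
qed

text \<open>Here \<open>W = U' + a U\<close> equals \<open>e\<^sup>a\<^sup>x (W 0 - ln (1 + x))\<close>, and \<open>|e\<^sup>a\<^sup>x| = 1\<close>.\<close>

lemma resonant_no_half_L2_solution:
  assumes sol: "half_sol (a\<^sup>2) f U U1" and L: "half_L2 U" "half_L2 U1" and a: "Re a = 0"
    and f: "\<And>x. 0 < x \<Longrightarrow> f x = exp (a * of_real x) / of_real (1 + x)"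
  shows False
proof -
  define W where "W x = U1 x + a * U x" for x
  define g where "g x = exp (a * of_real x) * complex_of_real (1 / (1 + x))" for x
  have W: "half_prim W (\<lambda>x. a * W x - g x)"
    unfolding W_def by (rule half_prim_cong[OF half_sol_first_order(1)[OF sol]]) (auto simp: f g_def)
  have W2: "half_L2 W"
    unfolding W_def by (intro half_L2_add half_L2_cmult L)
  have bd: "1 \<le> cmod (W x)" if x: "exp (cmod (W 0) + 1) \<le> x" for x
  proof -
    have x0: "0 < x" using x exp_gt_zero[of "cmod (W 0) + 1"] by linarith
    have eq: "exp (- a * of_real y) * g y = complex_of_real (1 / (1 + y))" for y
      by (simp add: g_def mult.assoc[symmetric] exp_add[symmetric])
    have "W x = exp (a * of_real x) * (W 0 - of_real (ln (1 + x)))"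
      using variation_of_constants[OF W, of x] x0 unfolding eq integral_inverse_one_plus[OF
          less_imp_le[OF x0]] by simp
    then have "cmod (W x) = cmod (W 0 - of_real (ln (1 + x)))"
      using a by (simp add: norm_mult)
    also have "\<dots> \<ge> ln (1 + x) - cmod (W 0)"
      using norm_triangle_ineq2[of "complex_of_real (ln (1 + x))" "W 0"] x0 by
          (simp add: norm_minus_commute)
    moreover have "cmod (W 0) + 1 \<le> ln (1 + x)"
    proof -
      have "ln (exp (cmod (W 0) + 1)) \<le> ln (1 + x)"
        using x by (subst ln_le_cancel_iff) (auto intro: order_trans add_pos_pos x0)
      then show ?thesis by simp
    qed
    ultimately show ?thesis by linarith
  qed
  show False by (rule half_L2_not_bounded_below[OF W2 zero_less_one bd])
qed

lemma resonant_square_integrable: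
  assumes a: "Re a = 0"
  shows "square_integrable (\<lambda>x. if 0 \<le> x then exp (a * of_real x) / of_real (1 + x) else 0)"
proof -
  have "(\<integral>\<^sup>+y. ennreal (inverse ((1 + y)\<^sup>2)) * indicator {0..} y \<partial>lborel) = ennreal (0 - (- inverse (1 + 0)))"
  proof (rule nn_integral_FTC_atLeast)
    show "((\<lambda>y. - inverse (1 + y)) has_real_derivative inverse ((1 + y)\<^sup>2)) (at y)" if "0 \<le> y" for y :: real
      using that by (auto intro!: derivative_eq_intros simp: power2_eq_square)
    have "((\<lambda>y::real. inverse (1 + y)) \<longlongrightarrow> 0) at_top"
      by (rule filterlim_compose[OF tendsto_inverse_0_at_top filterlim_tendsto_add_at_top[OF
          tendsto_const]])
        (auto intro: filterlim_ident)
    from tendsto_minus[OF this] show "((\<lambda>y::real. - inverse (1 + y)) \<longlongrightarrow> 0) at_top" by simp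
  qed auto
  moreover have "(\<integral>\<^sup>+y. ennreal (inverse ((1 + y)\<^sup>2)) * indicator {0..} y \<partial>lborel) =
      (\<integral>\<^sup>+y. ennreal (indicator {0..} y * inverse ((1 + y)\<^sup>2)) \<partial>lborel)"
    by (rule nn_integral_cong) (auto simp: indicator_def)
  ultimately have "has_bochner_integral lborel (\<lambda>y::real. indicator {0..} y * inverse ((1 + y)\<^sup>2)) 1"
    by (intro has_bochner_integral_nn_integral) auto
  moreover have "(cmod (if 0 \<le> x then exp (a * of_real x) / of_real (1 + x) else 0))\<^sup>2 =
      indicator {0..} x * inverse ((1 + x)\<^sup>2)" for x
  proof (cases "0 \<le> x")
    case True
    have "cmod (exp (a * of_real x) / of_real (1 + x)) = inverse (1 + x)"
      unfolding norm_divide norm_of_real using True a by (simp add: inverse_eq_divide)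
    then show ?thesis
      using True by (simp only: if_True power_inverse) simp
  qed simp
  ultimately show ?thesis
    by (auto simp: square_integrable_def has_bochner_integral_iff)
qed

section \<open>Damped solutions\<close>

lemma half_sqnorm_add_le:
  assumes "half_L2 u" "half_L2 v"
  shows "half_sqnorm (\<lambda>x. u x + v x) \<le> 2 * half_sqnorm u + 2 * half_sqnorm v"
proof -
  have "half_sqnorm (\<lambda>x. u x + v x) \<le>
      (LINT x|lborel. 2 * (indicator {0..} x * (cmod (u x))\<^sup>2) + 2 * (indicator {0..} x * (cmod (v x))\<^sup>2))"
    unfolding half_sqnorm_def
  proof (rule integral_mono)
    show "integrable lborel (\<lambda>x. indicator {0..} x * (cmod (u x + v x))\<^sup>2)"
      by (rule half_L2_integrable[OF half_L2_add[OF assms]])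
    show "integrable lborel (\<lambda>x. 2 * (indicator {0..} x * (cmod (u x))\<^sup>2)
        + 2 * (indicator {0..} x * (cmod (v x))\<^sup>2))"
      using half_L2_integrable[OF assms(1)] half_L2_integrable[OF assms(2)] by simp
    fix x
    have "(cmod (u x + v x))\<^sup>2 \<le> (cmod (u x) + cmod (v x))\<^sup>2"
      by (intro power_mono norm_triangle_ineq) auto
    also have "\<dots> \<le> 2 * (cmod (u x))\<^sup>2 + 2 * (cmod (v x))\<^sup>2"
      using zero_le_power2[of "cmod (u x) - cmod (v x)"] by (simp add: power2_sum power2_diff)
    finally show "indicator {0..} x * (cmod (u x + v x))\<^sup>2 \<le>
        2 * (indicator {0..} x * (cmod (u x))\<^sup>2) + 2 * (indicator {0..} x * (cmod (v x))\<^sup>2)"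
      by (auto simp: indicator_def)
  qed
  also have "\<dots> = 2 * half_sqnorm u + 2 * half_sqnorm v"
    using half_L2_integrable[OF assms(1)] half_L2_integrable[OF assms(2)] by (simp add: half_sqnorm_def)
  finally show ?thesis .
qed

lemma half_L2_exp_bound:
  assumes c: "\<And>X. continuous_on {0..X} F" and k: "0 < k"
    and b: "\<And>x. 0 \<le> x \<Longrightarrow> cmod (F x) \<le> B * exp (- (k * x))"
  shows "half_L2 F" "half_sqnorm F \<le> B\<^sup>2 / (2 * k)"
proof -
  note h = has_integral_exp_decay[of "2 * k" 0, unfolded has_bochner_integral_iff]
  have ie: "integrable lborel (\<lambda>x. B\<^sup>2 * (indicator {0..} x * exp (- (2 * k * x))))"
    and ee: "(LINT x|lborel. B\<^sup>2 * (indicator {0..} x * exp (- (2 * k * x)))) = B\<^sup>2 / (2 * k)"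
    using h k by auto
  have bd: "(LINT x:{0..X}|lborel. (cmod (F x))\<^sup>2) \<le> B\<^sup>2 / (2 * k)" for X
    unfolding set_lebesgue_integral_def ee[symmetric]
  proof (rule integral_mono[OF _ ie])
    have "set_integrable lborel {0..X} (\<lambda>x. (cmod (F x))\<^sup>2)"
      by (rule borel_integrable_atLeastAtMost') (intro continuous_intros c)
    then show "integrable lborel (\<lambda>x. indicator {0..X} x *\<^sub>R (cmod (F x))\<^sup>2)"
      by (simp add: set_integrable_def)
    fix x
    have "(cmod (F x))\<^sup>2 \<le> B\<^sup>2 * exp (- (2 * k * x))" if "0 \<le> x"
    proof -
      have "(cmod (F x))\<^sup>2 \<le> (B * exp (- (k * x)))\<^sup>2"
        using b[OF that] by (intro power_mono) auto
      also have "\<dots> = B\<^sup>2 * exp (- (2 * k * x))"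
        by (simp add: power_mult_distrib exp_double[symmetric] mult.assoc)
      finally show ?thesis .
    qed
    then show "indicator {0..X} x *\<^sub>R (cmod (F x))\<^sup>2 \<le> B\<^sup>2 * (indicator {0..} x * exp (- (2 * k * x)))"
      by (auto simp: indicator_def)
  qed
  show "half_L2 F" "half_sqnorm F \<le> B\<^sup>2 / (2 * k)"
    by (rule half_L2_of_bounded_integrals[OF c bd])+
qed

text \<open>Polynomial growth is absorbed by giving up half of the exponential decay.\<close>

lemma one_plus_square_exp_bound:
  assumes "0 \<le> (y::real)" shows "(1 + y)\<^sup>2 * exp (- y) \<le> 16 * exp (- (y / 2))"
proof -
  have "1 + y / 4 \<le> exp (y / 4)" by (rule exp_ge_add_one_self)
  then have "1 + y \<le> 4 * exp (y / 4)" using assms by linarith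
  then have "(1 + y)\<^sup>2 \<le> (4 * exp (y / 4))\<^sup>2" using assms by (intro power_mono) auto
  also have "\<dots> = 16 * exp (y / 2)"
    by (simp add: power_mult_distrib exp_double[symmetric])
  finally have "(1 + y)\<^sup>2 * exp (- y) \<le> 16 * exp (y / 2) * exp (- y)"
    by (rule mult_right_mono) simp
  also have "\<dots> = 16 * exp (- (y / 2))"
    by (simp add: mult.assoc exp_add[symmetric])
  finally show ?thesis .
qed

lemma half_prim_of_real:
  assumes d: "\<And>x. (h has_real_derivative h' x) (at x)" and c: "\<And>X. continuous_on {0..X} h'"
  shows "half_prim (\<lambda>x. complex_of_real (h x)) (\<lambda>x. complex_of_real (h' x))"
proof (rule half_prim_C1)
  show "((\<lambda>x. complex_of_real (h x)) has_vector_derivative complex_of_real (h' x)) (at x within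
      {0..})" for x
    using has_vector_derivative_of_real d has_real_derivative_iff_has_vector_derivative
      has_vector_derivative_at_within by blast
qed (intro continuous_intros c)

lemma first_order_bounded:
  assumes W: "half_prim W (\<lambda>x. c * W x - f x)" and c: "Re c = 0"
    and f: "half_L2 f" "\<And>x. R < x \<Longrightarrow> f x = 0" and x: "0 \<le> x"
  shows "cmod (W x) \<le> cmod (W 0) + (LINT y:{0..R}|lborel. cmod (f y))"
proof -
  have i: "set_integrable lborel {0..x} (\<lambda>y. exp (- c * of_real y) * f y)"
    by (rule exp_mult_set_integrable[OF half_L2_set_integrable[OF f(1) order_refl]])
  have n: "set_integrable lborel {0..t} (\<lambda>y. cmod (f y))" for t
    by (rule set_integrable_norm[OF half_L2_set_integrable[OF f(1) order_refl]])
  have "cmod (W x) = cmod (W 0 - (LINT y:{0..x}|lborel. exp (- c * of_real y) * f y))"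
    unfolding variation_of_constants[OF W x] using c by (simp add: norm_mult)
  also have "\<dots> \<le> cmod (W 0) + cmod (LINT y:{0..x}|lborel. exp (- c * of_real y) * f y)"
    by (rule norm_triangle_ineq4)
  also have "cmod (LINT y:{0..x}|lborel. exp (- c * of_real y) * f y)
      \<le> (LINT y:{0..x}|lborel. cmod (exp (- c * of_real y) * f y))"
    by (rule set_integral_norm_bound[OF i])
  also have "\<dots> = (LINT y:{0..x}|lborel. cmod (f y))"
    using c by (simp add: norm_mult)
  also have "\<dots> \<le> (LINT y:{0..R}|lborel. cmod (f y))"
    unfolding set_lebesgue_integral_def
    by (rule integral_mono[OF n[unfolded set_integrable_def] n[unfolded set_integrable_def]])
      (use f(2) in \<open>auto simp: indicator_def not_le\<close>)
  finally show ?thesis by simp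
qed

text \<open>Both \<open>U' + a U\<close> and \<open>U' - a U\<close> are bounded because \<open>Re a = 0\<close> and \<open>f\<close> is integrable, and \<open>2 U'\<close> is their
sum.  Bounding \<open>U'\<close> by way of \<open>U\<close> would lose a factor \<open>x\<close>.\<close>

lemma half_sol_growth:
  assumes sol: "half_sol (a\<^sup>2) f U U1" and a: "Re a = 0" and f: "half_L2 f" "\<And>x. R < x \<Longrightarrow> f x = 0"
  obtains C where "0 \<le> C" "\<And>x. 0 \<le> x \<Longrightarrow> cmod (U1 x) \<le> C" "\<And>x. 0 \<le> x \<Longrightarrow> cmod (U x) \<le> C * (1 + x)"
proof -
  note W = half_sol_first_order[OF sol]
  define D where "D = (LINT y:{0..R}|lborel. cmod (f y))"
  define C1 where "C1 = cmod (U1 0 + a * U 0) + D + (cmod (U1 0 - a * U 0) + D)"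
  have U1: "cmod (U1 x) \<le> C1" if "0 \<le> x" for x
  proof -
    have "cmod (U1 x + a * U x) \<le> cmod (U1 0 + a * U 0) + D" "cmod (U1 x - a * U x) \<le> cmod (U1 0
        - a * U 0) + D"
      unfolding D_def using first_order_bounded[OF W(1) a f that] first_order_bounded[OF W(2) _ f
          that] a by auto
    moreover have "cmod (2 * U1 x) \<le> cmod (U1 x + a * U x) + cmod (U1 x - a * U x)"
      using norm_triangle_ineq[of "U1 x + a * U x" "U1 x - a * U x"] by simp
    moreover have "cmod (2 * U1 x) = 2 * cmod (U1 x)" by (simp add: norm_mult)
    ultimately show ?thesis
      using norm_ge_zero[of "U1 x"] unfolding C1_def by linarith
  qed
  have C10: "0 \<le> C1" using U1[of 0] norm_ge_zero order_trans by blast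
  have U: "cmod (U x) \<le> cmod (U 0) + C1 * x" if x: "0 \<le> x" for x
  proof -
    have s: "half_prim U U1" using sol by (simp add: half_sol_def)
    note D = half_primD[OF s x]
    have "cmod (U x - U 0) \<le> (LINT y:{0..x}|lborel. cmod (U1 y))"
      unfolding D(2) by (rule set_integral_norm_bound[OF D(1)])
    also have "\<dots> \<le> (LINT y:{0..x}|lborel. C1)"
      by (rule set_integral_mono[OF set_integrable_norm[OF D(1)]])
        (use U1 borel_integrable_atLeastAtMost'[of 0 x "\<lambda>x. C1"] in auto)
    also have "\<dots> = C1 * x" using x by (simp add: set_integral_const)
    finally show ?thesis using norm_triangle_sub[of "U x" "U 0"] by linarith
  qed
  show ?thesis
  proof (rule that[of "C1 + cmod (U 0)"])
    fix x :: real assume x: "0 \<le> x"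
    show "cmod (U1 x) \<le> C1 + cmod (U 0)" using U1[OF x] norm_ge_zero[of "U 0"] by linarith
    have "0 \<le> cmod (U 0) * x" using x by simp
    then show "cmod (U x) \<le> (C1 + cmod (U 0)) * (1 + x)"
      using U[OF x] C10 by (simp add: algebra_simps)
  qed (use C10 in simp)
qed

text \<open>The solution is multiplied by \<open>m x = (1 + e x) exp (- e x)\<close> with small \<open>e > 0\<close>.  Since \<open>m 0 = 1\<close> and
\<open>m' 0 = 0\<close>, the data at \<open>0\<close> do not change, and the left half of the solution can be kept.  The
right-hand side changes by \<open>(m - 1) f - 2 m' U' - m'' U\<close>.  The first term is small because \<open>f\<close> vanishes
beyond \<open>R\<close>.  The other two have size \<open>e\<close> on an interval of length of order \<open>1 / e\<close>, because \<open>U'\<close> is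
bounded and \<open>U\<close> grows at most linearly; the square of their norm is therefore of order \<open>e\<close>.\<close>

lemma half_sol_damped:
  assumes sol: "half_sol (a\<^sup>2) f U U1" and a: "Re a = 0"
    and f: "half_L2 f" "\<And>x. R < x \<Longrightarrow> f x = 0" and d: "0 < d"
  obtains g V V1 where "half_sol (a\<^sup>2) g V V1" "V 0 = U 0" "V1 0 = U1 0" "half_L2 V" "half_L2 V1"
    "half_L2 (\<lambda>x. g x - f x)" "half_sqnorm (\<lambda>x. g x - f x) \<le> d"
proof -
  obtain C where C: "0 \<le> C" "\<And>x. 0 \<le> x \<Longrightarrow> cmod (U1 x) \<le> C" "\<And>x. 0 \<le> x \<Longrightarrow> cmod (U x) \<le> C * (1 + x)"
    using half_sol_growth[OF sol a f] by metis
  have U: "half_prim U U1" "half_prim U1 (\<lambda>x. a\<^sup>2 * U x - f x)"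
    using sol by (auto simp: half_sol_def)
  define Q where "Q = 2 * R ^ 4 * half_sqnorm f + 2048 * C\<^sup>2"
  have Q: "0 \<le> Q" using half_sqnorm_nonneg[of f] by (simp add: Q_def)
  \<comment> \<open>For \<open>e \<le> 1\<close> the squared norm of the change of the right-hand side turns out to be at most \<open>e Q\<close>.\<close>
  define e where "e = min 1 (d / (Q + 1))"
  have e: "0 < e" "e \<le> 1" "e * Q \<le> d"
  proof -
    show "0 < e" "e \<le> 1" using d Q by (auto simp: e_def)
    have "e * Q \<le> d / (Q + 1) * Q" using Q by (intro mult_right_mono) (auto simp: e_def)
    also have "\<dots> \<le> d" using Q d by (simp add: field_simps)
    finally show "e * Q \<le> d" .
  qed
  define m m1 m2 where "m x = (1 + e * x) * exp (- (e * x))" and "m1 x = - (e\<^sup>2 * x * exp (- (e * x)))"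
    and "m2 x = e\<^sup>2 * (e * x - 1) * exp (- (e * x))" for x :: real
  have dm: "(m has_real_derivative m1 x) (at x)" "(m1 has_real_derivative m2 x) (at x)" for x
    unfolding m_def[abs_def] m1_def[abs_def] m2_def
    by (auto intro!: derivative_eq_intros simp: m1_def algebra_simps power2_eq_square)
  have cm: "continuous_on S m1" "continuous_on S m2" "continuous_on S m" for S
    unfolding m_def[abs_def] m1_def[abs_def] m2_def[abs_def] by (intro continuous_intros)+
  let ?M = "\<lambda>x. complex_of_real (m x)" and ?M1 = "\<lambda>x. complex_of_real (m1 x)" and ?M2 =
      "\<lambda>x. complex_of_real (m2 x)"
  have M: "half_prim ?M ?M1" "half_prim ?M1 ?M2"
    by (intro half_prim_of_real dm cm)+
  define V V1 g where "V = (\<lambda>x. ?M x * U x)" and "V1 = (\<lambda>x. ?M1 x * U x + ?M x * U1 x)"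
    and "g = (\<lambda>x. ?M x * f x - 2 * ?M1 x * U1 x - ?M2 x * U x)"
  have V: "half_prim V V1"
    unfolding V_def V1_def by (rule half_prim_mult[OF M(1) U(1)])
  have V1: "half_prim V1 (\<lambda>x. a\<^sup>2 * V x - g x)"
    unfolding V1_def by (rule half_prim_cong[OF half_prim_add[OF half_prim_mult[OF M(2) U(1)]
        half_prim_mult[OF M(1) U(2)]]])
      (auto simp: V_def g_def algebra_simps)
  \<comment> \<open>The functions \<open>V\<close>, \<open>V1\<close> and \<open>r\<close> are bounded by multiples of \<open>(1 + e x)\<^sup>2 exp (- e x)\<close>, hence of \<open>E x\<close>.\<close>
  define E where "E x = 16 * exp (- (e / 2 * x))" for x
  have key: "(1 + e * x)\<^sup>2 * exp (- (e * x)) \<le> E x" if "0 \<le> x" for x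
    using one_plus_square_exp_bound[of "e * x"] that e by (simp add: E_def)
  have sq1: "1 + e * x \<le> (1 + e * x)\<^sup>2" "e * x \<le> (1 + e * x)\<^sup>2" "e * x * (1 + e * x) \<le> (1 + e * x)\<^sup>2"
    if "0 \<le> x" for x
    using that e by (auto simp: power2_eq_square algebra_simps)
  have bV: "cmod (V x) \<le> (16 * C / e) * exp (- (e / 2 * x))" if x: "0 \<le> x" for x
  proof -
    have mx: "0 \<le> m x" using x e by (simp add: m_def)
    have "cmod (V x) = m x * cmod (U x)" using mx by (simp add: V_def norm_mult)
    also have "\<dots> \<le> m x * (C * (1 + x))" using C(3)[OF x] mx by (rule mult_left_mono)
    also have "\<dots> \<le> m x * (C * ((1 + e * x) / e))"
    proof (intro mult_left_mono mx C(1))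
      show "1 + x \<le> (1 + e * x) / e" using e x by (simp add: field_simps)
    qed
    also have "\<dots> = C / e * ((1 + e * x)\<^sup>2 * exp (- (e * x)))"
      by (simp add: m_def power2_eq_square)
    also have "\<dots> \<le> C / e * E x" using key[OF x] C(1) e by (intro mult_left_mono) auto
    finally show ?thesis by (simp add: E_def mult_ac)
  qed
  have xm: "e\<^sup>2 * x * (1 + x) \<le> e * x * (1 + e * x)" if "0 \<le> x" for x
  proof -
    have "e * (1 + x) \<le> 1 + e * x" using e by (simp add: distrib_left)
    then have "e * x * (e * (1 + x)) \<le> e * x * (1 + e * x)"
      using that e by (intro mult_left_mono) auto
    then show ?thesis by (simp add: power2_eq_square mult_ac)
  qed
  have bV1: "cmod (V1 x) \<le> (32 * C) * exp (- (e / 2 * x))" if x: "0 \<le> x" for x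
  proof -
    have mx: "0 \<le> m x" using x e by (simp add: m_def)
    have "cmod (V1 x) \<le> cmod (?M1 x * U x) + cmod (?M x * U1 x)"
      unfolding V1_def by (rule norm_triangle_ineq)
    also have "\<dots> = e\<^sup>2 * x * exp (- (e * x)) * cmod (U x) + m x * cmod (U1 x)"
      using x mx by (simp add: norm_mult norm_power m1_def)
    also have "\<dots> \<le> e\<^sup>2 * x * exp (- (e * x)) * (C * (1 + x)) + m x * C"
      using C x mx by (intro add_mono mult_left_mono) auto
    also have "\<dots> = C * (e\<^sup>2 * x * (1 + x) + (1 + e * x)) * exp (- (e * x))"
      by (simp add: m_def algebra_simps)
    also have "\<dots> \<le> C * ((1 + e * x)\<^sup>2 + (1 + e * x)\<^sup>2) * exp (- (e * x))"
      using order_trans[OF xm[OF x] sq1(3)[OF x]] sq1(1)[OF x] C(1)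
      by (intro mult_right_mono mult_left_mono add_mono) auto
    also have "\<dots> = 2 * C * ((1 + e * x)\<^sup>2 * exp (- (e * x)))" by simp
    also have "\<dots> \<le> 2 * C * E x" using key[OF x] C(1) by (intro mult_left_mono) auto
    finally show ?thesis by (simp add: E_def)
  qed
  define r where "r = (\<lambda>x. - (2 * ?M1 x * U1 x + ?M2 x * U x))"
  have br: "cmod (r x) \<le> (32 * C * e) * exp (- (e / 2 * x))" if x: "0 \<le> x" for x
  proof -
    have m2: "\<bar>m2 x\<bar> \<le> e\<^sup>2 * (1 + e * x) * exp (- (e * x))"
    proof -
      have "0 \<le> e * x" using x e by simp
      then have "\<bar>e * x - 1\<bar> \<le> 1 + e * x" by linarith
      then show ?thesis by (auto simp: m2_def abs_mult intro!: mult_right_mono mult_left_mono)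
    qed
    have "cmod (r x) \<le> cmod (2 * ?M1 x * U1 x) + cmod (?M2 x * U x)"
      unfolding r_def norm_minus_cancel by (rule norm_triangle_ineq)
    also have "\<dots> = 2 * (e\<^sup>2 * x * exp (- (e * x))) * cmod (U1 x) + \<bar>m2 x\<bar> * cmod (U x)"
      using x by (simp add: norm_mult norm_power m1_def)
    also have "\<dots> \<le> 2 * (e\<^sup>2 * x * exp (- (e * x))) * C + (e\<^sup>2 * (1
        + e * x) * exp (- (e * x))) * (C * (1 + x))"
      using C x m2 e by (intro add_mono mult_left_mono mult_mono) auto
    also have "\<dots> = C * e * (2 * (e * x) + (1 + e * x) * (e * (1 + x))) * exp (- (e * x))"
      by (simp add: algebra_simps power2_eq_square)
    also have "\<dots> \<le> C * e * ((1 + e * x)\<^sup>2 + (1 + e * x)\<^sup>2) * exp (- (e * x))"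
    proof (intro mult_right_mono mult_left_mono add_mono)
      show "2 * (e * x) \<le> (1 + e * x)\<^sup>2" by (simp add: power2_sum)
      have "e * (1 + x) \<le> 1 + e * x" using e by (simp add: distrib_left)
      then show "(1 + e * x) * (e * (1 + x)) \<le> (1 + e * x)\<^sup>2"
        unfolding power2_eq_square using x e by (intro mult_left_mono) auto
    qed (use C e in auto)
    also have "\<dots> = 2 * C * e * ((1 + e * x)\<^sup>2 * exp (- (e * x)))" by simp
    also have "\<dots> \<le> 2 * C * e * E x" using key[OF x] C(1) e by (intro mult_left_mono) auto
    finally show ?thesis by (simp add: E_def mult_ac)
  qed
  have cU: "continuous_on {0..X} U" "continuous_on {0..X} U1" for X
    using half_prim_continuous U by auto
  have cr: "continuous_on {0..X} r" for X
    unfolding r_def by (intro continuous_intros cU cm)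
  have e2: "0 < e / 2" using e by simp
  note rL = half_L2_exp_bound[OF cr e2 br]
  define s where "s = (\<lambda>x. complex_of_real (m x - 1) * f x)"
  have m01: "\<bar>m x - 1\<bar> \<le> 1" "\<bar>m x - 1\<bar> \<le> (e * x)\<^sup>2" if x: "0 \<le> x" for x
  proof -
    have ex: "0 \<le> e * x" using x e by simp
    have 1: "m x \<le> 1"
      using exp_ge_add_one_self[of "e * x"] by (simp add: m_def exp_minus field_simps)
    have 2: "0 \<le> m x" using ex by (simp add: m_def)
    have "(1 + e * x) * (1 + - (e * x)) \<le> (1 + e * x) * exp (- (e * x))"
      using ex by (intro mult_left_mono exp_ge_add_one_self) auto
    then have 3: "1 - (e * x)\<^sup>2 \<le> m x" by (simp add: m_def algebra_simps power2_eq_square)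
    show "\<bar>m x - 1\<bar> \<le> 1" "\<bar>m x - 1\<bar> \<le> (e * x)\<^sup>2" using 1 2 3 by auto
  qed
  have mm: "m \<in> borel_measurable borel" by (rule borel_measurable_continuous_onI[OF cm(3)])
  have sL: "half_L2 s"
  proof -
    have "square_integrable (\<lambda>x. (indicator {0..} x * complex_of_real (m x
        - 1)) * (indicator {0..} x *\<^sub>R f x))"
    proof (rule square_integrable_bounded_mult[where K = 1])
      show "square_integrable (\<lambda>x. indicator {0..} x *\<^sub>R f x)" using f(1) by (simp add: half_L2_def)
      show "(\<lambda>x. indicator {0..} x * complex_of_real (m x - 1)) \<in> borel_measurable lborel"
        using mm by measurable
      show "cmod (indicator {0..} x * complex_of_real (m x - 1)) \<le> 1" for x
        using m01(1)[of x] by (auto simp: indicator_def norm_of_real simp del: of_real_diff)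
    qed
    moreover have "(\<lambda>x. (indicator {0..} x * complex_of_real (m x
        - 1)) * (indicator {0..} x *\<^sub>R f x)) = (\<lambda>x. indicator {0..} x *\<^sub>R s x)"
      by (auto simp: s_def indicator_def)
    ultimately show ?thesis by (simp add: half_L2_def)
  qed
  have sN: "half_sqnorm s \<le> e ^ 4 * R ^ 4 * half_sqnorm f"
  proof -
    have "half_sqnorm s \<le> (LINT x|lborel. e ^ 4 * R ^ 4 * (indicator {0..} x * (cmod (f x))\<^sup>2))"
      unfolding half_sqnorm_def
    proof (rule integral_mono[OF half_L2_integrable[OF sL]])
      show "integrable lborel (\<lambda>x. e ^ 4 * R ^ 4 * (indicator {0..} x * (cmod (f x))\<^sup>2))"
        using half_L2_integrable[OF f(1)] by simp
      fix x
      have "(cmod (s x))\<^sup>2 \<le> e ^ 4 * R ^ 4 * (cmod (f x))\<^sup>2" if x: "0 \<le> x"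
      proof (cases "R < x")
        case True then show ?thesis using f(2) by (simp add: s_def)
      next
        case False
        have "(m x - 1)\<^sup>2 \<le> ((e * x)\<^sup>2)\<^sup>2"
          using m01(2)[OF x] by (metis abs_ge_zero power2_abs power_mono)
        also have "\<dots> = e ^ 4 * x ^ 4" by (simp add: power_mult_distrib)
        also have "\<dots> \<le> e ^ 4 * R ^ 4" using False x e by (intro mult_left_mono power_mono) auto
        finally have "(m x - 1)\<^sup>2 * (cmod (f x))\<^sup>2 \<le> e ^ 4 * R ^ 4 * (cmod (f x))\<^sup>2"
          by (rule mult_right_mono) simp
        then show ?thesis by (simp add: s_def norm_mult power_mult_distrib del: of_real_diff)
      qed
      then show "indicator {0..} x * (cmod (s x))\<^sup>2 \<le> e ^ 4 * R ^ 4 * (indicator {0..} x * (cmod (f x))\<^sup>2)"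
        by (auto simp: indicator_def)
    qed
    then show ?thesis by (simp add: half_sqnorm_def)
  qed
  have gf: "(\<lambda>x. g x - f x) = (\<lambda>x. s x + r x)"
    by (auto simp: g_def s_def r_def algebra_simps)
  have "half_sqnorm (\<lambda>x. g x - f x) \<le> 2 * half_sqnorm s + 2 * half_sqnorm r"
    unfolding gf by (rule half_sqnorm_add_le[OF sL rL(1)])
  also have "\<dots> \<le> 2 * (e ^ 4 * R ^ 4 * half_sqnorm f) + 2 * ((32 * C * e)\<^sup>2 / (2 * (e / 2)))"
    using sN rL(2) by linarith
  also have "(32 * C * e)\<^sup>2 / (2 * (e / 2)) = 1024 * C\<^sup>2 * e"
    using e by (simp add: field_simps power2_eq_square)
  also have "2 * (e ^ 4 * R ^ 4 * half_sqnorm f) \<le> 2 * (e * R ^ 4 * half_sqnorm f)"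
  proof -
    have "e ^ 4 \<le> e ^ 1" using e by (intro power_decreasing) auto
    then have "e ^ 4 * (R ^ 4 * half_sqnorm f) \<le> e * (R ^ 4 * half_sqnorm f)"
      using half_sqnorm_nonneg[of f] by (intro mult_right_mono) auto
    then show ?thesis by (simp add: mult.assoc)
  qed
  also have "2 * (e * R ^ 4 * half_sqnorm f) + 2 * (1024 * C\<^sup>2 * e) = e * Q"
    by (simp add: Q_def algebra_simps)
  also have "\<dots> \<le> d" by (rule e(3))
  finally have "half_sqnorm (\<lambda>x. g x - f x) \<le> d" by simp
  moreover have "half_L2 (\<lambda>x. g x - f x)"
    unfolding gf by (rule half_L2_add[OF sL rL(1)])
  moreover have "half_L2 V"
    by (rule half_L2_exp_bound(1)[OF half_prim_continuous[OF V] e2 bV])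
  moreover have "half_L2 V1"
    by (rule half_L2_exp_bound(1)[OF half_prim_continuous[OF V1] e2 bV1])
  moreover have "half_sol (a\<^sup>2) g V V1" using V V1 by (simp add: half_sol_def)
  moreover have "V 0 = U 0" "V1 0 = U1 0"
    by (simp_all add: V_def V1_def m_def m1_def)
  ultimately show ?thesis using that by blast
qed

text \<open>The initial value is chosen so that the solution vanishes at \<open>R\<close>, and hence beyond.\<close>

lemma first_order_compact:
  assumes f: "\<And>x. 0 \<le> x \<Longrightarrow> set_integrable lborel {0..x} f" and z: "\<And>x. R < x \<Longrightarrow> f x = 0" and R: "0 \<le> R"
  obtains W where "half_prim W (\<lambda>x. c * W x - f x)" "\<And>x. R \<le> x \<Longrightarrow> W x = 0"
proof -
  let ?p = "LINT y:{0..R}|lborel. exp (- c * of_real y) * f y"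
  obtain W where W: "half_prim W (\<lambda>x. c * W x - f x)"
    "\<And>x. W x = exp (c * of_real x) * (?p - (LINT y:{0..x}|lborel. exp (- c * of_real y) * f y))"
    by (rule first_order_exists[of f c ?p]) (erule f, rule that)
  have eq: "(LINT y:{0..x}|lborel. exp (- c * of_real y) * f y) = ?p" if "R \<le> x" for x
    unfolding set_lebesgue_integral_def
    by (rule Bochner_Integration.integral_cong) (use that z in \<open>auto simp: indicator_def\<close>)
  have "W x = 0" if "R \<le> x" for x
    unfolding W(2)[of x] eq[OF that] by simp
  then show ?thesis by (rule that[OF W(1)])
qed

lemma half_L2_compact:
  assumes c: "\<And>X. continuous_on {0..X} F" and z: "\<And>x. R < x \<Longrightarrow> F x = 0"
  shows "half_L2 F"
proof (rule half_L2_of_bounded_integrals(1)[OF c])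
  have i: "set_integrable lborel {0..X} (\<lambda>x. (cmod (F x))\<^sup>2)" for X
    by (rule borel_integrable_atLeastAtMost') (intro continuous_intros c)
  show "(LINT x:{0..X}|lborel. (cmod (F x))\<^sup>2) \<le> (LINT x:{0..R}|lborel. (cmod (F x))\<^sup>2)" for X
    unfolding set_lebesgue_integral_def
    by (rule integral_mono[OF i[unfolded set_integrable_def] i[unfolded set_integrable_def]])
      (use z in \<open>auto simp: indicator_def not_le\<close>)
qed

text \<open>Both first-order equations are solved backwards from \<open>R\<close>, so the solution has compact support.\<close>

lemma half_sol_compact:
  assumes f: "half_L2 f" and z: "\<And>x. R < x \<Longrightarrow> f x = 0" and R: "0 \<le> R"
  obtains U U1 where "half_sol (b\<^sup>2) f U U1" "half_L2 U" "half_L2 U1"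
proof -
  obtain Y where Y: "half_prim Y (\<lambda>x. b * Y x - f x)" "\<And>x. R \<le> x \<Longrightarrow> Y x = 0"
    by (rule first_order_compact[of f R b]) (use half_L2_set_integrable[OF f] z R in auto)
  obtain U where U: "half_prim U (\<lambda>x. - b * U x - (- Y x))" "\<And>x. R \<le> x \<Longrightarrow> U x = 0"
    by (rule first_order_compact[of "\<lambda>x. - Y x" R "- b"]) (use half_prim_loc_integrable[OF Y(1)]
        Y(2) R in auto)
  have "half_L2 Y" "half_L2 U"
    by (rule half_L2_compact[OF half_prim_continuous, of _ _ R]; use Y U in force)+
  then show ?thesis
    using that[OF half_sol_factorized[OF Y(1) U(1)]] half_L2_diff half_L2_cmult by blast
qed

lemma half_sol_cauchy:
  assumes f: "half_L2 f"
  obtains U U1 where "half_sol (a\<^sup>2) f U U1" "U 0 = p" "U1 0 = p1"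
proof -
  obtain Y where Y: "half_prim Y (\<lambda>x. a * Y x - f x)" "Y 0 = p1 + a * p"
    using half_L2_set_integrable[OF f order_refl] by (rule first_order_exists[of f a "p1
        + a * p"]) (rule that)
  obtain U where U: "half_prim U (\<lambda>x. - a * U x - (- Y x))" "U 0 = p"
    using half_prim_loc_integrable[OF Y(1)] by (rule first_order_exists[of "\<lambda>x. - Y x" "- a" p]) (rule that)
  show ?thesis
    using that[OF half_sol_factorized[OF Y(1) U(1)]] Y U by simp
qed

lemma line_sol_reflect:
  "line_sol qp qm f U U1 \<Longrightarrow> line_sol qm qp (\<lambda>x. f (- x)) (\<lambda>x. U (- x)) (\<lambda>x. - U1 (- x))"
  by (simp add: line_sol_def)

section \<open>Solutions on the line\<close>

lemma half_sol_cong: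
  assumes "half_sol q f U U1" "\<And>x. 0 < x \<Longrightarrow> f x = g x"
    "\<And>x. 0 \<le> x \<Longrightarrow> U x = V x" "\<And>x. 0 \<le> x \<Longrightarrow> U1 x = V1 x"
  shows "half_sol q g V V1"
proof -
  have U: "half_prim U U1" "half_prim U1 (\<lambda>x. q * U x - f x)"
    using assms(1) by (auto simp: half_sol_def)
  show ?thesis
    unfolding half_sol_def
    using half_prim_cong[OF U(1), of V V1] half_prim_cong[OF U(2), of V1 "\<lambda>x. q * V x - g x"] assms(2-4)
    by simp
qed

lemma half_L2_cong:
  assumes "half_L2 f" "\<And>x. 0 \<le> x \<Longrightarrow> f x = g x"
  shows "half_L2 g" "half_sqnorm g = half_sqnorm f"
proof -
  have "(\<lambda>x. indicator {0..} x *\<^sub>R f x) = (\<lambda>x. indicator {0..} x *\<^sub>R g x)"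
    "(\<lambda>x. indicator {0..} x * (cmod (f x))\<^sup>2) = (\<lambda>x. indicator {0..} x * (cmod (g x))\<^sup>2)"
    using assms(2) by (auto simp: fun_eq_iff indicator_def)
  then show "half_L2 g" "half_sqnorm g = half_sqnorm f"
    using assms(1) by (auto simp: half_L2_def half_sqnorm_def)
qed

text \<open>Solutions on the two sides that agree at \<open>0\<close> to first order make up a solution on the line.  The sign
in the second condition comes from the reflection.\<close>

lemma line_sol_glue:
  assumes p: "half_sol qp f P P1" "half_L2 P" "half_L2 P1"
    and m: "half_sol qm (\<lambda>x. f (- x)) N N1" "half_L2 N" "half_L2 N1"
    and eq: "N 0 = P 0" "N1 0 = - P1 0"
  obtains U U1 where "line_sol qp qm f U U1" "square_integrable U" "square_integrable U1"
    "(LINT x|lborel. (cmod (U x))\<^sup>2) = half_sqnorm P + half_sqnorm N"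
proof -
  define U U1 where "U x = (if 0 \<le> x then P x else N (- x))"
    and "U1 x = (if 0 \<le> x then P1 x else - N1 (- x))" for x
  have UN: "N x = U (- x)" "N1 x = - U1 (- x)" if "0 \<le> x" for x
    using that eq by (auto simp: U_def U1_def)
  have "half_sol qp f U U1"
    by (rule half_sol_cong[OF p(1)]) (auto simp: U_def U1_def)
  moreover have "half_sol qm (\<lambda>x. f (- x)) (\<lambda>x. U (- x)) (\<lambda>x. - U1 (- x))"
    by (rule half_sol_cong[OF m(1)]) (auto simp: UN)
  moreover have hU: "half_L2 U" "half_sqnorm U = half_sqnorm P"
    by (rule half_L2_cong[OF p(2)], simp add: U_def)+
  moreover have hU': "half_L2 (\<lambda>x. U (- x))" "half_sqnorm (\<lambda>x. U (- x)) = half_sqnorm N"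
    by (rule half_L2_cong[OF m(2)], simp add: UN)+
  moreover have hU1: "half_L2 U1"
    by (rule half_L2_cong[OF p(3)]) (simp add: U1_def)
  moreover have "half_L2 (\<lambda>x. U1 (- x))"
    by (rule half_L2_cong(1)[OF half_L2_uminus[OF m(3)]]) (simp add: UN)
  ultimately show ?thesis
    using that square_integrable_from_halves[of U] square_integrable_from_halves(1)[of U1]
    by (simp add: line_sol_def)
qed

lemma square_integrable_halves:
  assumes "square_integrable f"
  shows "half_L2 f" "half_L2 (\<lambda>x. f (- x))"
    "(LINT x|lborel. (cmod (f x))\<^sup>2) = half_sqnorm f + half_sqnorm (\<lambda>x. f (- x))"
proof -
  show h: "half_L2 f" "half_L2 (\<lambda>x. f (- x))"
    using assms square_integrable_reflect square_integrable_half_L2 by auto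
  show "(LINT x|lborel. (cmod (f x))\<^sup>2) = half_sqnorm f + half_sqnorm (\<lambda>x. f (- x))"
    by (rule square_integrable_from_halves(2)[OF h])
qed

lemma line_resolvent:
  assumes a: "0 < Re a" and b: "0 < Re b"
  obtains K where "0 \<le> K" "\<And>f. square_integrable f \<Longrightarrow> \<exists>U U1. line_sol (a\<^sup>2) (b\<^sup>2) f U U1 \<and>
    square_integrable U \<and> square_integrable U1 \<and>
    (LINT x|lborel. (cmod (U x))\<^sup>2) \<le> K * (LINT x|lborel. (cmod (f x))\<^sup>2)"
proof -
  obtain K1 where K1: "0 \<le> K1" "\<And>f. half_L2 f \<Longrightarrow> \<exists>y0. (cmod y0)\<^sup>2 \<le> K1 * half_sqnorm f \<and>
    (\<forall>p. \<exists>U U1. half_sol (a\<^sup>2) f U U1 \<and> U 0 = p \<and> U1 0 = y0 - a * p \<and> half_L2 U \<and> half_L2 U1 \<and>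
       half_sqnorm U \<le> K1 * ((cmod p)\<^sup>2 + half_sqnorm f))"
    using half_resolvent[OF a] by blast
  obtain K2 where K2: "0 \<le> K2" "\<And>f. half_L2 f \<Longrightarrow> \<exists>y0. (cmod y0)\<^sup>2 \<le> K2 * half_sqnorm f \<and>
    (\<forall>p. \<exists>U U1. half_sol (b\<^sup>2) f U U1 \<and> U 0 = p \<and> U1 0 = y0 - b * p \<and> half_L2 U \<and> half_L2 U1 \<and>
       half_sqnorm U \<le> K2 * ((cmod p)\<^sup>2 + half_sqnorm f))"
    using half_resolvent[OF b] by blast
  have ab: "a + b \<noteq> 0" using a b by (metis add_pos_pos less_numeral_extra(3) plus_complex.simps(1)
      zero_complex.simps(1))
  define k where "k = 2 * (K1 + K2) / (cmod (a + b))\<^sup>2"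
  have k: "0 \<le> k" using K1 K2 by (simp add: k_def)
  define K where "K = (K1 + K2) * (2 * k + 1)"
  show ?thesis
  proof (rule that[of K])
    show "0 \<le> K" using K1 K2 k by (simp add: K_def)
    fix f assume f: "square_integrable f"
    note h = square_integrable_halves[OF f]
    let ?P = "half_sqnorm f" and ?M = "half_sqnorm (\<lambda>x. f (- x))"
    let ?N = "LINT x|lborel. (cmod (f x))\<^sup>2"
    have nn: "0 \<le> ?P" "0 \<le> ?M" "?P \<le> ?N" "?M \<le> ?N"
      using half_sqnorm_nonneg[of f] half_sqnorm_nonneg[of "\<lambda>x. f (- x)"] h(3) by auto
    obtain yp where yp: "(cmod yp)\<^sup>2 \<le> K1 * ?P"
      "\<And>p. \<exists>U U1. half_sol (a\<^sup>2) f U U1 \<and> U 0 = p \<and> U1 0 = yp - a * p \<and> half_L2 U \<and> half_L2 U1 \<and>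
       half_sqnorm U \<le> K1 * ((cmod p)\<^sup>2 + ?P)"
      using K1(2)[OF h(1)] by blast
    obtain ym where ym: "(cmod ym)\<^sup>2 \<le> K2 * ?M"
      "\<And>p. \<exists>U U1. half_sol (b\<^sup>2) (\<lambda>x. f (- x)) U U1 \<and> U 0 = p \<and> U1 0 = ym - b * p \<and> half_L2 U \<and> half_L2 U1 \<and>
       half_sqnorm U \<le> K2 * ((cmod p)\<^sup>2 + ?M)"
      using K2(2)[OF h(2)] by blast
    \<comment> \<open>The value at \<open>0\<close> for which the two one-sided derivatives \<open>yp - a p\<close> and \<open>b p - ym\<close> agree.\<close>
    define p where "p = (yp + ym) / (a + b)"
    obtain P P1 where P: "half_sol (a\<^sup>2) f P P1" "P 0 = p" "P1 0 = yp - a * p" "half_L2 P" "half_L2 P1"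
       "half_sqnorm P \<le> K1 * ((cmod p)\<^sup>2 + ?P)"
      using yp(2)[of p] by blast
    obtain M M1 where M: "half_sol (b\<^sup>2) (\<lambda>x. f (- x)) M M1" "M 0 = p" "M1 0 = ym - b * p"
        "half_L2 M" "half_L2 M1"
       "half_sqnorm M \<le> K2 * ((cmod p)\<^sup>2 + ?M)"
      using ym(2)[of p] by blast
    have "(a + b) * p = yp + ym" using ab by (simp add: p_def)
    then have match: "M1 0 = - P1 0" unfolding P M by (simp add: algebra_simps eq_neg_iff_add_eq_0)
    obtain U U1 where U: "line_sol (a\<^sup>2) (b\<^sup>2) f U U1" "square_integrable U" "square_integrable U1"
      "(LINT x|lborel. (cmod (U x))\<^sup>2) = half_sqnorm P + half_sqnorm M"
      by (rule line_sol_glue[OF P(1,4,5) M(1,4,5) _ match]) (use P M in auto)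
    have "(cmod p)\<^sup>2 \<le> k * ?N"
    proof -
      have "(cmod (yp + ym))\<^sup>2 \<le> (cmod yp + cmod ym)\<^sup>2"
        by (intro power_mono norm_triangle_ineq) auto
      also have "\<dots> \<le> 2 * (cmod yp)\<^sup>2 + 2 * (cmod ym)\<^sup>2"
        using zero_le_power2[of "cmod yp - cmod ym"] by (simp add: power2_sum power2_diff)
      also have "\<dots> \<le> 2 * (K1 * ?N) + 2 * (K2 * ?N)"
        using yp(1) ym(1) mult_left_mono[OF nn(3) K1(1)] mult_left_mono[OF nn(4) K2(1)] by linarith
      finally have "(cmod (yp + ym))\<^sup>2 \<le> 2 * (K1 + K2) * ?N" by (simp add: algebra_simps)
      then show ?thesis
        unfolding p_def k_def norm_divide power_divide by (simp add: divide_right_mono)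
    qed
    then have le: "(cmod p)\<^sup>2 + ?P \<le> (k + 1) * ?N" "(cmod p)\<^sup>2 + ?M \<le> (k + 1) * ?N"
      using nn by (auto simp: algebra_simps)
    have "half_sqnorm P + half_sqnorm M \<le> K1 * ((k + 1) * ?N) + K2 * ((k + 1) * ?N)"
      using P(6) M(6) mult_left_mono[OF le(1) K1(1)] mult_left_mono[OF le(2) K2(1)] by linarith
    also have "\<dots> = (K1 + K2) * (k + 1) * ?N" by (simp add: algebra_simps)
    also have "\<dots> \<le> K * ?N"
      unfolding K_def using K1 K2 k nn by (intro mult_right_mono mult_left_mono) auto
    finally have "(LINT x|lborel. (cmod (U x))\<^sup>2) \<le> K * ?N"
      unfolding U(4) .
    then show "\<exists>U U1. line_sol (a\<^sup>2) (b\<^sup>2) f U U1 \<and> square_integrable U \<and> square_integrable U1 \<and>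
        (LINT x|lborel. (cmod (U x))\<^sup>2) \<le> K * ?N"
      using U(1-3) by blast
  qed
qed

text \<open>The difference \<open>D\<close> satisfies \<open>D' 0 = - a D 0\<close> from the right and \<open>D' 0 = b D 0\<close> from the left, so
\<open>(a + b) D 0 = 0\<close>.\<close>

lemma line_sol_unique:
  assumes U: "line_sol (a\<^sup>2) (b\<^sup>2) f U U1" "square_integrable U" "square_integrable U1"
    and V: "line_sol (a\<^sup>2) (b\<^sup>2) f V V1" "square_integrable V" "square_integrable V1"
    and a: "0 \<le> Re a" and b: "0 \<le> Re b"
  shows "U = V"
proof -
  define D D1 where "D x = U x - V x" and "D1 x = U1 x - V1 x" for x
  have diff: "half_sol q (\<lambda>x. 0) (\<lambda>x. u x - v x) (\<lambda>x. u1 x - v1 x)"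
    if "half_sol q g u u1" "half_sol q g v v1" for q g u u1 v v1
  proof -
    have "half_prim (\<lambda>x. u1 x - v1 x) (\<lambda>x. (q * u x - g x) - (q * v x - g x))"
      using that unfolding half_sol_def by (intro half_prim_diff) blast+
    then have "half_prim (\<lambda>x. u1 x - v1 x) (\<lambda>x. q * (u x - v x) - 0)"
      by (rule half_prim_cong) (auto simp: algebra_simps)
    then show ?thesis using that half_prim_diff unfolding half_sol_def by auto
  qed
  have solp: "half_sol (a\<^sup>2) (\<lambda>x. 0) D D1"
    using diff[of "a\<^sup>2" f U U1 V V1] U(1) V(1) by (simp add: line_sol_def D_def[abs_def] D1_def[abs_def])
  have solm: "half_sol (b\<^sup>2) (\<lambda>x. 0) (\<lambda>x. D (- x)) (\<lambda>x. - D1 (- x))"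
    using diff[of "b\<^sup>2" "\<lambda>x. f (- x)" "\<lambda>x. U (- x)" "\<lambda>x. - U1 (- x)" "\<lambda>x. V (- x)" "\<lambda>x.
        - V1 (- x)"] U(1) V(1)
    by (simp add: line_sol_def D_def D1_def)
  have DL: "square_integrable D" "square_integrable D1"
    unfolding D_def[abs_def] D1_def[abs_def] using U V by (auto intro: square_integrable_diff)
  note Hp = homogeneous_half_L2[OF solp square_integrable_halves(1)[OF DL(1)]
      square_integrable_halves(1)[OF DL(2)] a]
  note Hm = homogeneous_half_L2[OF solm square_integrable_halves(2)[OF DL(1)] half_L2_uminus[OF
      square_integrable_halves(2)[OF DL(2)]] b]
  have "D 0 = 0"
  proof (rule ccontr)
    assume "D 0 \<noteq> 0"
    have "D1 0 = - a * D 0" "- D1 0 = - b * D 0" using Hp(2) Hm(2) by simp_all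
    \<comment> \<open>As \<open>Re a\<close> and \<open>Re b\<close> are nonnegative, \<open>a + b = 0\<close> is possible only if both are zero, and then
      \<open>D 0 = 0\<close>.\<close>
    then have "(a + b) * D 0 = 0" by (simp add: algebra_simps)
    with \<open>D 0 \<noteq> 0\<close> have "a + b = 0" by simp
    then have "Re a + Re b = 0" by (metis plus_complex.simps(1) zero_complex.simps(1))
    then have "Re a = 0" using a b by linarith
    then show False using Hp(3) \<open>D 0 \<noteq> 0\<close> by simp
  qed
  then have "D x = 0" for x
    using Hp(1)[of x] Hm(1)[of "- x"] by (cases "0 \<le> x") auto
  then show ?thesis by (auto simp: D_def)
qed

lemma square_integrable_truncation:
  assumes f: "square_integrable f" and d: "0 < d"
  obtains n :: nat where "(LINT x|lborel. (cmod (indicator {-real n..real n} x *\<^sub>R f x - f x))\<^sup>2) \<le> d"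
proof -
  have [measurable]: "f \<in> borel_measurable borel" using f by (simp add: square_integrable_def)
  have "(\<lambda>n. LINT x|lborel. (cmod (indicator {-real n..real n} x *\<^sub>R f x - f x))\<^sup>2)
      \<longlonglongrightarrow> (LINT x|(lborel::real measure). (0::real))"
  proof (rule integral_dominated_convergence[where w = "\<lambda>x. (cmod (f x))\<^sup>2"])
    show "integrable lborel (\<lambda>x. (cmod (f x))\<^sup>2)" using f by (simp add: square_integrable_def)
    have "(\<lambda>n. (cmod (indicator {-real n..real n} x *\<^sub>R f x - f x))\<^sup>2) \<longlonglongrightarrow> 0" for x
    proof (rule tendsto_eventually)
      obtain N where "\<bar>x\<bar> \<le> real N" using real_arch_simple by blast
      then have "indicator {-real n..real n} x = (1::real)" if "N \<le> n" for n
        using that by (auto simp: indicator_def abs_le_iff)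
      then show "\<forall>\<^sub>F n in sequentially. (cmod (indicator {-real n..real n} x *\<^sub>R f x - f x))\<^sup>2 = 0"
        unfolding eventually_sequentially by (intro exI[of _ N]) simp
    qed
    then show "AE x in lborel. (\<lambda>n. (cmod (indicator {-real n..real n} x *\<^sub>R f x - f x))\<^sup>2) \<longlonglongrightarrow> 0" by simp
    show "AE x in lborel. norm ((cmod (indicator {-real n..real n} x *\<^sub>R f x - f x))\<^sup>2) \<le> (cmod (f x))\<^sup>2" for n
      by (auto simp: indicator_def)
  qed measurable
  then have "\<forall>\<^sub>F n in sequentially. (LINT x|lborel. (cmod (indicator {-real n..real n} x *\<^sub>R f x
      - f x))\<^sup>2) < d"
    using d by (intro order_tendstoD(2)) auto
  then show ?thesis using that by (auto simp: eventually_sequentially intro: less_imp_le)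
qed

text \<open>After truncation of \<open>f\<close>, the equation is solved from left to right, starting with zero at the left
end of the support.  What comes out on the right need not be square-integrable, but it can be damped.\<close>

lemma line_range_dense:
  assumes a: "Re a = 0" and f: "square_integrable f" and d: "0 < d"
  obtains g U U1 where "square_integrable g" "square_integrable U" "square_integrable U1"
    "line_sol (a\<^sup>2) (b\<^sup>2) g U U1" "(LINT x|lborel. (cmod (g x - f x))\<^sup>2) \<le> d"
proof -
  obtain n :: nat where n: "(LINT x|lborel. (cmod (indicator {-real n..real n} x *\<^sub>R f x - f x))\<^sup>2) \<le> d / 4"
    using square_integrable_truncation[OF f, of "d / 4"] d by auto
  define h where "h x = indicator {-real n..real n} x *\<^sub>R f x" for x
  have h: "square_integrable h"
    unfolding h_def[abs_def] scaleR_conv_of_real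
    by (rule square_integrable_bounded_mult[where K = 1, OF f]) (auto simp: indicator_def)
  have hz: "h x = 0" "h (- x) = 0" if "real n < x" for x
    using that by (auto simp: h_def)
  note hh = square_integrable_halves[OF h]
  obtain M M1 where M: "half_sol (b\<^sup>2) (\<lambda>x. h (- x)) M M1" "half_L2 M" "half_L2 M1"
    by (rule half_sol_compact[OF hh(2) hz(2)]) auto
  obtain P P1 where P: "half_sol (a\<^sup>2) h P P1" "P 0 = M 0" "P1 0 = - M1 0"
    by (rule half_sol_cauchy[OF hh(1)])
  have d4: "0 < d / 4" using d by simp
  obtain k Q Q1 where Q: "half_sol (a\<^sup>2) k Q Q1" "Q 0 = P 0" "Q1 0 = P1 0" "half_L2 Q" "half_L2 Q1"
    "half_L2 (\<lambda>x. k x - h x)" "half_sqnorm (\<lambda>x. k x - h x) \<le> d / 4"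
    by (rule half_sol_damped[OF P(1) a hh(1) _ d4]) (erule hz(1), rule that)
  \<comment> \<open>The right-hand side is changed only where the solution is damped.\<close>
  define g where "g x = h x + indicator {0..} x *\<^sub>R (k x - h x)" for x
  have gs: "square_integrable g"
    unfolding g_def[abs_def] using Q(6) h by (intro square_integrable_add) (auto simp: half_L2_def)
  have Qg: "half_sol (a\<^sup>2) g Q Q1"
    by (rule half_sol_cong[OF Q(1)]) (auto simp: g_def)
  have Mg: "half_sol (b\<^sup>2) (\<lambda>x. g (- x)) M M1"
    by (rule half_sol_cong[OF M(1)]) (auto simp: g_def)
  obtain U U1 where U: "line_sol (a\<^sup>2) (b\<^sup>2) g U U1" "square_integrable U" "square_integrable U1"
    by (rule line_sol_glue[OF Qg Q(4,5) Mg M(2,3)]) (use P Q in auto)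
  have hf: "square_integrable (\<lambda>x. h x - f x)" and gh: "square_integrable (\<lambda>x. g x - h x)" and gf:
      "square_integrable (\<lambda>x. g x - f x)"
    using f h gs by (auto intro: square_integrable_diff)
  have ghd: "(LINT x|lborel. (cmod (g x - h x))\<^sup>2) \<le> d / 4"
  proof -
    have "g x - h x = indicator {0..} x *\<^sub>R (k x - h x)" for x by (simp add: g_def)
    then show ?thesis using Q(7) by (simp only: half_sqnorm_def indicator_cmod_sq[of "{0..}" _
        "\<lambda>x. k x - h x"])
  qed
  have "(LINT x|lborel. (cmod (g x - f x))\<^sup>2) \<le>
      (LINT x|lborel. 2 * (cmod (g x - h x))\<^sup>2 + 2 * (cmod (h x - f x))\<^sup>2)"
  proof (rule integral_mono)
    fix x
    have "(cmod (g x - f x))\<^sup>2 \<le> (cmod (g x - h x) + cmod (h x - f x))\<^sup>2"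
      using norm_triangle_ineq[of "g x - h x" "h x - f x"] by (intro power_mono) auto
    also have "\<dots> \<le> 2 * (cmod (g x - h x))\<^sup>2 + 2 * (cmod (h x - f x))\<^sup>2"
      using zero_le_power2[of "cmod (g x - h x) - cmod (h x - f x)"] by (simp add: power2_sum power2_diff)
    finally show "(cmod (g x - f x))\<^sup>2 \<le> 2 * (cmod (g x - h x))\<^sup>2 + 2 * (cmod (h x - f x))\<^sup>2" .
  qed (use gf gh hf in \<open>auto simp: square_integrable_def\<close>)
  also have "\<dots> = 2 * (LINT x|lborel. (cmod (g x - h x))\<^sup>2) + 2 * (LINT x|lborel. (cmod (h x - f x))\<^sup>2)"
    using gh hf by (simp add: square_integrable_def)
  also have "\<dots> \<le> d" using ghd n unfolding h_def[symmetric] by simp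
  finally show ?thesis using that gs U by blast
qed

section \<open>Purely continuous spectrum from dense proper ranges\<close>

text \<open>The kernel is trivial and the range is everything, so its only algebraic complement is trivial.\<close>

lemma resolvent_set_imp_Deltas:
  fixes S :: "'a::complex_normed_vector unbounded_op"
  assumes z: "z \<in> resolvent_set S"
  shows "z \<in> Delta1 S" "z \<in> Delta2 S" "z \<in> Delta3 S" "z \<in> Delta4 S"
proof -
  let ?T = "shift_op S z"
  obtain K where ran: "Ran ?T = UNIV" and K: "\<forall>u\<in>Dom S. norm u \<le> K * norm (act ?T u)"
    using z by (auto simp: resolvent_set_def)
  have dom: "Dom ?T = Dom S" by (simp add: shift_op_def)
  have "0 \<in> Ran ?T" using ran by simp
  then obtain u where u: "u \<in> Dom S" "act ?T u = 0"
    by (auto simp: Ran_def dom)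
  have zero: "v = 0" if "v \<in> Dom S" "act ?T v = 0" for v
    using K that by fastforce
  have ker: "Ker ?T = {0}"
    unfolding Ker_def dom using u zero by auto
  have f0: "finite_cdim ({0} :: 'a set)"
    unfolding finite_cdim_def by (intro exI[of _ "{}"]) simp
  have ac: "algebraic_complement (UNIV :: 'a set) C \<longleftrightarrow> C = {0}" for C
    unfolding algebraic_complement_def
    using complex_vector.subspace_single_0 by auto
  have "complex_vector.dim {0::'a} \<le> card ({} :: 'a set)"
    by (rule complex_vector.dim_le_card) simp_all
  then have d0: "complex_vector.dim {0::'a} = 0" by simp
  have c0: "ccodim (UNIV :: 'a set) = 0"
    unfolding ccodim_def ac using d0 by simp
  have fc: "finite_ccodim (UNIV :: 'a set)"
    unfolding finite_ccodim_def ac using f0 by blast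
  show "z \<in> Delta1 S" "z \<in> Delta2 S" "z \<in> Delta3 S" "z \<in> Delta4 S"
    by (auto simp: Delta1_def Delta2_def Delta3_def Delta4_def semi_Fredholm_def Fredholm_def
        Fredholm_index_def ran ker f0 fc c0 d0)
qed

text \<open>A dense proper subspace is not closed, and closedness of the range is part of the definition of all
the sets \<open>\<Delta>\<^sub>1\<close> to \<open>\<Delta>\<^sub>4\<close>.  All four are therefore equal to the resolvent set, and so is \<open>\<Delta>\<^sub>5\<close>, since
each component of \<open>\<Delta>\<^sub>1\<close> is a nonempty subset of the resolvent set.\<close>

lemma purely_continuous_spectrum:
  fixes S :: "'a::complex_normed_vector unbounded_op"
  assumes out: "\<And>z. z \<notin> A \<Longrightarrow> z \<in> resolvent_set S"
    and inside: "\<And>z. z \<in> A \<Longrightarrow> op_injective (shift_op S z)"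
      "\<And>z. z \<in> A \<Longrightarrow> closure (Ran (shift_op S z)) = UNIV"
      "\<And>z. z \<in> A \<Longrightarrow> Ran (shift_op S z) \<noteq> UNIV"
  shows "spectrum S = A \<and> point_spectrum S = {} \<and> residual_spectrum S = {} \<and> continuous_spectrum S = A \<and>
    ess_spectrum1 S = A \<and> ess_spectrum2 S = A \<and> ess_spectrum3 S = A \<and> ess_spectrum4 S = A
        \<and> ess_spectrum5 S = A"
proof -
  have ran: "op_injective (shift_op S z)" "Ran (shift_op S z) = UNIV" if "z \<notin> A" for z
    using out[OF that] by (auto simp: resolvent_set_def)
  have rho: "resolvent_set S = - A"
    using out inside(3) by (auto simp: resolvent_set_def)
  have nc: "\<not> closed (Ran (shift_op S z))" if "z \<in> A" for z
    using inside(2,3)[OF that] closure_closed by metis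
  have D: "Delta1 S = - A" "Delta2 S = - A" "Delta3 S = - A" "Delta4 S = - A"
    using resolvent_set_imp_Deltas[of _ S] nc unfolding rho
    by (auto simp: Delta1_def Delta2_def Delta3_def Delta4_def semi_Fredholm_def Fredholm_def)
  have D5: "Delta5 S = - A"
  proof -
    have "{C \<in> components (Delta1 S). C \<inter> resolvent_set S \<noteq> {}} = components (- A)"
      unfolding D rho using in_components_nonempty in_components_subset by blast
    then show ?thesis unfolding Delta5_def by simp
  qed
  have "closure (UNIV :: 'a set) = UNIV" by simp
  then have cs: "continuous_spectrum S = A" and rs: "residual_spectrum S = {}" and ps:
      "point_spectrum S = {}"
    using ran inside by (fastforce simp: continuous_spectrum_def residual_spectrum_def point_spectrum_def)+
  show ?thesis
    using D D5 rho cs rs ps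
    by (simp add: spectrum_def ess_spectrum1_def ess_spectrum2_def ess_spectrum3_def
        ess_spectrum4_def ess_spectrum5_def)
qed

section \<open>The spectrum of the Schroedinger operator\<close>

text \<open>The values of \<^const>\<open>csqrt\<close> have nonnegative real part, and the square of \<open>w\<close> is real and nonpositive iff
\<open>Re w = 0\<close>.\<close>

lemma mem_half_line_iff: "z \<in> half_line C \<longleftrightarrow> Re (csqrt (C - z)) = 0"
proof
  assume "z \<in> half_line C"
  then obtain t where t: "t \<ge> 0" "z = C + of_real t" by (auto simp: half_line_def)
  then have "C - z = - of_real t" by simp
  then show "Re (csqrt (C - z)) = 0"
    using t by (simp add: csqrt.simps)
next
  assume h: "Re (csqrt (C - z)) = 0"
  define w where "w = csqrt (C - z)"
  have "C - z = w\<^sup>2" by (simp add: w_def)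
  also have "w\<^sup>2 = - of_real ((Im w)\<^sup>2)"
    using h unfolding w_def[symmetric] by (simp add: complex_eq_iff power2_eq_square)
  finally have w2: "C - z = - of_real ((Im w)\<^sup>2)" .
  have "z = C - (C - z)" by simp
  then have "z = C + of_real ((Im w)\<^sup>2)" unfolding w2 by simp
  moreover have "0 \<le> (Im w)\<^sup>2" by simp
  ultimately show "z \<in> half_line C" unfolding half_line_def mem_Collect_eq by (intro exI conjI)
qed

lemma Re_csqrt_nonneg: "0 \<le> Re (csqrt w)"
  using csqrt_principal[of w] by auto

lemma norm_abs_L2_line: "square_integrable f \<Longrightarrow> norm (abs_L2_line f) = sqrt (LINT x|lborel. (cmod (f x))\<^sup>2)"
  by (simp add: norm_L2_line.abs_eq eq_AE_refl)

lemma schroedinger_eq_iff_line_sol_csqrt: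
  assumes "square_integrable f"
  shows "u \<in> H2_line \<and> act (shift_op (step_schroedinger Vp Vm) z) u = abs_L2_line f \<longleftrightarrow>
    (\<exists>U U1. square_integrable U \<and> square_integrable U1 \<and> u = abs_L2_line U \<and>
       line_sol ((csqrt (Vp - z))\<^sup>2) ((csqrt (Vm - z))\<^sup>2) f U U1)"
  using schroedinger_eq_iff_line_sol[OF assms, of u Vp Vm z] by simp

lemma schroedinger_injective: "op_injective (shift_op (step_schroedinger Vp Vm) z)"
  unfolding op_injective_def Dom_shift
proof (rule inj_onI)
  fix u v assume uv: "u \<in> H2_line" "v \<in> H2_line" "act (shift_op (step_schroedinger Vp Vm) z) u
      = act (shift_op (step_schroedinger Vp Vm) z) v"
  obtain f where f: "square_integrable f" "act (shift_op (step_schroedinger Vp Vm) z) u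
      = abs_L2_line f" by (rule abs_L2_line_cases)
  obtain U U1 where U: "square_integrable U" "square_integrable U1" "u = abs_L2_line U"
    "line_sol ((csqrt (Vp - z))\<^sup>2) ((csqrt (Vm - z))\<^sup>2) f U U1"
    using schroedinger_eq_iff_line_sol_csqrt[OF f(1), of u Vp Vm z] uv f by blast
  obtain V V1 where V: "square_integrable V" "square_integrable V1" "v = abs_L2_line V"
    "line_sol ((csqrt (Vp - z))\<^sup>2) ((csqrt (Vm - z))\<^sup>2) f V V1"
    using schroedinger_eq_iff_line_sol_csqrt[OF f(1), of v Vp Vm z] uv f by metis
  show "u = v"
    using line_sol_unique[OF U(4,1,2) V(4,1,2) Re_csqrt_nonneg Re_csqrt_nonneg] U V by simp
qed

lemma schroedinger_range_mem_iff:
  assumes "square_integrable f"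
  shows "abs_L2_line f \<in> Ran (shift_op (step_schroedinger Vp Vm) z) \<longleftrightarrow> (\<exists>U U1. square_integrable U
      \<and> square_integrable U1 \<and>
       line_sol ((csqrt (Vp - z))\<^sup>2) ((csqrt (Vm - z))\<^sup>2) f U U1)"
  unfolding Ran_def Dom_shift using schroedinger_eq_iff_line_sol_csqrt[OF assms] by
      (auto simp: image_iff) metis+

lemma schroedinger_resolvent:
  assumes "z \<notin> half_line Vp \<union> half_line Vm"
  shows "z \<in> resolvent_set (step_schroedinger Vp Vm)"
proof -
  have re: "0 < Re (csqrt (Vp - z))" "0 < Re (csqrt (Vm - z))"
    using assms Re_csqrt_nonneg[of "Vp - z"] Re_csqrt_nonneg[of "Vm - z"]
    unfolding Un_iff mem_half_line_iff by linarith+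
  obtain K where K: "0 \<le> K" "\<And>f. square_integrable f \<Longrightarrow> \<exists>U U1. line_sol ((csqrt (Vp
      - z))\<^sup>2) ((csqrt (Vm - z))\<^sup>2) f U U1 \<and>
    square_integrable U \<and> square_integrable U1 \<and>
    (LINT x|lborel. (cmod (U x))\<^sup>2) \<le> K * (LINT x|lborel. (cmod (f x))\<^sup>2)"
    using line_resolvent[OF re] by blast
  have "w \<in> Ran (shift_op (step_schroedinger Vp Vm) z)" for w
  proof -
    obtain f where f: "square_integrable f" "w = abs_L2_line f" by (rule abs_L2_line_cases)
    show ?thesis using K(2)[OF f(1)] schroedinger_range_mem_iff[OF f(1), of Vp Vm z] f(2) by blast
  qed
  moreover have "norm u \<le> sqrt K * norm (act (shift_op (step_schroedinger Vp Vm) z) u)" if u: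
      "u \<in> H2_line" for u
  proof -
    obtain f where f: "square_integrable f" "act (shift_op (step_schroedinger Vp Vm) z) u
        = abs_L2_line f" by (rule abs_L2_line_cases)
    obtain U U1 where U: "square_integrable U" "square_integrable U1"
      "line_sol ((csqrt (Vp - z))\<^sup>2) ((csqrt (Vm - z))\<^sup>2) f U U1"
      and le: "(LINT x|lborel. (cmod (U x))\<^sup>2) \<le> K * (LINT x|lborel. (cmod (f x))\<^sup>2)"
      using K(2)[OF f(1)] by blast
    have "abs_L2_line U \<in> H2_line" "act (shift_op (step_schroedinger Vp Vm) z) (abs_L2_line U)
        = act (shift_op (step_schroedinger Vp Vm) z) u"
      using schroedinger_eq_iff_line_sol_csqrt[OF f(1), of "abs_L2_line U" Vp Vm z] U f(2) by auto
    then have "u = abs_L2_line U"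
      using schroedinger_injective[of Vp Vm z] u by (simp add: op_injective_def Dom_shift inj_on_def)
    then have "norm u = sqrt (LINT x|lborel. (cmod (U x))\<^sup>2)"
      using norm_abs_L2_line[OF U(1)] by simp
    also have "\<dots> \<le> sqrt (K * (LINT x|lborel. (cmod (f x))\<^sup>2))"
      using le by (rule real_sqrt_le_mono)
    also have "\<dots> = sqrt K * norm (act (shift_op (step_schroedinger Vp Vm) z) u)"
      unfolding f(2) norm_abs_L2_line[OF f(1)] by (rule real_sqrt_mult)
    finally show ?thesis .
  qed
  ultimately show ?thesis
    using schroedinger_injective by (auto simp: resolvent_set_def step_schroedinger_def)
qed

text \<open>If \<open>Re a = 0\<close>, the resonant function is supported on the right, otherwise its reflection is used.\<close>

lemma schroedinger_range_not_UNIV: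
  assumes "z \<in> half_line Vp \<union> half_line Vm"
  shows "Ran (shift_op (step_schroedinger Vp Vm) z) \<noteq> UNIV"
proof
  assume ran: "Ran (shift_op (step_schroedinger Vp Vm) z) = UNIV"
  let ?h = "\<lambda>a x. if 0 \<le> x then exp (a * of_real x) / of_real (1 + x) else (0::complex)"
  have sol: "\<exists>U U1. square_integrable U \<and> square_integrable U1 \<and>
       line_sol ((csqrt (Vp - z))\<^sup>2) ((csqrt (Vm - z))\<^sup>2) f U U1" if "square_integrable f" for f
    using schroedinger_range_mem_iff[OF that, of Vp Vm z] ran by simp
  consider "Re (csqrt (Vp - z)) = 0" | "Re (csqrt (Vm - z)) = 0"
    using assms by (auto simp: mem_half_line_iff)
  then show False
  proof cases
    case 1
    let ?a = "csqrt (Vp - z)"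
    obtain U U1 where U: "square_integrable U" "square_integrable U1" "line_sol (?a\<^sup>2) ((csqrt (Vm
        - z))\<^sup>2) (?h ?a) U U1"
      using sol[OF resonant_square_integrable[OF 1]] by blast
    show False
      by (rule resonant_no_half_L2_solution[of ?a "?h ?a" U U1])
        (use U 1 in \<open>auto simp: line_sol_def intro: square_integrable_halves\<close>)
  next
    case 2
    let ?b = "csqrt (Vm - z)"
    obtain U U1 where U: "square_integrable U" "square_integrable U1"
      "line_sol ((csqrt (Vp - z))\<^sup>2) (?b\<^sup>2) (\<lambda>x. ?h ?b (- x)) U U1"
      using sol[OF square_integrable_reflect[OF resonant_square_integrable[OF 2]]] by blast
    show False
      by (rule resonant_no_half_L2_solution[of ?b "\<lambda>x. ?h ?b (- (- x))" "\<lambda>x. U (- x)" "\<lambda>x. - U1 (- x)"])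
        (use U 2 in \<open>auto simp: line_sol_def intro: square_integrable_halves half_L2_uminus\<close>)
  qed
qed

text \<open>If it is the left side that is in resonance, the problem is reflected.\<close>

lemma schroedinger_range_dense:
  assumes "z \<in> half_line Vp \<union> half_line Vm"
  shows "closure (Ran (shift_op (step_schroedinger Vp Vm) z)) = UNIV"
proof -
  have "w \<in> closure (Ran (shift_op (step_schroedinger Vp Vm) z))" for w
    unfolding closure_approachable
  proof (intro allI impI)
    fix e :: real assume e: "0 < e"
    obtain f where f: "square_integrable f" "w = abs_L2_line f" by (rule abs_L2_line_cases)
    have d: "0 < (e / 2)\<^sup>2" using e by simp
    have "\<exists>g. square_integrable g \<and> abs_L2_line g \<in> Ran (shift_op (step_schroedinger Vp Vm) z)
        \<and> (LINT x|lborel. (cmod (g x - f x))\<^sup>2) \<le> (e / 2)\<^sup>2"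
    proof (cases "Re (csqrt (Vp - z)) = 0")
      case True
      obtain g U U1 where g: "square_integrable g" and U: "square_integrable U" "square_integrable U1"
        and s: "line_sol ((csqrt (Vp - z))\<^sup>2) ((csqrt (Vm - z))\<^sup>2) g U U1"
        and le: "(LINT x|lborel. (cmod (g x - f x))\<^sup>2) \<le> (e / 2)\<^sup>2"
        by (rule line_range_dense[OF True f(1) d])
      then show ?thesis
        using schroedinger_range_mem_iff[OF g, of Vp Vm z] by blast
    next
      case False
      then have b: "Re (csqrt (Vm - z)) = 0" using assms by (auto simp: mem_half_line_iff)
      obtain g U U1 where g: "square_integrable g" and U: "square_integrable U" "square_integrable U1"
        and s: "line_sol ((csqrt (Vm - z))\<^sup>2) ((csqrt (Vp - z))\<^sup>2) g U U1"
        and le: "(LINT x|lborel. (cmod (g x - f (- x)))\<^sup>2) \<le> (e / 2)\<^sup>2"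
        by (rule line_range_dense[OF b square_integrable_reflect[OF f(1)] d])
      note g' = square_integrable_reflect[OF g]
      have "abs_L2_line (\<lambda>x. g (- x)) \<in> Ran (shift_op (step_schroedinger Vp Vm) z)"
        unfolding schroedinger_range_mem_iff[OF g', of Vp Vm z]
        using line_sol_reflect[OF s] square_integrable_reflect[OF U(1)]
          square_integrable_uminus[OF square_integrable_reflect[OF U(2)]] by blast
      moreover have "(LINT x|lborel. (cmod (g (- x) - f x))\<^sup>2) \<le> (e / 2)\<^sup>2"
        using le lborel_integral_real_affine[of "-1" "\<lambda>x. (cmod (g x - f (- x)))\<^sup>2" 0] by simp
      ultimately show ?thesis using g' by blast
    qed
    then obtain g where g: "square_integrable g" "abs_L2_line g \<in> Ran (shift_op (step_schroedinger
        Vp Vm) z)"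
      and le: "(LINT x|lborel. (cmod (g x - f x))\<^sup>2) \<le> (e / 2)\<^sup>2" by blast
    have "dist (abs_L2_line g) w = sqrt (LINT x|lborel. (cmod (g x - f x))\<^sup>2)"
      using f g square_integrable_diff[OF g(1) f(1)]
      by (simp add: dist_norm minus_L2_line.abs_eq norm_abs_L2_line eq_AE_refl)
    also have "\<dots> \<le> sqrt ((e / 2)\<^sup>2)" using le by (rule real_sqrt_le_mono)
    also have "\<dots> = e / 2" using e by simp
    also have "\<dots> < e" using e by simp
    finally show "\<exists>y\<in>Ran (shift_op (step_schroedinger Vp Vm) z). dist y w < e" using g(2) by blast
  qed
  then show ?thesis by auto
qed

theorem theorem2p4:
  fixes Vp Vm :: complex
  shows "spectrum (step_schroedinger Vp Vm) = half_line Vp \<union> half_line Vm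
    \<and> point_spectrum (step_schroedinger Vp Vm) = {}
    \<and> residual_spectrum (step_schroedinger Vp Vm) = {}
    \<and> continuous_spectrum (step_schroedinger Vp Vm) = half_line Vp \<union> half_line Vm
    \<and> ess_spectrum1 (step_schroedinger Vp Vm) = half_line Vp \<union> half_line Vm
    \<and> ess_spectrum2 (step_schroedinger Vp Vm) = half_line Vp \<union> half_line Vm
    \<and> ess_spectrum3 (step_schroedinger Vp Vm) = half_line Vp \<union> half_line Vm
    \<and> ess_spectrum4 (step_schroedinger Vp Vm) = half_line Vp \<union> half_line Vm
    \<and> ess_spectrum5 (step_schroedinger Vp Vm) = half_line Vp \<union> half_line Vm"
  by (rule purely_continuous_spectrum)
    (simp_all only: schroedinger_resolvent schroedinger_injective schroedinger_range_dense
      schroedinger_range_not_UNIV not_False_eq_True)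

end
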